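(* Consider the unified inventory problem described in the context, under the $\alpha$-degree polynomial holding cost assumption: for every element $i\in\mathcal{N}$ and all periods $1\le s\le t\le T$, $h^i_{st}=(t-s)^{\alpha}\,\bar h^i_t$ for some base per-unit holding cost $\bar h^i_t>0$ and some $\alpha\ge 1$. Suppose that the joint ordering cost function $f$ is $\beta$-approximate fractional subadditive, and that a $\gamma$-approximate solution to the LP relaxation of (IP) can be found in polynomial time. Then there is a polynomial-time $\mathcal{O}\!\left(\alpha\beta\gamma\cdot\frac{\log T}{\log\log T}\right)$-approximation algorithm for the integer program (IP), i.e. a polynomial-time algorithm that outputs a feasible solution of (IP) whose cost is at most $\mathcal{O}\!\left(\alpha\beta\gamma\cdot\frac{\log T}{\log\log T}\right)$ times the optimal value of (IP).
   Context: Unified problem: there are $N$ elements $\mathcal{N}=\{1,\dots,N\}$ and $T$ periods $\mathcal{T}=\{1,\dots,T\}$. For each $i\in\mathcal{N}$, $t\in\mathcal{T}$ there is a known demand $d_{it}\ge 0$; $\mathcal{D}$ is the set of demand points $(i,t)$ with $d_{it}>0$. In each period an order for a subset $S\subseteq\mathcal{N}$ of elements may be placed, costing $f(S)$ (the joint ordering cost, a set function $f:2^{\mathcal{N}}\to\mathbb{R}_{\ge 0}$). Every demand point $(i,t)\in\mathcal{D}$ must be served by an order containing $i$ placed in some period $s\le t$ (no backlogging); serving it from period $s$ incurs holding cost $H^i_{st}:=d_{it}h^i_{st}$, where $h^i_{st}\ge 0$ is nonincreasing in $s$ for each fixed $(i,t)$. The goal is to minimize total ordering plus holding cost. Integer program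 (IP): variables $y^S_s\in\{0,1\}$ ($S\subseteq\mathcal{N}$, $s\in\mathcal{T}$; $1$ iff set $S$ is ordered in period $s$) and $x^i_{st}\in\{0,1\}$ ($(i,t)\in\mathcal{D}$, $1\le s\le t$; $1$ iff $(i,t)$ is served from period $s$); minimize $\sum_{S\subseteq\mathcal{N}}\sum_{s=1}^T f(S)y^S_s+\sum_{(i,t)\in\mathcal{D}}\sum_{s=1}^t H^i_{st}x^i_{st}$ subject to $\sum_{s=1}^t x^i_{st}=1$ for all $(i,t)\in\mathcal{D}$, and $x^i_{st}\le\sum_{S:\,i\in S\subseteq\mathcal{N}}y^S_s$ for all $(i,t)\in\mathcal{D}$, $1\le s\le t$. The LP relaxation of (IP) replaces the integrality constraints by nonnegativity constraints. A feasible LP solution is $\gamma$-approximate if its objective value is at most $\gamma$ times the optimal LP value. The set function $f$ is $\beta$-approximate fractional subadditive if for every $S\subseteq\mathcal{N}$ and every collection of weighted subsets $\{(S_j,\lambda_j)\}$ with $0\le\lambda_j\le 1$ and $\sum_{j:\,v\in S_j}\lambda_j\ge 1$ for every $v\in S$, we have $f(S)\le\beta\sum_j\lambda_j f(S_j)$. *)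

theory Defs
  imports Complex_Main "HOL-Library.Log_Nat"
begin

section \<open>Polynomial-time computation\<close>

text \<open>
  The machine model is a deterministic while-language over nested lists of integers, with an
  oracle and the logarithmic cost criterion: evaluating an expression or calling the oracle is
  charged at least the bit size of all operands and results. Hence no value can be larger than the
  input plus the time spent, and up to polynomial factors the time is that of a multitape
  (oracle) Turing machine.
\<close>

datatype data = Num int | Lst "data list"

primrec data_size :: "data \<Rightarrow> nat" where
  "data_size (Num k) = Suc (floorlog 2 (nat \<bar>k\<bar>))"
| "data_size (Lst vs) = Suc (sum_list (map data_size vs))"

datatype binop = Add | Sub | Mul | Div | Less | Equal | Push

datatype unop = Head | Tail | IsNum

datatype expr = Var nat | Lit data | Unop unop expr | Binop binop expr expr

definition of_truth :: "bool \<Rightarrow> data" where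
  "of_truth b = Num (if b then 1 else 0)"

definition truth :: "data \<Rightarrow> bool" where
  "truth v \<longleftrightarrow> v \<noteq> Num 0"

text \<open>Operations applied to data of the wrong shape return default values.\<close>

fun num_of :: "data \<Rightarrow> int" where
  "num_of (Num k) = k"
| "num_of (Lst vs) = 0"

fun list_of :: "data \<Rightarrow> data list" where
  "list_of (Num k) = []"
| "list_of (Lst vs) = vs"

fun eval_unop :: "unop \<Rightarrow> data \<Rightarrow> data" where
  "eval_unop Head v = (case list_of v of [] \<Rightarrow> Lst [] | w # ws \<Rightarrow> w)"
| "eval_unop Tail v = Lst (tl (list_of v))"
| "eval_unop IsNum v = of_truth (\<exists>k. v = Num k)"

fun eval_binop :: "binop \<Rightarrow> data \<Rightarrow> data \<Rightarrow> data" where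
  "eval_binop Add v w = Num (num_of v + num_of w)"
| "eval_binop Sub v w = Num (num_of v - num_of w)"
| "eval_binop Mul v w = Num (num_of v * num_of w)"
| "eval_binop Div v w = Num (num_of v div num_of w)"
| "eval_binop Less v w = of_truth (num_of v < num_of w)"
| "eval_binop Equal v w = of_truth (v = w)"
| "eval_binop Push v w = Lst (v # list_of w)"

type_synonym store = "nat \<Rightarrow> data"

primrec eval_expr :: "store \<Rightarrow> expr \<Rightarrow> data" where
  "eval_expr \<sigma> (Var n) = \<sigma> n"
| "eval_expr \<sigma> (Lit v) = v"
| "eval_expr \<sigma> (Unop p e) = eval_unop p (eval_expr \<sigma> e)"
| "eval_expr \<sigma> (Binop p e1 e2) = eval_binop p (eval_expr \<sigma> e1) (eval_expr \<sigma> e2)"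

primrec cost_expr :: "store \<Rightarrow> expr \<Rightarrow> nat" where
  "cost_expr \<sigma> (Var n) = data_size (\<sigma> n)"
| "cost_expr \<sigma> (Lit v) = data_size v"
| "cost_expr \<sigma> (Unop p e) = cost_expr \<sigma> e + data_size (eval_expr \<sigma> (Unop p e))"
| "cost_expr \<sigma> (Binop p e1 e2) =
     cost_expr \<sigma> e1 + cost_expr \<sigma> e2 + data_size (eval_expr \<sigma> (Binop p e1 e2))"

datatype com =
    Skip
  | Assign nat expr
  | Query nat expr
  | Then com com
  | IfElse expr com com
  | Loop expr com

text \<open>\<open>exec \<phi> c \<sigma> n \<sigma>'\<close>: with oracle \<open>\<phi>\<close>, the program \<open>c\<close> started in \<open>\<sigma>\<close> halts in \<open>\<sigma>'\<close> in time \<open>n\<close>.\<close>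

inductive exec :: "(data \<Rightarrow> data) \<Rightarrow> com \<Rightarrow> store \<Rightarrow> nat \<Rightarrow> store \<Rightarrow> bool"
  for \<phi> :: "data \<Rightarrow> data" where
  Skip: "exec \<phi> Skip \<sigma> 1 \<sigma>"
| Assign: "exec \<phi> (Assign v e) \<sigma> (1 + cost_expr \<sigma> e) (\<sigma>(v := eval_expr \<sigma> e))"
| Query: "w = \<phi> (eval_expr \<sigma> e) \<Longrightarrow>
    exec \<phi> (Query v e) \<sigma> (1 + cost_expr \<sigma> e + data_size w) (\<sigma>(v := w))"
| Then: "exec \<phi> c1 \<sigma> n1 \<sigma>1 \<Longrightarrow> exec \<phi> c2 \<sigma>1 n2 \<sigma>2 \<Longrightarrow> exec \<phi> (Then c1 c2) \<sigma> (n1 + n2) \<sigma>2"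
| IfTrue: "truth (eval_expr \<sigma> e) \<Longrightarrow> exec \<phi> c1 \<sigma> n \<sigma>' \<Longrightarrow>
    exec \<phi> (IfElse e c1 c2) \<sigma> (1 + cost_expr \<sigma> e + n) \<sigma>'"
| IfFalse: "\<not> truth (eval_expr \<sigma> e) \<Longrightarrow> exec \<phi> c2 \<sigma> n \<sigma>' \<Longrightarrow>
    exec \<phi> (IfElse e c1 c2) \<sigma> (1 + cost_expr \<sigma> e + n) \<sigma>'"
| LoopFalse: "\<not> truth (eval_expr \<sigma> e) \<Longrightarrow> exec \<phi> (Loop e c) \<sigma> (1 + cost_expr \<sigma> e) \<sigma>"
| LoopTrue: "truth (eval_expr \<sigma> e) \<Longrightarrow> exec \<phi> c \<sigma> n1 \<sigma>1 \<Longrightarrow> exec \<phi> (Loop e c) \<sigma>1 n2 \<sigma>2 \<Longrightarrow>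
    exec \<phi> (Loop e c) \<sigma> (1 + cost_expr \<sigma> e + n1 + n2) \<sigma>2"

inductive_cases SkipE: "exec \<phi> Skip \<sigma> n \<sigma>'"
inductive_cases AssignE: "exec \<phi> (Assign v e) \<sigma> n \<sigma>'"
inductive_cases QueryE: "exec \<phi> (Query v e) \<sigma> n \<sigma>'"
inductive_cases ThenE: "exec \<phi> (Then c1 c2) \<sigma> n \<sigma>'"
inductive_cases IfElseE: "exec \<phi> (IfElse e c1 c2) \<sigma> n \<sigma>'"
inductive_cases LoopE: "exec \<phi> (Loop e c) \<sigma> n \<sigma>'"

lemma exec_deterministic:
  "exec \<phi> c \<sigma> n \<sigma>' \<Longrightarrow> exec \<phi> c \<sigma> m \<sigma>'' \<Longrightarrow> m = n \<and> \<sigma>'' = \<sigma>'"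
proof (induction arbitrary: m \<sigma>'' rule: exec.induct)
  case (Skip \<sigma>)
  then show ?case by (rule SkipE) simp
next
  case (Assign v e \<sigma>)
  then show ?case by (rule AssignE) simp
next
  case (Query w e \<sigma> v)
  from Query.prems show ?case by (rule QueryE) (simp add: Query.hyps)
next
  case (Then c1 \<sigma> n1 \<sigma>1 c2 n2 \<sigma>2)
  from Then.prems show ?case by (rule ThenE) (metis Then.IH)
next
  case (IfTrue \<sigma> e c1 n \<sigma>' c2)
  from IfTrue.prems show ?case by (rule IfElseE) (auto simp: IfTrue.hyps(1) dest: IfTrue.IH)
next
  case (IfFalse \<sigma> e c2 n \<sigma>' c1)
  from IfFalse.prems show ?case by (rule IfElseE) (auto simp: IfFalse.hyps(1) dest: IfFalse.IH)
next
  case (LoopFalse \<sigma> e c)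
  from LoopFalse.prems show ?case by (rule LoopE) (auto simp: LoopFalse.hyps(1))
next
  case (LoopTrue \<sigma> e c n1 \<sigma>1 n2 \<sigma>2)
  from LoopTrue.prems show ?case by (rule LoopE) (auto simp: LoopTrue.hyps(1) dest!: LoopTrue.IH)
qed

definition init_store :: "data \<Rightarrow> store" where
  "init_store v = (\<lambda>_. Lst [])(0 := v)"

text \<open>
  A search problem with instance set \<open>P\<close>: an instance \<open>p\<close> is given by its input \<open>enc p\<close> and its
  oracle \<open>orc p\<close>, and the admissible outputs are those satisfying \<open>ok p\<close>. One program must solve
  all instances in time polynomial in the input size.
\<close>

definition poly_time_solvable ::
    "('p \<Rightarrow> data) \<Rightarrow> ('p \<Rightarrow> data \<Rightarrow> data) \<Rightarrow> 'p set \<Rightarrow> ('p \<Rightarrow> data \<Rightarrow> bool) \<Rightarrow> bool" where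
  "poly_time_solvable enc orc P ok \<longleftrightarrow>
     (\<exists>c a k. \<forall>p\<in>P. \<exists>n \<sigma>. exec (orc p) c (init_store (enc p)) n \<sigma>
        \<and> n \<le> a * data_size (enc p) ^ k \<and> ok p (\<sigma> 0))"


section \<open>The unified inventory problem\<close>

text \<open>
  \<open>holding I i s t\<close> is the per-unit cost h of serving (i,t) from period s and \<open>base I i t\<close> the base
  per-unit holding cost. Demands and base costs are rational because they are part of the finite
  input. The ordering cost is an arbitrary real set function; algorithms get access to it through
  the finite description \<open>descr I\<close> (for instance a metric) and the oracle \<open>orc I\<close> (for instance a
  value oracle).
\<close>

record inventory =
  elems :: nat
  horizon :: nat
  demand :: "nat \<Rightarrow> nat \<Rightarrow> rat"
  base :: "nat \<Rightarrow> nat \<Rightarrow> rat"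
  holding :: "nat \<Rightarrow> nat \<Rightarrow> nat \<Rightarrow> real"
  order_cost :: "nat set \<Rightarrow> real"
  descr :: data
  orc :: "data \<Rightarrow> data"

definition inventory_problem :: "inventory \<Rightarrow> bool" where
  "inventory_problem I \<longleftrightarrow>
     1 \<le> elems I \<and> 1 \<le> horizon I
     \<and> (\<forall>i\<in>{1..elems I}. \<forall>t\<in>{1..horizon I}. 0 \<le> demand I i t)
     \<and> (\<forall>S\<subseteq>{1..elems I}. 0 \<le> order_cost I S)
     \<and> (\<forall>i\<in>{1..elems I}. \<forall>t\<in>{1..horizon I}. \<forall>s\<in>{1..t}. 0 \<le> holding I i s t)
     \<and> (\<forall>i\<in>{1..elems I}. \<forall>t\<in>{1..horizon I}. \<forall>r\<in>{1..t}. \<forall>s\<in>{1..t}.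
          r \<le> s \<longrightarrow> holding I i s t \<le> holding I i r t)"

definition polynomial_holding :: "real \<Rightarrow> inventory \<Rightarrow> bool" where
  "polynomial_holding \<alpha> I \<longleftrightarrow>
     (\<forall>i\<in>{1..elems I}. \<forall>t\<in>{1..horizon I}. 0 < base I i t
        \<and> (\<forall>s\<in>{1..t}. holding I i s t = real (t - s) powr \<alpha> * of_rat (base I i t)))"

definition fractional_subadditive :: "real \<Rightarrow> nat \<Rightarrow> (nat set \<Rightarrow> real) \<Rightarrow> bool" where
  "fractional_subadditive \<beta> N f \<longleftrightarrow>
     (\<forall>S\<subseteq>{1..N}. \<forall>(J :: nat set) (C :: nat \<Rightarrow> nat set) (l :: nat \<Rightarrow> real).
        finite J \<longrightarrow> (\<forall>j\<in>J. C j \<subseteq> {1..N} \<and> 0 \<le> l j \<and> l j \<le> 1) \<longrightarrow>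
        (\<forall>v\<in>S. 1 \<le> (\<Sum>j\<in>{j\<in>J. v \<in> C j}. l j)) \<longrightarrow>
        f S \<le> \<beta> * (\<Sum>j\<in>J. l j * f (C j)))"

definition demand_points :: "inventory \<Rightarrow> (nat \<times> nat) set" where
  "demand_points I = {(i, t). i \<in> {1..elems I} \<and> t \<in> {1..horizon I} \<and> 0 < demand I i t}"

definition holding_cost :: "inventory \<Rightarrow> nat \<Rightarrow> nat \<Rightarrow> nat \<Rightarrow> real" where
  "holding_cost I i s t = of_rat (demand I i t) * holding I i s t"

type_synonym y_vars = "nat set \<Rightarrow> nat \<Rightarrow> real"
type_synonym x_vars = "nat \<Rightarrow> nat \<Rightarrow> nat \<Rightarrow> real"

text \<open>The variables are \<open>y S s\<close> and \<open>x i s t\<close>; their values outside the index ranges are ignored.\<close>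

definition objective :: "inventory \<Rightarrow> y_vars \<Rightarrow> x_vars \<Rightarrow> real" where
  "objective I y x =
     (\<Sum>S\<in>Pow {1..elems I}. \<Sum>s=1..horizon I. order_cost I S * y S s)
     + (\<Sum>(i, t)\<in>demand_points I. \<Sum>s=1..t. holding_cost I i s t * x i s t)"

definition constraints :: "inventory \<Rightarrow> y_vars \<Rightarrow> x_vars \<Rightarrow> bool" where
  "constraints I y x \<longleftrightarrow>
     (\<forall>(i, t)\<in>demand_points I. (\<Sum>s=1..t. x i s t) = 1
        \<and> (\<forall>s\<in>{1..t}. x i s t \<le> (\<Sum>S\<in>{S. i \<in> S \<and> S \<subseteq> {1..elems I}}. y S s)))"

definition LP_feasible :: "inventory \<Rightarrow> y_vars \<Rightarrow> x_vars \<Rightarrow> bool" where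
  "LP_feasible I y x \<longleftrightarrow> constraints I y x
     \<and> (\<forall>S\<subseteq>{1..elems I}. \<forall>s\<in>{1..horizon I}. 0 \<le> y S s)
     \<and> (\<forall>(i, t)\<in>demand_points I. \<forall>s\<in>{1..t}. 0 \<le> x i s t)"

definition IP_feasible :: "inventory \<Rightarrow> y_vars \<Rightarrow> x_vars \<Rightarrow> bool" where
  "IP_feasible I y x \<longleftrightarrow> constraints I y x
     \<and> (\<forall>S\<subseteq>{1..elems I}. \<forall>s\<in>{1..horizon I}. y S s \<in> {0, 1})
     \<and> (\<forall>(i, t)\<in>demand_points I. \<forall>s\<in>{1..t}. x i s t \<in> {0, 1})"

definition LP_opt :: "inventory \<Rightarrow> real" where
  "LP_opt I = Inf {objective I y x |y x. LP_feasible I y x}"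

definition IP_opt :: "inventory \<Rightarrow> real" where
  "IP_opt I = Inf {objective I y x |y x. IP_feasible I y x}"

definition LP_approximate :: "real \<Rightarrow> inventory \<Rightarrow> y_vars \<Rightarrow> x_vars \<Rightarrow> bool" where
  "LP_approximate \<gamma> I y x \<longleftrightarrow> LP_feasible I y x \<and> objective I y x \<le> \<gamma> * LP_opt I"

definition IP_approximate :: "real \<Rightarrow> inventory \<Rightarrow> y_vars \<Rightarrow> x_vars \<Rightarrow> bool" where
  "IP_approximate \<rho> I y x \<longleftrightarrow> IP_feasible I y x \<and> objective I y x \<le> \<rho> * IP_opt I"


section \<open>Encodings\<close>

definition enc_nat :: "nat \<Rightarrow> data" where
  "enc_nat n = Num (int n)"

definition enc_rat :: "rat \<Rightarrow> data" where
  "enc_rat q = (case quotient_of q of (a, b) \<Rightarrow> Lst [Num a, Num b])"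

definition enc_table :: "nat \<Rightarrow> nat \<Rightarrow> (nat \<Rightarrow> nat \<Rightarrow> rat) \<Rightarrow> data" where
  "enc_table N T g = Lst (map (\<lambda>i. Lst (map (\<lambda>t. enc_rat (g i t)) [1..<Suc T])) [1..<Suc N])"

text \<open>
  The per-unit costs \<open>holding I\<close> are not listed in the input: for polynomial holding costs of a fixed
  degree they are determined by \<open>base I\<close>.
\<close>

definition enc_inventory :: "inventory \<Rightarrow> data" where
  "enc_inventory I =
     Lst [enc_nat (elems I), enc_nat (horizon I),
          enc_table (elems I) (horizon I) (demand I),
          enc_table (elems I) (horizon I) (base I), descr I]"

text \<open>
  The exponentially many variables \<open>y\<close> force a sparse output format: lists of entries, each naming
  a variable and a rational value; sets are given as lists of elements. The value of a variable is
  the sum of its entries, and 0 if there is none.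
\<close>

type_synonym y_entries = "((nat list \<times> nat) \<times> rat) list"
type_synonym x_entries = "((nat \<times> nat \<times> nat) \<times> rat) list"

definition y_of :: "y_entries \<Rightarrow> y_vars" where
  "y_of Y S s = (\<Sum>((E, r), q)\<leftarrow>Y. if set E = S \<and> r = s then of_rat q else 0)"

definition x_of :: "x_entries \<Rightarrow> x_vars" where
  "x_of X i s t = (\<Sum>(k, q)\<leftarrow>X. if k = (i, s, t) then of_rat q else 0)"

definition enc_solution :: "y_entries \<Rightarrow> x_entries \<Rightarrow> data" where
  "enc_solution Y X =
     Lst [Lst (map (\<lambda>((E, s), q). Lst [Lst (map enc_nat E), enc_nat s, enc_rat q]) Y),
          Lst (map (\<lambda>((i, s, t), q). Lst [enc_nat i, enc_nat s, enc_nat t, enc_rat q]) X)]"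

definition LP_approx_in_poly_time :: "real \<Rightarrow> inventory set \<Rightarrow> bool" where
  "LP_approx_in_poly_time \<gamma> \<I> \<longleftrightarrow>
     poly_time_solvable enc_inventory orc \<I>
       (\<lambda>I v. \<exists>Y X. v = enc_solution Y X \<and> LP_approximate \<gamma> I (y_of Y) (x_of X))"

text \<open>The approximation factor may depend on the instance.\<close>

definition IP_approx_in_poly_time :: "(inventory \<Rightarrow> real) \<Rightarrow> inventory set \<Rightarrow> bool" where
  "IP_approx_in_poly_time \<rho> \<I> \<longleftrightarrow>
     poly_time_solvable enc_inventory orc \<I>
       (\<lambda>I v. \<exists>Y X. v = enc_solution Y X \<and> IP_approximate (\<rho> I) I (y_of Y) (x_of X))"

text \<open>
  log log T is undefined or nonpositive for T < 3; there the value at 3 is used, a constant.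
\<close>

definition log_ratio :: "nat \<Rightarrow> real" where
  "log_ratio T = ln (real (max 3 T)) / ln (ln (real (max 3 T)))"

end

theory Submission
  imports Defs "HOL-Analysis.Harmonic_Numbers"
begin

text \<open>
  Round an LP solution as follows. For every demand point \<open>(i,t)\<close> let \<open>a\<close> be the median of the
  distribution \<open>x\<close> over the serving periods. Serving \<open>(i,t)\<close> from \<open>a\<close> at most doubles its holding
  cost, and the sets containing \<open>i\<close> have \<open>y\<close>-mass at least 1/2 in \<open>[a,t]\<close>. Group the intervals by
  length into classes \<open>[B^k, B^(k+1))\<close> and move \<open>a\<close> down to a grid whose spacing is a multiple \<open>P/M\<close>
  of \<open>B^k\<close>; the holding cost grows by a factor of at most \<open>(1+P/M) powr \<alpha>\<close>. All elements served from a
  period \<open>s\<close> are ordered together: the LP sets in a window after \<open>s\<close>, with weights \<open>min 1 (2y)\<close>, cover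
  them fractionally, so fractional subadditivity bounds the cost, and a period lies in
  \<open>O(1 + B M / P)\<close> windows per class. The trick is to let the holding cost grow by a factor
  \<open>sqrt (log T)\<close>, which is still \<open>O(log T / log log T)\<close>: it permits \<open>B = P\<close> of order
  \<open>(log T) powr (1/(2\<alpha>))\<close> with \<open>M = 1\<close>, leaving \<open>O(\<alpha> log T / log log T)\<close> classes; when this
  \<open>B\<close> would be smaller than 2, one takes \<open>B = 2\<close>, \<open>P = 1\<close> and \<open>M = O(\<alpha> / log log T)\<close> instead.

  Polynomial-time computability of the rounding follows from closure rules for functions on data, the
  basic one being iteration over a list with an accumulator of polynomially bounded size.
\<close>

section \<open>Polynomial-time functions on data\<close>

text \<open>Snapping to a grid is what makes the orders few: with unsnapped medians a period could
  lie in the windows of linearly many orders, and its LP ordering cost would be charged that often.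
  The price is paid in holding cost, so everything depends on how coarse the grid may be. The
  machine has integer arithmetic only, while \<alpha> is an arbitrary real. As \<alpha> is fixed,
  the even number \<open>e = 2 * nat \<lceil>\<alpha>\<rceil>\<close> can be built into the program,
  and an integer test on the power \<open>e\<close> of a stretch then certifies that the holding
  costs grow by at most a square root. \<beta>, \<gamma> and the ordering cost are never evaluated
  by the rounding, and the oracle is called only by the given LP solver. That solver is an unknown
  program on one global store; hence the rounding is built from functions computable from any store
  and under any oracle, and is appended to it.\<close>

primrec vars_expr :: "expr \<Rightarrow> nat set" where
  "vars_expr (Var n) = {n}"
| "vars_expr (Lit v) = {}"
| "vars_expr (Unop p e) = vars_expr e"
| "vars_expr (Binop p e1 e2) = vars_expr e1 \<union> vars_expr e2"

primrec vars_com :: "com \<Rightarrow> nat set" where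
  "vars_com Skip = {}"
| "vars_com (Assign v e) = insert v (vars_expr e)"
| "vars_com (Query v e) = insert v (vars_expr e)"
| "vars_com (Then c1 c2) = vars_com c1 \<union> vars_com c2"
| "vars_com (IfElse e c1 c2) = vars_expr e \<union> vars_com c1 \<union> vars_com c2"
| "vars_com (Loop e c) = vars_expr e \<union> vars_com c"

lemma finite_vars_expr: "finite (vars_expr e)"
  by (induction e) auto

lemma finite_vars_com: "finite (vars_com c)"
  by (induction c) (auto simp: finite_vars_expr)

text \<open>All programs share one store. Registers from \<open>b\<close> on survive any of the
  given programs and can keep saved arguments and intermediate results; \<open>0 < b\<close> keeps
  them apart from register 0, which carries input and output. A caller with fewer programs repeats
  one.\<close>

lemma fresh_vars:
  obtains b where "0 < b" and "\<And>x. x \<in> vars_com c1 \<union> vars_com c2 \<union> vars_com c3 \<Longrightarrow> x < b"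
proof -
  have "finite (vars_com c1 \<union> vars_com c2 \<union> vars_com c3)"
    by (simp add: finite_vars_com)
  then obtain b where "\<forall>x\<in>vars_com c1 \<union> vars_com c2 \<union> vars_com c3. x < b"
    using finite_nat_set_iff_bounded by auto
  then show ?thesis
    by (intro that[of "Suc b"]) (auto simp: less_Suc_eq)
qed

lemma eval_expr_agree:
  "\<forall>x\<in>vars_expr e. \<tau> x = \<sigma> x \<Longrightarrow> eval_expr \<tau> e = eval_expr \<sigma> e"
  by (induction e) auto

lemma cost_expr_agree:
  "\<forall>x\<in>vars_expr e. \<tau> x = \<sigma> x \<Longrightarrow> cost_expr \<tau> e = cost_expr \<sigma> e"
proof (induction e)
  case (Unop p e)
  then show ?case using eval_expr_agree[of "Unop p e" \<tau> \<sigma>] by simp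
next
  case (Binop p e1 e2)
  then show ?case using eval_expr_agree[of "Binop p e1 e2" \<tau> \<sigma>] by simp
qed auto

lemma exec_unchanged:
  "exec \<phi> c \<sigma> n \<sigma>' \<Longrightarrow> x \<notin> vars_com c \<Longrightarrow> \<sigma>' x = \<sigma> x"
  by (induction rule: exec.induct) auto

text \<open>A run depends only on the registers that the program mentions. \<open>V\<close> may be
  larger, so that agreement can also be tracked on a register that \<open>c\<close> does not
  mention.\<close>

lemma exec_agree:
  "exec \<phi> c \<sigma> n \<sigma>' \<Longrightarrow> vars_com c \<subseteq> V \<Longrightarrow> \<forall>x\<in>V. \<tau> x = \<sigma> x \<Longrightarrow>
   \<exists>\<tau>'. exec \<phi> c \<tau> n \<tau>' \<and> (\<forall>x\<in>V. \<tau>' x = \<sigma>' x)"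
proof (induction arbitrary: \<tau> rule: exec.induct)
  case (Skip \<sigma>)
  then show ?case using exec.Skip[of \<phi> \<tau>] by auto
next
  case (Assign v e \<sigma>)
  then have e: "\<forall>x\<in>vars_expr e. \<tau> x = \<sigma> x" by auto
  have "exec \<phi> (Assign v e) \<tau> (1 + cost_expr \<sigma> e) (\<tau>(v := eval_expr \<sigma> e))"
    using exec.Assign[of \<phi> v e \<tau>] by (simp add: eval_expr_agree[OF e] cost_expr_agree[OF e])
  then show ?case using Assign by force
next
  case (Query w \<sigma> e v)
  then have e: "\<forall>x\<in>vars_expr e. \<tau> x = \<sigma> x" by auto
  have "exec \<phi> (Query v e) \<tau> (1 + cost_expr \<sigma> e + data_size w) (\<tau>(v := w))"
    using exec.Query[of w \<phi> \<tau> e v] Query.hyps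
    by (simp add: eval_expr_agree[OF e] cost_expr_agree[OF e])
  then show ?case using Query by force
next
  case (Then c1 \<sigma> n1 \<sigma>1 c2 n2 \<sigma>2)
  from Then.IH(1)[of \<tau>] Then.prems obtain \<tau>1
    where 1: "exec \<phi> c1 \<tau> n1 \<tau>1" "\<forall>x\<in>V. \<tau>1 x = \<sigma>1 x" by auto
  from Then.IH(2)[of \<tau>1] Then.prems 1 obtain \<tau>2
    where "exec \<phi> c2 \<tau>1 n2 \<tau>2" "\<forall>x\<in>V. \<tau>2 x = \<sigma>2 x" by auto
  with 1 show ?case by (auto intro: exec.Then)
next
  case (IfTrue \<sigma> e c1 n \<sigma>' c2)
  then have e: "\<forall>x\<in>vars_expr e. \<tau> x = \<sigma> x" by auto
  from IfTrue.IH[of \<tau>] IfTrue.prems obtain \<tau>'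
    where "exec \<phi> c1 \<tau> n \<tau>'" "\<forall>x\<in>V. \<tau>' x = \<sigma>' x" by auto
  then show ?case
    using exec.IfTrue[of \<tau> e \<phi> c1 n \<tau>' c2] IfTrue.hyps(1)
    by (auto simp: eval_expr_agree[OF e] cost_expr_agree[OF e])
next
  case (IfFalse \<sigma> e c2 n \<sigma>' c1)
  then have e: "\<forall>x\<in>vars_expr e. \<tau> x = \<sigma> x" by auto
  from IfFalse.IH[of \<tau>] IfFalse.prems obtain \<tau>'
    where "exec \<phi> c2 \<tau> n \<tau>'" "\<forall>x\<in>V. \<tau>' x = \<sigma>' x" by auto
  then show ?case
    using exec.IfFalse[of \<tau> e \<phi> c2 n \<tau>' c1] IfFalse.hyps(1)
    by (auto simp: eval_expr_agree[OF e] cost_expr_agree[OF e])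
next
  case (LoopFalse \<sigma> e c)
  then have e: "\<forall>x\<in>vars_expr e. \<tau> x = \<sigma> x" by auto
  show ?case
    using exec.LoopFalse[of \<tau> e \<phi> c] LoopFalse
    by (auto simp: eval_expr_agree[OF e] cost_expr_agree[OF e])
next
  case (LoopTrue \<sigma> e c n1 \<sigma>1 n2 \<sigma>2)
  then have e: "\<forall>x\<in>vars_expr e. \<tau> x = \<sigma> x" by auto
  from LoopTrue.IH(1)[of \<tau>] LoopTrue.prems obtain \<tau>1
    where 1: "exec \<phi> c \<tau> n1 \<tau>1" "\<forall>x\<in>V. \<tau>1 x = \<sigma>1 x" by auto
  from LoopTrue.IH(2)[of \<tau>1] LoopTrue.prems 1 obtain \<tau>2
    where "exec \<phi> (Loop e c) \<tau>1 n2 \<tau>2" "\<forall>x\<in>V. \<tau>2 x = \<sigma>2 x" by auto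
  then show ?case
    using exec.LoopTrue[of \<tau> e \<phi> c n1 \<tau>1 n2 \<tau>2] 1 LoopTrue.hyps(1)
    by (auto simp: eval_expr_agree[OF e] cost_expr_agree[OF e])
qed

lemma eval_expr_size: "data_size (eval_expr \<sigma> e) \<le> cost_expr \<sigma> e"
  by (cases e) auto

text \<open>Every value written is charged at least its own size, so no register grows by more than
  the elapsed time. This turns time bounds into bounds on output sizes.\<close>

lemma exec_size: "exec \<phi> c \<sigma> n \<sigma>' \<Longrightarrow> data_size (\<sigma>' x) \<le> data_size (\<sigma> x) + n"
proof (induction rule: exec.induct)
  case (Assign v e \<sigma>)
  then show ?case using eval_expr_size[of \<sigma> e] by auto
qed auto

text \<open>Exact times depend on the path taken; upper bounds can be relaxed before programs are
  composed.\<close>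

definition runs :: "(data \<Rightarrow> data) \<Rightarrow> com \<Rightarrow> store \<Rightarrow> nat \<Rightarrow> store \<Rightarrow> bool" where
  "runs \<phi> c \<sigma> m \<sigma>' \<longleftrightarrow> (\<exists>n\<le>m. exec \<phi> c \<sigma> n \<sigma>')"

lemma runs_mono: "runs \<phi> c \<sigma> m \<sigma>' \<Longrightarrow> m \<le> m' \<Longrightarrow> runs \<phi> c \<sigma> m' \<sigma>'"
  unfolding runs_def by (meson le_trans)

lemma runs_Assign:
  "\<sigma>' = \<sigma>(v := eval_expr \<sigma> e) \<Longrightarrow> runs \<phi> (Assign v e) \<sigma> (1 + cost_expr \<sigma> e) \<sigma>'"
  unfolding runs_def by (metis exec.Assign order_refl)

lemma runs_Then:
  "runs \<phi> c1 \<sigma> m1 \<sigma>1 \<Longrightarrow> runs \<phi> c2 \<sigma>1 m2 \<sigma>2 \<Longrightarrow> runs \<phi> (Then c1 c2) \<sigma> (m1 + m2) \<sigma>2"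
  unfolding runs_def by (meson add_mono exec.Then)

lemma runs_LoopTrue:
  assumes "truth (eval_expr \<sigma> e)" "runs \<phi> c \<sigma> m1 \<sigma>1" "runs \<phi> (Loop e c) \<sigma>1 m2 \<sigma>2"
  shows "runs \<phi> (Loop e c) \<sigma> (1 + cost_expr \<sigma> e + m1 + m2) \<sigma>2"
proof -
  from assms obtain n1 n2 where "n1 \<le> m1" "n2 \<le> m2" "exec \<phi> c \<sigma> n1 \<sigma>1" "exec \<phi> (Loop e c) \<sigma>1 n2 \<sigma>2"
    by (auto simp: runs_def)
  with exec.LoopTrue[OF assms(1) this(3,4)] show ?thesis
    unfolding runs_def by (intro exI[of _ "1 + cost_expr \<sigma> e + n1 + n2"]) auto
qed

lemma runs_unchanged: "runs \<phi> c \<sigma> m \<sigma>' \<Longrightarrow> x \<notin> vars_com c \<Longrightarrow> \<sigma>' x = \<sigma> x"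
  by (auto simp: runs_def dest: exec_unchanged)

section \<open>Polynomial bounds in the size of the input\<close>

lemma data_size_pos: "1 \<le> data_size v"
  by (cases v) auto

lemma length_le_data_size: "length vs \<le> data_size (Lst vs)"
proof (induction vs)
  case (Cons v vs)
  then show ?case using data_size_pos[of v] by simp
qed simp

definition poly_bounded :: "(data \<Rightarrow> nat) \<Rightarrow> bool" where
  "poly_bounded g \<longleftrightarrow> (\<exists>a k. \<forall>v. g v \<le> a * data_size v ^ k)"

lemma poly_bounded_le: "poly_bounded h \<Longrightarrow> (\<And>v. g v \<le> h v) \<Longrightarrow> poly_bounded g"
  unfolding poly_bounded_def by (meson le_trans)

lemma poly_bounded_const: "poly_bounded (\<lambda>v. c)"
  unfolding poly_bounded_def by (intro exI[of _ c] exI[of _ 0]) simp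

lemma poly_bounded_size: "poly_bounded data_size"
  unfolding poly_bounded_def by (intro exI[of _ 1]) simp

lemma poly_bounded_mult:
  assumes "poly_bounded g" "poly_bounded h"
  shows "poly_bounded (\<lambda>v. g v * h v)"
proof -
  from assms obtain a k b l where "\<And>v. g v \<le> a * data_size v ^ k" "\<And>v. h v \<le> b * data_size v ^ l"
    unfolding poly_bounded_def by metis
  then have "g v * h v \<le> (a * b) * data_size v ^ (k + l)" for v
    using mult_mono[of "g v" "a * data_size v ^ k" "h v" "b * data_size v ^ l"]
    by (simp add: power_add mult_ac)
  then show ?thesis unfolding poly_bounded_def by blast
qed

text \<open>Sizes are at least 1, so both monomials can be raised to the common exponent
  \<open>k + l\<close>.\<close>

lemma poly_bounded_add:
  assumes "poly_bounded g" "poly_bounded h"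
  shows "poly_bounded (\<lambda>v. g v + h v)"
proof -
  from assms(1) obtain a k where a: "\<forall>v. g v \<le> a * data_size v ^ k"
    unfolding poly_bounded_def by (elim exE)
  from assms(2) obtain b l where b: "\<forall>v. h v \<le> b * data_size v ^ l"
    unfolding poly_bounded_def by (elim exE)
  have "g v + h v \<le> (a + b) * data_size v ^ (k + l)" for v
  proof -
    have "g v \<le> a * data_size v ^ (k + l)"
      by (rule order_trans[OF spec[OF a]], rule mult_left_mono, rule power_increasing, rule le_add1,
          rule data_size_pos, rule le0)
    moreover have "h v \<le> b * data_size v ^ (k + l)"
      by (rule order_trans[OF spec[OF b]], rule mult_left_mono, rule power_increasing, rule le_add2,
          rule data_size_pos, rule le0)
    ultimately show ?thesis unfolding distrib_right by (rule add_mono)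
  qed
  then have "\<forall>v. g v + h v \<le> (a + b) * data_size v ^ (k + l)" by (rule allI)
  then show ?thesis unfolding poly_bounded_def by - (rule exI[of _ "a + b"], rule exI[of _ "k + l"])
qed

lemma poly_bounded_power: "poly_bounded g \<Longrightarrow> poly_bounded (\<lambda>v. g v ^ k)"
  by (induction k) (auto intro: poly_bounded_const poly_bounded_mult)

lemma poly_bounded_comp:
  assumes "poly_bounded h" "poly_bounded (\<lambda>v. data_size (F v))"
  shows "poly_bounded (\<lambda>v. h (F v))"
proof -
  from assms(1) obtain a k where "\<And>v. h v \<le> a * data_size v ^ k" unfolding poly_bounded_def by metis
  then show ?thesis
    by (rule poly_bounded_le[rotated])
       (intro poly_bounded_mult poly_bounded_power poly_bounded_const assms(2))
qed

lemmas poly_bounded_intros =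
  poly_bounded_const poly_bounded_size poly_bounded_add poly_bounded_mult poly_bounded_power

text \<open>The program has to work from every store and under every oracle, with no promise about
  registers other than 0. It can therefore run after code that left arbitrary values behind.\<close>

definition poly_time :: "(data \<Rightarrow> data) \<Rightarrow> bool" where
  "poly_time F \<longleftrightarrow> (\<exists>c g. poly_bounded g \<and>
     (\<forall>\<phi> \<sigma>. \<exists>\<sigma>'. runs \<phi> c \<sigma> (g (\<sigma> 0)) \<sigma>' \<and> \<sigma>' 0 = F (\<sigma> 0)))"

lemma poly_timeI:
  assumes "poly_bounded g" and "\<And>\<phi> \<sigma>. \<exists>\<sigma>'. runs \<phi> c \<sigma> (g (\<sigma> 0)) \<sigma>' \<and> \<sigma>' 0 = F (\<sigma> 0)"
  shows "poly_time F"
  unfolding poly_time_def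
  by (rule exI[of _ c], rule exI[of _ g]) (use assms in simp)

text \<open>In a composition the outer program is timed by the size of the inner result, which has
  to be polynomial in the original input.\<close>

lemma poly_time_size:
  assumes "poly_time F"
  shows "poly_bounded (\<lambda>v. data_size (F v))"
proof -
  from assms obtain c g where g: "poly_bounded g"
    and c: "\<And>\<phi> \<sigma>. \<exists>\<sigma>'. runs \<phi> c \<sigma> (g (\<sigma> 0)) \<sigma>' \<and> \<sigma>' 0 = F (\<sigma> 0)"
    unfolding poly_time_def by blast
  have "data_size (F v) \<le> data_size v + g v" for v
    using c[of "\<lambda>_. v" "\<lambda>x. v"] by (auto simp: runs_def dest!: exec_size[where x=0])
  then show ?thesis
    using poly_bounded_add[OF poly_bounded_size g] by (rule poly_bounded_le[rotated])
qed

lemma poly_time_id: "poly_time (\<lambda>v. v)"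
  unfolding poly_time_def
  unfolding runs_def
  by (intro exI[of _ Skip] exI[of _ "\<lambda>_. 1"]) (metis poly_bounded_const exec.Skip order_refl)

lemma poly_time_const: "poly_time (\<lambda>v. w)"
  unfolding poly_time_def
  by (intro exI[of _ "Assign 0 (Lit w)"] exI[of _ "\<lambda>_. 1 + data_size w"])
     (use runs_Assign[of _ _ 0 "Lit w"] in \<open>force simp: poly_bounded_const\<close>)

lemma poly_time_comp:
  assumes "poly_time F" "poly_time G"
  shows "poly_time (\<lambda>v. F (G v))"
proof -
  from assms(1) obtain c1 g1 where 1: "poly_bounded g1"
    "\<And>\<phi> \<sigma>. \<exists>\<sigma>'. runs \<phi> c1 \<sigma> (g1 (\<sigma> 0)) \<sigma>' \<and> \<sigma>' 0 = F (\<sigma> 0)"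
    unfolding poly_time_def by blast
  from assms(2) obtain c2 g2 where 2: "poly_bounded g2"
    "\<And>\<phi> \<sigma>. \<exists>\<sigma>'. runs \<phi> c2 \<sigma> (g2 (\<sigma> 0)) \<sigma>' \<and> \<sigma>' 0 = G (\<sigma> 0)"
    unfolding poly_time_def by blast
  have r: "\<exists>\<sigma>'. runs \<phi> (Then c2 c1) \<sigma> (g2 (\<sigma> 0) + g1 (G (\<sigma> 0))) \<sigma>' \<and> \<sigma>' 0 = F (G (\<sigma> 0))" for \<phi> \<sigma>
    using 1(2) 2(2) by (metis runs_Then)
  have b: "poly_bounded (\<lambda>v. g2 v + g1 (G v))"
    by (intro poly_bounded_add poly_bounded_comp[OF 1(1) poly_time_size] 2 assms)
  show ?thesis
    by (rule poly_timeI[where F = "\<lambda>v. F (G v)" and g = "\<lambda>v. g2 v + g1 (G v)" and c = "Then c2 c1", OF b r])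
qed

lemma floorlog_add_le: "floorlog 2 (a + b) \<le> floorlog 2 a + floorlog 2 b + 1"
proof (rule floorlog_leI)
  let ?x = "2 ^ floorlog 2 a :: nat" and ?y = "2 ^ floorlog 2 b :: nat"
  have "a < ?x" "b < ?y" by (rule floorlog_leD[OF order_refl], simp)+
  moreover have "?x * 1 \<le> ?x * ?y" "1 * ?y \<le> ?x * ?y" by (rule mult_le_mono, simp, simp)+
  ultimately have "a + b < 2 * (?x * ?y)" by linarith
  then show "a + b < 2 ^ (floorlog 2 a + floorlog 2 b + 1)" by (simp add: power_add)
qed simp_all

lemma floorlog_mult_le: "floorlog 2 (a * b) \<le> floorlog 2 a + floorlog 2 b"
proof (rule floorlog_leI)
  have "a < 2 ^ floorlog 2 a" "b < 2 ^ floorlog 2 b" by (rule floorlog_leD[OF order_refl], simp)+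
  then show "a * b < 2 ^ (floorlog 2 a + floorlog 2 b)"
    unfolding power_add by (intro mult_strict_mono) simp_all
qed simp_all

lemma data_size_Lst_list_of: "data_size (Lst (list_of v)) \<le> data_size v"
  by (cases v) auto

lemma eval_unop_size: "data_size (eval_unop p v) \<le> 2 + data_size v"
proof (cases p)
  case Head
  then show ?thesis by (cases v) (auto split: list.split)
next
  case Tail
  have "(\<Sum>v\<leftarrow>tl vs. data_size v) \<le> (\<Sum>v\<leftarrow>vs. data_size v)" for vs by (cases vs) auto
  from this[of "list_of v"] Tail data_size_Lst_list_of[of v] show ?thesis by simp
next
  case IsNum
  then show ?thesis by (auto simp: of_truth_def floorlog_def)
qed

text \<open>A result is longer than both operands together by at most a constant. This includes
  floor division, whose quotient never exceeds the dividend in absolute value, and division by 0,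
  which yields 0.\<close>

lemma eval_binop_size: "data_size (eval_binop p v w) \<le> 3 + data_size v + data_size w"
proof -
  have n: "floorlog 2 (nat \<bar>num_of v\<bar>) \<le> data_size v" for v by (cases v) (auto simp: floorlog_def)
  have t: "data_size (of_truth b) \<le> 3 + data_size v + data_size w" for b by (auto simp: of_truth_def floorlog_def)
  let ?a = "nat \<bar>num_of v\<bar>" and ?b = "nat \<bar>num_of w\<bar>"
  have add: "floorlog 2 (nat \<bar>k\<bar>) \<le> data_size v + data_size w + 1" if "\<bar>k\<bar> \<le> \<bar>num_of v\<bar> + \<bar>num_of w\<bar>" for k
  proof -
    have "floorlog 2 (nat \<bar>k\<bar>) \<le> floorlog 2 (?a + ?b)" using that by (intro floorlog_mono) auto
    with floorlog_add_le[of ?a ?b] n[of v] n[of w] show ?thesis by linarith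
  qed
  show ?thesis
  proof (cases p)
    case Add
    then show ?thesis using add[of "num_of v + num_of w", OF abs_triangle_ineq] by simp
  next
    case Sub
    then show ?thesis using add[of "num_of v - num_of w", OF abs_triangle_ineq4] by simp
  next
    case Mul
    then show ?thesis using floorlog_mult_le[of ?a ?b] n[of v] n[of w] by (simp add: abs_mult nat_mult_distrib)
  next
    case Div
    have pos: "\<bar>a div b\<bar> \<le> \<bar>a\<bar>" if "0 < b" for a b :: int
    proof (cases "0 \<le> a")
      case True
      then have "a div b \<le> a" using that by (metis div_by_1 int_one_le_iff_zero_less zdiv_mono2 zero_less_one)
      with True that show ?thesis by (simp add: pos_imp_zdiv_nonneg_iff)
    next
      case False
      \<comment> \<open>For negative \<open>a\<close> the floor rounds away from zero, yet
        \<open>a * b \<le> a\<close> keeps the quotient at or above \<open>a\<close>.\<close>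
      then have "a * b \<le> a * 1" using that by (intro mult_left_mono_neg) auto
      then have "a \<le> a div b" using that zdiv_mono1[of "a * b" a b] by simp
      with False that pos_imp_zdiv_neg_iff[of b a] show ?thesis by linarith
    qed
    have "\<bar>a div b\<bar> \<le> \<bar>a\<bar>" for a b :: int
    proof (cases "0 < b")
      case True
      then show ?thesis by (rule pos)
    next
      case False
      then show ?thesis using pos[of "- b" "- a"] by (cases "b = 0") simp_all
    qed
    from this[of "num_of v" "num_of w"]
    have "\<bar>num_of v div num_of w\<bar> \<le> \<bar>num_of v\<bar> + \<bar>num_of w\<bar>" by linarith
    with Div show ?thesis using add[of "num_of v div num_of w"] by simp
  next
    case Less
    then show ?thesis using t by simp
  next
    case Equal
    then show ?thesis using t by simp
  next
    case Push
    then show ?thesis using data_size_Lst_list_of[of w] by simp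
  qed
qed

lemma poly_time_unop:
  assumes "poly_time F"
  shows "poly_time (\<lambda>v. eval_unop p (F v))"
proof -
  have r: "\<exists>\<sigma>'. runs \<phi> (Assign 0 (Unop p (Var 0))) \<sigma> (3 + 2 * data_size (\<sigma> 0)) \<sigma>' \<and> \<sigma>' 0 = eval_unop p (\<sigma> 0)" for \<phi> \<sigma>
    using runs_Assign[of _ \<sigma> 0 "Unop p (Var 0)" \<phi>] eval_unop_size[of p "\<sigma> 0"]
    by (fastforce elim!: runs_mono)
  have b: "poly_bounded (\<lambda>v. 3 + 2 * data_size v)"
    by (intro poly_bounded_intros)
  have "poly_time (eval_unop p)"
    by (rule poly_timeI[where F = "eval_unop p" and g = "\<lambda>v. 3 + 2 * data_size v" and c = "Assign 0 (Unop p (Var 0))", OF b r])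
  from poly_time_comp[OF this assms] show ?thesis .
qed

text \<open>The first program may destroy the argument, so register \<open>z\<close> keeps a copy
  for the second one, and \<open>Suc z\<close> keeps the first result meanwhile.\<close>

lemma poly_time_binop:
  assumes "poly_time F" "poly_time G"
  shows "poly_time (\<lambda>v. eval_binop p (F v) (G v))"
proof -
  from assms(1) obtain c1 g1 where 1: "poly_bounded g1"
    "\<And>\<phi> \<sigma>. \<exists>\<sigma>'. runs \<phi> c1 \<sigma> (g1 (\<sigma> 0)) \<sigma>' \<and> \<sigma>' 0 = F (\<sigma> 0)"
    unfolding poly_time_def by blast
  from assms(2) obtain c2 g2 where 2: "poly_bounded g2"
    "\<And>\<phi> \<sigma>. \<exists>\<sigma>'. runs \<phi> c2 \<sigma> (g2 (\<sigma> 0)) \<sigma>' \<and> \<sigma>' 0 = G (\<sigma> 0)"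
    unfolding poly_time_def by blast
  obtain z where z: "0 < z" "\<And>x. x \<in> vars_com c1 \<union> vars_com c2 \<union> vars_com c2 \<Longrightarrow> x < z"
    by (rule fresh_vars) blast
  then have fresh: "z \<notin> vars_com c1" "z \<notin> vars_com c2" "Suc z \<notin> vars_com c2"
    by (metis Un_iff less_irrefl not_less_iff_gr_or_eq lessI order.asym)+
  define c where "c = Then (Assign z (Var 0)) (Then c1 (Then (Assign (Suc z) (Var 0))
    (Then (Assign 0 (Var z)) (Then c2 (Assign 0 (Binop p (Var (Suc z)) (Var 0)))))))"
  define g where "g = (\<lambda>v. (1 + data_size v) + (g1 v + ((1 + data_size (F v)) + ((1 + data_size v)
    + (g2 v + (4 + 2 * data_size (F v) + 2 * data_size (G v)))))))"
  have b: "poly_bounded g"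
    unfolding g_def by (intro poly_bounded_intros 1 2 poly_time_size assms)
  have r: "\<exists>\<sigma>'. runs \<phi> c \<sigma> (g (\<sigma> 0)) \<sigma>' \<and> \<sigma>' 0 = eval_binop p (F (\<sigma> 0)) (G (\<sigma> 0))" for \<phi> \<sigma>
  proof -
    let ?v = "\<sigma> 0"
    let ?\<sigma>1 = "\<sigma>(z := ?v)"
    have r1: "runs \<phi> (Assign z (Var 0)) \<sigma> (1 + data_size ?v) ?\<sigma>1"
      using runs_Assign[of ?\<sigma>1 \<sigma> z "Var 0" \<phi>] by simp
    from 1(2)[of \<phi> ?\<sigma>1] z(1) obtain \<sigma>2 where r2: "runs \<phi> c1 ?\<sigma>1 (g1 ?v) \<sigma>2" and s2: "\<sigma>2 0 = F ?v"
      by auto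
    have z2: "\<sigma>2 z = ?v" using runs_unchanged[OF r2 fresh(1)] by simp
    let ?\<sigma>3 = "\<sigma>2(Suc z := F ?v)"
    have r3: "runs \<phi> (Assign (Suc z) (Var 0)) \<sigma>2 (1 + data_size (F ?v)) ?\<sigma>3"
      using runs_Assign[of ?\<sigma>3 \<sigma>2 "Suc z" "Var 0" \<phi>] s2 by simp
    let ?\<sigma>4 = "?\<sigma>3(0 := ?v)"
    have r4: "runs \<phi> (Assign 0 (Var z)) ?\<sigma>3 (1 + data_size ?v) ?\<sigma>4"
      using runs_Assign[of ?\<sigma>4 ?\<sigma>3 0 "Var z" \<phi>] z2 by simp
    from 2(2)[of \<phi> ?\<sigma>4] obtain \<sigma>5 where r5: "runs \<phi> c2 ?\<sigma>4 (g2 ?v) \<sigma>5" and s5: "\<sigma>5 0 = G ?v"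
      by auto
    have z5: "\<sigma>5 (Suc z) = F ?v" using runs_unchanged[OF r5 fresh(3)] by simp
    let ?\<sigma>6 = "\<sigma>5(0 := eval_binop p (F ?v) (G ?v))"
    have r6: "runs \<phi> (Assign 0 (Binop p (Var (Suc z)) (Var 0))) \<sigma>5 (4 + 2 * data_size (F ?v) + 2 * data_size (G ?v)) ?\<sigma>6"
      using runs_Assign[of ?\<sigma>6 \<sigma>5 0 "Binop p (Var (Suc z)) (Var 0)" \<phi>] z5 s5 eval_binop_size[of p "F ?v" "G ?v"]
      by (auto elim!: runs_mono)
    show ?thesis unfolding c_def g_def
      by (rule exI[of _ ?\<sigma>6], rule conjI,
          (rule runs_Then[OF r1 runs_Then[OF r2 runs_Then[OF r3 runs_Then[OF r4 runs_Then[OF r5 r6]]]]]))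
         simp
  qed
  show ?thesis
    by (rule poly_timeI[where F = "\<lambda>v. eval_binop p (F v) (G v)" and g = g and c = c, OF b r])
qed

lemma runs_IfElse:
  assumes "runs \<phi> c1 \<sigma> m \<sigma>1" "runs \<phi> c2 \<sigma> m \<sigma>2"
  shows "runs \<phi> (IfElse e c1 c2) \<sigma> (1 + cost_expr \<sigma> e + m) (if truth (eval_expr \<sigma> e) then \<sigma>1 else \<sigma>2)"
proof (cases "truth (eval_expr \<sigma> e)")
  case True
  from assms(1) obtain n where n: "n \<le> m" "exec \<phi> c1 \<sigma> n \<sigma>1" unfolding runs_def by blast
  from exec.IfTrue[OF True n(2)] n(1) True show ?thesis unfolding runs_def
    by (intro exI[of _ "1 + cost_expr \<sigma> e + n"]) auto
next
  case False
  from assms(2) obtain n where n: "n \<le> m" "exec \<phi> c2 \<sigma> n \<sigma>2" unfolding runs_def by blast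
  from exec.IfFalse[OF False n(2)] n(1) False show ?thesis unfolding runs_def
    by (intro exI[of _ "1 + cost_expr \<sigma> e + n"]) auto
qed

lemma poly_time_If:
  assumes "poly_time (\<lambda>v. of_truth (P v))" "poly_time F" "poly_time G"
  shows "poly_time (\<lambda>v. if P v then F v else G v)"
proof -
  from assms(1) obtain c0 g0 where 0: "poly_bounded g0"
    "\<And>\<phi> \<sigma>. \<exists>\<sigma>'. runs \<phi> c0 \<sigma> (g0 (\<sigma> 0)) \<sigma>' \<and> \<sigma>' 0 = of_truth (P (\<sigma> 0))"
    unfolding poly_time_def by blast
  from assms(2) obtain c1 g1 where 1: "poly_bounded g1"
    "\<And>\<phi> \<sigma>. \<exists>\<sigma>'. runs \<phi> c1 \<sigma> (g1 (\<sigma> 0)) \<sigma>' \<and> \<sigma>' 0 = F (\<sigma> 0)"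
    unfolding poly_time_def by blast
  from assms(3) obtain c2 g2 where 2: "poly_bounded g2"
    "\<And>\<phi> \<sigma>. \<exists>\<sigma>'. runs \<phi> c2 \<sigma> (g2 (\<sigma> 0)) \<sigma>' \<and> \<sigma>' 0 = G (\<sigma> 0)"
    unfolding poly_time_def by blast
  obtain z where z: "0 < z" "\<And>x. x \<in> vars_com c0 \<union> vars_com c1 \<union> vars_com c2 \<Longrightarrow> x < z"
    by (rule fresh_vars) blast
  then have fresh: "z \<notin> vars_com c0" by (metis Un_iff less_irrefl)
  define c where "c = Then (Assign z (Var 0)) (Then c0 (Then (Assign (Suc z) (Var 0))
    (Then (Assign 0 (Var z)) (IfElse (Var (Suc z)) c1 c2))))"
  define g where "g = (\<lambda>v. (1 + data_size v) + (g0 v + ((1 + 2) + ((1 + data_size v)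
    + (1 + 2 + (g1 v + g2 v))))))"
  have b: "poly_bounded g"
    unfolding g_def by (intro poly_bounded_intros 0 1 2)
  have r: "\<exists>\<sigma>'. runs \<phi> c \<sigma> (g (\<sigma> 0)) \<sigma>' \<and> \<sigma>' 0 = (if P (\<sigma> 0) then F (\<sigma> 0) else G (\<sigma> 0))" for \<phi> \<sigma>
  proof -
    let ?v = "\<sigma> 0"
    let ?t = "of_truth (P ?v)"
    have t: "data_size ?t \<le> 2" by (simp add: of_truth_def floorlog_def)
    let ?\<sigma>1 = "\<sigma>(z := ?v)"
    have r1: "runs \<phi> (Assign z (Var 0)) \<sigma> (1 + data_size ?v) ?\<sigma>1"
      using runs_Assign[of ?\<sigma>1 \<sigma> z "Var 0" \<phi>] by simp
    from 0(2)[of \<phi> ?\<sigma>1] z(1) obtain \<sigma>2 where r2: "runs \<phi> c0 ?\<sigma>1 (g0 ?v) \<sigma>2" and s2: "\<sigma>2 0 = ?t"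
      by auto
    have z2: "\<sigma>2 z = ?v" using runs_unchanged[OF r2 fresh(1)] by simp
    let ?\<sigma>3 = "\<sigma>2(Suc z := ?t)"
    have r3: "runs \<phi> (Assign (Suc z) (Var 0)) \<sigma>2 (1 + 2) ?\<sigma>3"
      by (rule runs_mono[OF runs_Assign[of ?\<sigma>3 \<sigma>2 "Suc z" "Var 0" \<phi>]]) (use s2 t in simp_all)
    let ?\<sigma>4 = "?\<sigma>3(0 := ?v)"
    have r4: "runs \<phi> (Assign 0 (Var z)) ?\<sigma>3 (1 + data_size ?v) ?\<sigma>4"
      using runs_Assign[of ?\<sigma>4 ?\<sigma>3 0 "Var z" \<phi>] z2 by simp
    from 1(2)[of \<phi> ?\<sigma>4] obtain \<sigma>5 where r5: "runs \<phi> c1 ?\<sigma>4 (g1 ?v) \<sigma>5" and s5: "\<sigma>5 0 = F ?v"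
      by auto
    from 2(2)[of \<phi> ?\<sigma>4] obtain \<sigma>6 where r6: "runs \<phi> c2 ?\<sigma>4 (g2 ?v) \<sigma>6" and s6: "\<sigma>6 0 = G ?v"
      by auto
    let ?\<sigma>7 = "if truth (eval_expr ?\<sigma>4 (Var (Suc z))) then \<sigma>5 else \<sigma>6"
    have r7: "runs \<phi> (IfElse (Var (Suc z)) c1 c2) ?\<sigma>4 (1 + 2 + (g1 ?v + g2 ?v)) ?\<sigma>7"
      by (rule runs_mono[OF runs_IfElse[OF runs_mono[OF r5] runs_mono[OF r6], of "g1 ?v + g2 ?v" "Var (Suc z)"]])
         (use t in simp_all)
    show ?thesis unfolding c_def g_def
      by (rule exI[of _ ?\<sigma>7], rule conjI,
          (rule runs_Then[OF r1 runs_Then[OF r2 runs_Then[OF r3 runs_Then[OF r4 r7]]]]))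
         (simp add: s5 s6 truth_def of_truth_def)
  qed
  show ?thesis
    by (rule poly_timeI[where F = "\<lambda>v. if P v then F v else G v" and g = g and c = c, OF b r])
qed

section \<open>Iteration over lists\<close>

definition pair :: "data \<Rightarrow> data \<Rightarrow> data" where
  "pair v w = Lst [v, w]"

definition first :: "data \<Rightarrow> data" where
  "first v = eval_unop Head v"

definition second :: "data \<Rightarrow> data" where
  "second v = eval_unop Head (eval_unop Tail v)"

lemma first_pair [simp]: "first (pair v w) = v" and second_pair [simp]: "second (pair v w) = w"
  by (simp_all add: first_def second_def pair_def)

text \<open>Without the bound on the accumulator, repeated squaring would take exponential time.\<close>

lemma poly_time_fold:
  assumes I: "poly_time F" and L: "poly_time (\<lambda>v. Lst (l v))"
    and S: "poly_time (\<lambda>u. step (first (first u)) (second (first u)) (second u))"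
    and b: "poly_bounded b"
    and bound: "\<And>v n. n \<le> length (l v) \<Longrightarrow> data_size (fold (step v) (take n (l v)) (F v)) \<le> b v"
  shows "poly_time (\<lambda>v. fold (step v) (l v) (F v))"
proof -
  from I obtain c0 g0 where 0: "poly_bounded g0"
    "\<And>\<phi> \<sigma>. \<exists>\<sigma>'. runs \<phi> c0 \<sigma> (g0 (\<sigma> 0)) \<sigma>' \<and> \<sigma>' 0 = F (\<sigma> 0)"
    unfolding poly_time_def by blast
  from L obtain c1 g1 where 1: "poly_bounded g1"
    "\<And>\<phi> \<sigma>. \<exists>\<sigma>'. runs \<phi> c1 \<sigma> (g1 (\<sigma> 0)) \<sigma>' \<and> \<sigma>' 0 = Lst (l (\<sigma> 0))"
    unfolding poly_time_def by blast
  from S obtain c2 g2 where 2: "poly_bounded g2"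
    "\<And>\<phi> \<sigma>. \<exists>\<sigma>'. runs \<phi> c2 \<sigma> (g2 (\<sigma> 0)) \<sigma>' \<and> \<sigma>' 0 = step (first (first (\<sigma> 0))) (second (first (\<sigma> 0))) (second (\<sigma> 0))"
    unfolding poly_time_def by blast
  obtain a k where ak: "\<And>v. g2 v \<le> a * data_size v ^ k" using 2(1) unfolding poly_bounded_def by blast
  obtain z where z: "0 < z" "\<And>x. x \<in> vars_com c0 \<union> vars_com c1 \<union> vars_com c2 \<Longrightarrow> x < z"
    by (rule fresh_vars) blast
  have fresh: "y \<notin> vars_com c0" "y \<notin> vars_com c1" "y \<notin> vars_com c2" if "z \<le> y" for y
    using z(2)[of y] that by auto
  \<comment> \<open>Register \<open>z\<close> holds the context \<open>v\<close>,
    \<open>z + 1\<close> the accumulator and \<open>z + 2\<close> the rest of the list;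
    \<open>p\<close> packs context, next element and accumulator into the argument of the step
    program.\<close>
  define p where "p = Binop Push (Binop Push (Var z) (Binop Push (Unop Head (Var (z + 2))) (Lit (Lst []))))
    (Binop Push (Var (z + 1)) (Lit (Lst [])))"
  define body where "body = Then (Assign 0 p) (Then (Assign (z + 2) (Unop Tail (Var (z + 2))))
    (Then c2 (Assign (z + 1) (Var 0))))"
  \<comment> \<open>The machine has no negation: comparing the outcome of the emptiness test with 0
    yields truth exactly while elements remain.\<close>
  define e where "e = Binop Equal (Binop Equal (Var (z + 2)) (Lit (Lst []))) (Lit (Num 0))"
  \<comment> \<open>One bound \<open>M\<close> on the context, the remaining list and all
    accumulators to come serves every iteration, so the induction just adds up equal costs.\<close>
  have loop: "\<exists>\<sigma>'. runs \<phi> (Loop e body) \<sigma> ((length xs + 1) * (100 * M + a * (5 * M) ^ k)) \<sigma>'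
      \<and> \<sigma>' (z + 1) = fold (step v) xs (\<sigma> (z + 1))"
    if "\<sigma> z = v" "\<sigma> (z + 2) = Lst xs" "data_size v \<le> M" "data_size (Lst xs) \<le> M"
      "\<forall>n\<le>length xs. data_size (fold (step v) (take n xs) (\<sigma> (z + 1))) \<le> M" for \<phi> \<sigma> xs v M
    using that
  proof (induction xs arbitrary: \<sigma>)
    case Nil
    have "\<not> truth (eval_expr \<sigma> e)" using Nil.prems by (simp add: e_def of_truth_def truth_def)
    from exec.LoopFalse[OF this, of \<phi> body] have "runs \<phi> (Loop e body) \<sigma> (1 + cost_expr \<sigma> e) \<sigma>"
      unfolding runs_def by blast
    moreover have "1 + cost_expr \<sigma> e \<le> 100 * M"
      using Nil.prems data_size_pos[of v] by (simp add: e_def of_truth_def floorlog_def)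
    ultimately show ?case by (intro exI[of _ \<sigma>]) (auto elim!: runs_mono)
  next
    case (Cons x xs)
    let ?acc = "\<sigma> (z + 1)"
    have M: "1 \<le> M" using Cons.prems(3) data_size_pos[of v] by linarith
    have acc: "data_size ?acc \<le> M" using Cons.prems(5)[rule_format, of 0] by simp
    have acc': "data_size (step v x ?acc) \<le> M" using Cons.prems(5)[rule_format, of 1] by simp
    have x: "data_size x \<le> M" "data_size (Lst xs) \<le> M" using Cons.prems(4) by auto
    have t: "truth (eval_expr \<sigma> e)" using Cons.prems by (simp add: e_def of_truth_def truth_def)
    have ce: "cost_expr \<sigma> e \<le> M + 10"
      using Cons.prems by (simp add: e_def of_truth_def floorlog_def)
    let ?u = "pair (pair v x) ?acc"
    let ?\<sigma>1 = "\<sigma>(0 := ?u)"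
    have "runs \<phi> (Assign 0 p) \<sigma> (1 + cost_expr \<sigma> p) ?\<sigma>1"
      by (rule runs_Assign) (use Cons.prems in \<open>simp add: p_def pair_def\<close>)
    moreover have "1 + cost_expr \<sigma> p \<le> 20 * M"
      using Cons.prems(1-4) acc x M by (simp add: p_def)
    ultimately have r1: "runs \<phi> (Assign 0 p) \<sigma> (20 * M) ?\<sigma>1" by (rule runs_mono)
    let ?\<sigma>2 = "?\<sigma>1(z + 2 := Lst xs)"
    have r2: "runs \<phi> (Assign (z + 2) (Unop Tail (Var (z + 2)))) ?\<sigma>1 (1 + M + M) ?\<sigma>2"
      by (rule runs_mono[OF runs_Assign]) (use Cons.prems z x in simp_all)
    obtain \<sigma>3 where r3: "runs \<phi> c2 ?\<sigma>2 (g2 ?u) \<sigma>3" and s3: "\<sigma>3 0 = step v x ?acc"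
      using 2(2)[of \<phi> ?\<sigma>2] by auto
    have z3: "\<sigma>3 z = v" "\<sigma>3 (z + 2) = Lst xs"
      using runs_unchanged[OF r3 fresh(3), of z] runs_unchanged[OF r3 fresh(3), of "z + 2"] Cons.prems z
      by simp_all
    have "data_size ?u \<le> 5 * M" using Cons.prems(3) acc x M by (simp add: pair_def)
    then have "g2 ?u \<le> a * (5 * M) ^ k"
      by (intro order_trans[OF ak] mult_left_mono power_mono) auto
    then have r3': "runs \<phi> c2 ?\<sigma>2 (a * (5 * M) ^ k) \<sigma>3" using r3 by (rule runs_mono[rotated])
    let ?\<sigma>4 = "\<sigma>3(z + 1 := step v x ?acc)"
    have r4: "runs \<phi> (Assign (z + 1) (Var 0)) \<sigma>3 (1 + M) ?\<sigma>4"
      by (rule runs_mono[OF runs_Assign]) (use s3 acc' in simp_all)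
    have rb: "runs \<phi> body \<sigma> (20 * M + (1 + M + M + (a * (5 * M) ^ k + (1 + M)))) ?\<sigma>4"
      unfolding body_def by (rule runs_Then[OF r1 runs_Then[OF r2 runs_Then[OF r3' r4]]])
    have "\<forall>n\<le>length xs. data_size (fold (step v) (take n xs) (?\<sigma>4 (z + 1))) \<le> M"
      using Cons.prems(5)[rule_format, of "Suc n" for n] by auto
    moreover have "?\<sigma>4 z = v" "?\<sigma>4 (z + 2) = Lst xs" using z3 by simp_all
    ultimately obtain \<sigma>5 where
      r5: "runs \<phi> (Loop e body) ?\<sigma>4 ((length xs + 1) * (100 * M + a * (5 * M) ^ k)) \<sigma>5"
      and s5: "\<sigma>5 (z + 1) = fold (step v) xs (?\<sigma>4 (z + 1))"
      using Cons.IH[of ?\<sigma>4] Cons.prems(3) x(2) by blast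
    have "1 + cost_expr \<sigma> e + (20 * M + (1 + M + M + (a * (5 * M) ^ k + (1 + M))))
        + (length xs + 1) * (100 * M + a * (5 * M) ^ k)
      \<le> (length (x # xs) + 1) * (100 * M + a * (5 * M) ^ k)"
      using ce M by (simp add: algebra_simps)
    then show ?case
      using runs_mono[OF runs_LoopTrue[OF t rb r5]] s5 by (intro exI[of _ \<sigma>5]) simp
  qed
  define c where "c = Then (Assign z (Var 0)) (Then c0 (Then (Assign (z + 1) (Var 0)) (Then (Assign 0 (Var z))
    (Then c1 (Then (Assign (z + 2) (Var 0)) (Then (Loop e body) (Assign 0 (Var (z + 1)))))))))"
  define M where "M = (\<lambda>v. data_size v + data_size (Lst (l v)) + b v)"
  define T where "T = (\<lambda>v. (data_size (Lst (l v)) + 1) * (100 * M v + a * (5 * M v) ^ k))"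
  define g where "g = (\<lambda>v. (1 + data_size v) + (g0 v + ((1 + data_size (F v)) + ((1 + data_size v) +
    (g1 v + ((1 + data_size (Lst (l v))) + (T v + (1 + b v))))))))"
  have pM: "poly_bounded M" unfolding M_def by (intro poly_bounded_intros b poly_time_size[OF L])
  have pT: "poly_bounded T" unfolding T_def by (intro poly_bounded_intros pM poly_time_size[OF L])
  have pg: "poly_bounded g"
    unfolding g_def by (intro poly_bounded_intros 0 1 b pT poly_time_size[OF L] poly_time_size[OF I])
  have r: "\<exists>\<sigma>'. runs \<phi> c \<sigma> (g (\<sigma> 0)) \<sigma>' \<and> \<sigma>' 0 = fold (step (\<sigma> 0)) (l (\<sigma> 0)) (F (\<sigma> 0))" for \<phi> \<sigma>
  proof -
    let ?v = "\<sigma> 0"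
    let ?\<sigma>1 = "\<sigma>(z := ?v)"
    have r1: "runs \<phi> (Assign z (Var 0)) \<sigma> (1 + data_size ?v) ?\<sigma>1"
      using runs_Assign[of ?\<sigma>1 \<sigma> z "Var 0" \<phi>] by simp
    from 0(2)[of \<phi> ?\<sigma>1] z(1) obtain \<sigma>2 where r2: "runs \<phi> c0 ?\<sigma>1 (g0 ?v) \<sigma>2" and s2: "\<sigma>2 0 = F ?v"
      by auto
    have z2: "\<sigma>2 z = ?v" using runs_unchanged[OF r2 fresh(1)] by simp
    let ?\<sigma>3 = "\<sigma>2(z + 1 := F ?v)"
    have r3: "runs \<phi> (Assign (z + 1) (Var 0)) \<sigma>2 (1 + data_size (F ?v)) ?\<sigma>3"
      using runs_Assign[of ?\<sigma>3 \<sigma>2 "z + 1" "Var 0" \<phi>] s2 by simp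
    let ?\<sigma>4 = "?\<sigma>3(0 := ?v)"
    have r4: "runs \<phi> (Assign 0 (Var z)) ?\<sigma>3 (1 + data_size ?v) ?\<sigma>4"
      using runs_Assign[of ?\<sigma>4 ?\<sigma>3 0 "Var z" \<phi>] z2 by simp
    from 1(2)[of \<phi> ?\<sigma>4] obtain \<sigma>5 where r5: "runs \<phi> c1 ?\<sigma>4 (g1 ?v) \<sigma>5" and s5: "\<sigma>5 0 = Lst (l ?v)"
      by auto
    have z5: "\<sigma>5 z = ?v" "\<sigma>5 (z + 1) = F ?v"
      using runs_unchanged[OF r5 fresh(2), of z] runs_unchanged[OF r5 fresh(2), of "z + 1"] z z2 by simp_all
    let ?\<sigma>6 = "\<sigma>5(z + 2 := Lst (l ?v))"
    have r6: "runs \<phi> (Assign (z + 2) (Var 0)) \<sigma>5 (1 + data_size (Lst (l ?v))) ?\<sigma>6"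
      using runs_Assign[of ?\<sigma>6 \<sigma>5 "z + 2" "Var 0" \<phi>] s5 by simp
    have "\<forall>n\<le>length (l ?v). data_size (fold (step ?v) (take n (l ?v)) (?\<sigma>6 (z + 1))) \<le> M ?v"
    proof (intro allI impI)
      fix n
      assume "n \<le> length (l ?v)"
      from bound[OF this] show "data_size (fold (step ?v) (take n (l ?v)) (?\<sigma>6 (z + 1))) \<le> M ?v"
        unfolding M_def using z5 by simp
    qed
    moreover have "?\<sigma>6 z = ?v" "?\<sigma>6 (z + 2) = Lst (l ?v)" using z5 by simp_all
    moreover have "data_size ?v \<le> M ?v" "data_size (Lst (l ?v)) \<le> M ?v" by (simp_all add: M_def)
    ultimately obtain \<sigma>7 where
      r7: "runs \<phi> (Loop e body) ?\<sigma>6 ((length (l ?v) + 1) * (100 * M ?v + a * (5 * M ?v) ^ k)) \<sigma>7"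
      and "\<sigma>7 (z + 1) = fold (step ?v) (l ?v) (?\<sigma>6 (z + 1))"
      using loop[of ?\<sigma>6 ?v "l ?v" "M ?v" \<phi>] by blast
    then have s7: "\<sigma>7 (z + 1) = fold (step ?v) (l ?v) (F ?v)" using z5 by simp
    have "length (l ?v) \<le> data_size (Lst (l ?v))" by (rule length_le_data_size)
    then have "(length (l ?v) + 1) * (100 * M ?v + a * (5 * M ?v) ^ k) \<le> T ?v"
      unfolding T_def by (intro mult_right_mono add_right_mono) auto
    then have r7': "runs \<phi> (Loop e body) ?\<sigma>6 (T ?v) \<sigma>7" using r7 by (rule runs_mono[rotated])
    let ?\<sigma>8 = "\<sigma>7(0 := fold (step ?v) (l ?v) (F ?v))"
    have r8: "runs \<phi> (Assign 0 (Var (z + 1))) \<sigma>7 (1 + b ?v) ?\<sigma>8"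
      by (rule runs_mono[OF runs_Assign]) (use s7 bound[of "length (l ?v)" ?v] in simp_all)
    show ?thesis unfolding c_def g_def
      by (rule exI[of _ ?\<sigma>8], rule conjI,
          (rule runs_Then[OF r1 runs_Then[OF r2 runs_Then[OF r3 runs_Then[OF r4 runs_Then[OF r5
             runs_Then[OF r6 runs_Then[OF r7' r8]]]]]]]))
         simp
  qed
  show ?thesis
    by (rule poly_timeI[where F = "\<lambda>v. fold (step v) (l v) (F v)" and g = g and c = c, OF pg r])
qed

text \<open>If each step adds at most \<open>c v\<close>, whatever the accumulator, the final size
  is at most the initial one plus \<open>c v\<close> per element. Concatenation, sums and even
  products are of this kind.\<close>

lemma poly_time_fold_additive:
  assumes I: "poly_time F" and L: "poly_time (\<lambda>v. Lst (l v))"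
    and S: "poly_time (\<lambda>u. step (first (first u)) (second (first u)) (second u))"
    and c: "poly_bounded c"
    and bound: "\<And>v x acc. x \<in> set (l v) \<Longrightarrow> data_size (step v x acc) \<le> data_size acc + c v"
  shows "poly_time (\<lambda>v. fold (step v) (l v) (F v))"
proof -
  have pb: "poly_bounded (\<lambda>v. data_size (F v) + data_size (Lst (l v)) * c v)"
    by (intro poly_bounded_intros c poly_time_size[OF L] poly_time_size[OF I])
  have b: "data_size (fold (step v) (take n (l v)) (F v)) \<le> data_size (F v) + data_size (Lst (l v)) * c v"
    for v n
  proof -
    have "data_size (fold (step v) xs acc) \<le> data_size acc + length xs * c v" if "set xs \<subseteq> set (l v)" for xs acc
      using that
    proof (induction xs arbitrary: acc)
      case (Cons x xs)
      from Cons.IH[of "step v x acc"] bound[of x v acc] Cons.prems show ?case by simp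
    qed simp
    from this[OF set_take_subset]
    have "data_size (fold (step v) (take n (l v)) (F v)) \<le> data_size (F v) + length (take n (l v)) * c v" .
    also have "length (take n (l v)) * c v \<le> data_size (Lst (l v)) * c v"
      using length_le_data_size[of "l v"] by (intro mult_right_mono) auto
    finally show ?thesis by simp
  qed
  show ?thesis
    by (rule poly_time_fold[where F = F and l = l and step = step and
          b = "\<lambda>v. data_size (F v) + data_size (Lst (l v)) * c v", OF I L S pb b])
qed

lemma poly_time_first: "poly_time F \<Longrightarrow> poly_time (\<lambda>v. first (F v))"
  unfolding first_def by (rule poly_time_unop)

lemma poly_time_second: "poly_time F \<Longrightarrow> poly_time (\<lambda>v. second (F v))"
  unfolding second_def by (intro poly_time_unop)

definition item :: "nat \<Rightarrow> data \<Rightarrow> data" where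
  "item k v = eval_unop Head ((eval_unop Tail ^^ k) v)"

lemma poly_time_item:
  assumes "poly_time F"
  shows "poly_time (\<lambda>v. item k (F v))"
proof -
  have "poly_time (\<lambda>v. (eval_unop Tail ^^ k) (F v))"
  proof (induction k)
    case (Suc k)
    from poly_time_unop[OF this, of Tail] show ?case by simp
  qed (simp add: assms)
  then show ?thesis unfolding item_def by (rule poly_time_unop)
qed

lemma item_simps [simp]:
  "item 0 (Lst (x # xs)) = x" "item (Suc k) (Lst (x # xs)) = item k (Lst xs)"
  by (simp_all add: item_def funpow_swap1)

lemma poly_time_Cons:
  "poly_time F \<Longrightarrow> poly_time (\<lambda>v. Lst (l v)) \<Longrightarrow> poly_time (\<lambda>v. Lst (F v # l v))"
  using poly_time_binop[of F "\<lambda>v. Lst (l v)" Push] by simp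

lemma poly_time_pair: "poly_time F \<Longrightarrow> poly_time G \<Longrightarrow> poly_time (\<lambda>v. pair (F v) (G v))"
  unfolding pair_def by (intro poly_time_Cons poly_time_const)

lemma poly_time_list_of: "poly_time F \<Longrightarrow> poly_time (\<lambda>v. Lst (list_of (F v)))"
  using poly_time_unop[OF poly_time_binop[OF poly_time_const[of "Num 0"], of F Push], of Tail] by simp

text \<open>\<open>head (filter Q xs)\<close> is a bounded search for the first hit; a failed search
  yields \<open>Lst []\<close>, which \<open>num_of\<close> reads as 0.\<close>

definition head :: "data list \<Rightarrow> data" where
  "head xs = (case xs of [] \<Rightarrow> Lst [] | x # _ \<Rightarrow> x)"

lemma poly_time_head: "poly_time (\<lambda>v. Lst (l v)) \<Longrightarrow> poly_time (\<lambda>v. head (l v))"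
  using poly_time_unop[of "\<lambda>v. Lst (l v)" Head] by (simp add: head_def)

lemma poly_time_num_of: "poly_time F \<Longrightarrow> poly_time (\<lambda>v. Num (num_of (F v)))"
  using poly_time_binop[of F "\<lambda>_. Num 0" Add] by (simp add: poly_time_const)

lemma poly_time_arith:
  assumes "poly_time (\<lambda>v. Num (f v))" "poly_time (\<lambda>v. Num (g v))"
  shows "poly_time (\<lambda>v. Num (f v + g v))" "poly_time (\<lambda>v. Num (f v - g v))"
    "poly_time (\<lambda>v. Num (f v * g v))" "poly_time (\<lambda>v. Num (f v div g v))"
    "poly_time (\<lambda>v. of_truth (f v < g v))" "poly_time (\<lambda>v. of_truth (f v = g v))"
  using poly_time_binop[OF assms, of Add] poly_time_binop[OF assms, of Sub]
    poly_time_binop[OF assms, of Mul] poly_time_binop[OF assms, of Div]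
    poly_time_binop[OF assms, of Less] poly_time_binop[OF assms, of Equal] by simp_all

lemma poly_time_power: "poly_time (\<lambda>v. Num (f v)) \<Longrightarrow> poly_time (\<lambda>v. Num (f v ^ k))"
  by (induction k) (simp_all add: poly_time_const poly_time_arith)

text \<open>The machine only compares strictly; over the integers \<open>a \<le> b\<close> is
  \<open>a < b + 1\<close>.\<close>

lemma poly_time_le:
  assumes "poly_time (\<lambda>v. Num (f v))" "poly_time (\<lambda>v. Num (g v))"
  shows "poly_time (\<lambda>v. of_truth (f v \<le> g v))"
  using poly_time_arith(5)[OF assms(1) poly_time_arith(1)[OF assms(2) poly_time_const[of "Num 1"]]]
  by (simp add: zless_add1_eq le_less disj_commute)

lemma poly_time_conj:
  assumes "poly_time (\<lambda>v. of_truth (P v))" "poly_time (\<lambda>v. of_truth (Q v))"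
  shows "poly_time (\<lambda>v. of_truth (P v \<and> Q v))"
proof -
  have "(\<lambda>v. of_truth (P v \<and> Q v)) = (\<lambda>v. if P v then of_truth (Q v) else of_truth False)" by auto
  then show ?thesis using poly_time_If[OF assms poly_time_const] by simp
qed

lemma poly_time_If_Num:
  assumes "poly_time (\<lambda>v. of_truth (P v))" "poly_time (\<lambda>v. Num (f v))" "poly_time (\<lambda>v. Num (g v))"
  shows "poly_time (\<lambda>v. Num (if P v then f v else g v))"
  using poly_time_If[OF assms] by (simp add: if_distrib)

lemma poly_time_If_Lst:
  assumes "poly_time (\<lambda>v. of_truth (P v))" "poly_time (\<lambda>v. Lst (f v))" "poly_time (\<lambda>v. Lst (g v))"
  shows "poly_time (\<lambda>v. Lst (if P v then f v else g v))"
  using poly_time_If[OF assms] by (simp add: if_distrib)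

text \<open>Lists grow only at the front, so a single pass reverses; appending takes one further
  reversal.\<close>

lemma poly_time_rev_append:
  assumes "poly_time (\<lambda>v. Lst (l v))" "poly_time (\<lambda>v. Lst (m v))"
  shows "poly_time (\<lambda>v. Lst (rev (l v) @ m v))"
proof -
  have "poly_time (\<lambda>v. fold (\<lambda>x acc. eval_binop Push x acc) (l v) (Lst (m v)))"
  proof (rule poly_time_fold_additive[where step = "\<lambda>v x acc. eval_binop Push x acc", OF assms(2,1)])
    show "poly_time (\<lambda>u. eval_binop Push (second (first u)) (second u))"
      by (intro poly_time_binop poly_time_second poly_time_first poly_time_id)
    show "poly_bounded (\<lambda>v. 3 + data_size (Lst (l v)))"
      by (intro poly_bounded_intros poly_time_size[OF assms(1)])
    show "data_size (eval_binop Push x acc) \<le> data_size acc + (3 + data_size (Lst (l v)))"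
      if "x \<in> set (l v)" for v x acc
      using eval_binop_size[of Push x acc] member_le_sum_list[of "data_size x" "map data_size (l v)"] that
      by auto
  qed
  moreover have "fold (\<lambda>x acc. eval_binop Push x acc) xs (Lst ys) = Lst (rev xs @ ys)" for xs ys
    by (induction xs arbitrary: ys) auto
  ultimately show ?thesis by simp
qed

lemma poly_time_rev: "poly_time (\<lambda>v. Lst (l v)) \<Longrightarrow> poly_time (\<lambda>v. Lst (rev (l v)))"
  using poly_time_rev_append[of l "\<lambda>_. []"] by (simp add: poly_time_const)

lemma poly_time_append:
  "poly_time (\<lambda>v. Lst (l v)) \<Longrightarrow> poly_time (\<lambda>v. Lst (m v)) \<Longrightarrow> poly_time (\<lambda>v. Lst (l v @ m v))"
  using poly_time_rev_append[OF poly_time_rev] by simp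

text \<open>A bound on \<open>h\<close> polynomial in the size of \<open>pair v x\<close> becomes
  one in \<open>v\<close> alone, the same for all \<open>x\<close>, because an element is no larger
  than the list containing it.\<close>

lemma poly_time_elementwise_bound:
  assumes L: "poly_time (\<lambda>v. Lst (l v))" and S: "poly_time (\<lambda>u. h (first u) (second u))"
  obtains c where "poly_bounded c" "\<And>v x. x \<in> set (l v) \<Longrightarrow> data_size (h v x) \<le> c v"
proof -
  from poly_time_size[OF S] obtain a k where ak: "\<And>u. data_size (h (first u) (second u)) \<le> a * data_size u ^ k"
    unfolding poly_bounded_def by blast
  let ?c = "\<lambda>v. a * (1 + data_size v + data_size (Lst (l v))) ^ k"
  show ?thesis
  proof (rule that[of ?c])
    show "poly_bounded ?c" by (intro poly_bounded_intros poly_time_size[OF L])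
    show "data_size (h v x) \<le> ?c v" if "x \<in> set (l v)" for v x
    proof -
      have "data_size (pair v x) \<le> 1 + data_size v + data_size (Lst (l v))"
        using member_le_sum_list[of "data_size x" "map data_size (l v)"] that by (simp add: pair_def)
      then have "a * data_size (pair v x) ^ k \<le> ?c v" by (intro mult_left_mono power_mono) auto
      then show ?thesis by (rule order_trans[OF ak[of "pair v x", unfolded first_pair second_pair]])
    qed
  qed
qed

lemma poly_time_sum_list:
  assumes L: "poly_time (\<lambda>v. Lst (l v))" and S: "poly_time (\<lambda>u. Num (h (first u) (second u)))"
  shows "poly_time (\<lambda>v. Num (\<Sum>x\<leftarrow>l v. h v x))"
proof -
  obtain c where c: "poly_bounded c" "\<And>v x. x \<in> set (l v) \<Longrightarrow> data_size (Num (h v x)) \<le> c v"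
    by (rule poly_time_elementwise_bound[where h = "\<lambda>v x. Num (h v x)", OF L S]) blast
  have "poly_time (\<lambda>v. fold (\<lambda>x acc. eval_binop Add (Num (h v x)) acc) (l v) (Num 0))"
  proof (rule poly_time_fold_additive[where step = "\<lambda>v x acc. eval_binop Add (Num (h v x)) acc",
        OF poly_time_const L])
    show "poly_time (\<lambda>u. eval_binop Add (Num (h (first (first u)) (second (first u)))) (second u))"
      by (intro poly_time_binop poly_time_second poly_time_id poly_time_comp[OF S poly_time_first])
    show "poly_bounded (\<lambda>v. 3 + c v)"
      by (intro poly_bounded_intros c)
    show "data_size (eval_binop Add (Num (h v x)) acc) \<le> data_size acc + (3 + c v)"
      if "x \<in> set (l v)" for v x acc
      using eval_binop_size[of Add "Num (h v x)" acc] c(2)[OF that] by linarith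
  qed
  moreover have "fold (\<lambda>x acc. eval_binop Add (Num (h v x)) acc) xs (Num n) = Num (n + (\<Sum>x\<leftarrow>xs. h v x))" for v xs n
    by (induction xs arbitrary: n) auto
  ultimately show ?thesis by simp
qed

text \<open>Multiplication adds bit lengths, so a product over a list also grows additively. This is
  what makes common denominators and powers computable.\<close>

lemma poly_time_prod_list:
  assumes L: "poly_time (\<lambda>v. Lst (l v))" and S: "poly_time (\<lambda>u. Num (h (first u) (second u)))"
  shows "poly_time (\<lambda>v. Num (\<Prod>x\<leftarrow>l v. h v x))"
proof -
  obtain c where c: "poly_bounded c" "\<And>v x. x \<in> set (l v) \<Longrightarrow> data_size (Num (h v x)) \<le> c v"
    by (rule poly_time_elementwise_bound[where h = "\<lambda>v x. Num (h v x)", OF L S]) blast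
  have "poly_time (\<lambda>v. fold (\<lambda>x acc. eval_binop Mul (Num (h v x)) acc) (l v) (Num 1))"
  proof (rule poly_time_fold_additive[where step = "\<lambda>v x acc. eval_binop Mul (Num (h v x)) acc",
        OF poly_time_const L])
    show "poly_time (\<lambda>u. eval_binop Mul (Num (h (first (first u)) (second (first u)))) (second u))"
      by (intro poly_time_binop poly_time_second poly_time_id poly_time_comp[OF S poly_time_first])
    show "poly_bounded (\<lambda>v. 3 + c v)"
      by (intro poly_bounded_intros c)
    show "data_size (eval_binop Mul (Num (h v x)) acc) \<le> data_size acc + (3 + c v)"
      if "x \<in> set (l v)" for v x acc
      using eval_binop_size[of Mul "Num (h v x)" acc] c(2)[OF that] by linarith
  qed
  moreover have "fold (\<lambda>x acc. eval_binop Mul (Num (h v x)) acc) xs (Num n) = Num (n * (\<Prod>x\<leftarrow>xs. h v x))" for v xs n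
    by (induction xs arbitrary: n) auto
  ultimately show ?thesis by simp
qed

lemma poly_time_concat_map:
  assumes L: "poly_time (\<lambda>v. Lst (l v))" and S: "poly_time (\<lambda>u. Lst (h (first u) (second u)))"
  shows "poly_time (\<lambda>v. Lst (concat (map (h v) (l v))))"
proof -
  obtain c where c: "poly_bounded c" "\<And>v x. x \<in> set (l v) \<Longrightarrow> data_size (Lst (h v x)) \<le> c v"
    by (rule poly_time_elementwise_bound[where h = "\<lambda>v x. Lst (h v x)", OF L S]) blast
  have "poly_time (\<lambda>v. fold (\<lambda>x acc. Lst (list_of acc @ h v x)) (l v) (Lst []))"
  proof (rule poly_time_fold_additive[where step = "\<lambda>v x acc. Lst (list_of acc @ h v x)",
        OF poly_time_const L])
    show "poly_time (\<lambda>u. Lst (list_of (second u) @ h (first (first u)) (second (first u))))"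
      by (intro poly_time_append poly_time_list_of poly_time_second poly_time_id
          poly_time_comp[OF S poly_time_first])
    show "poly_bounded c" by (rule c)
    show "data_size (Lst (list_of acc @ h v x)) \<le> data_size acc + c v"
      if "x \<in> set (l v)" for v x acc
      using data_size_Lst_list_of[of acc] c(2)[OF that] by simp
  qed
  moreover have "fold (\<lambda>x acc. Lst (list_of acc @ h v x)) xs (Lst ys) = Lst (ys @ concat (map (h v) xs))" for v xs ys
    by (induction xs arbitrary: ys) auto
  ultimately show ?thesis by simp
qed

lemma poly_time_map:
  assumes "poly_time (\<lambda>v. Lst (l v))" and "poly_time (\<lambda>u. h (first u) (second u))"
  shows "poly_time (\<lambda>v. Lst (map (h v) (l v)))"
proof -
  have "poly_time (\<lambda>v. Lst (concat (map (\<lambda>x. [h v x]) (l v))))"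
    by (rule poly_time_concat_map[where h = "\<lambda>v x. [h v x]", OF assms(1)])
       (intro poly_time_Cons poly_time_const assms(2))
  then show ?thesis by simp
qed

lemma poly_time_filter:
  assumes "poly_time (\<lambda>v. Lst (l v))" and "poly_time (\<lambda>u. of_truth (P (first u) (second u)))"
  shows "poly_time (\<lambda>v. Lst (filter (P v) (l v)))"
proof -
  have "poly_time (\<lambda>v. Lst (concat (map (\<lambda>x. if P v x then [x] else []) (l v))))"
    by (rule poly_time_concat_map[where h = "\<lambda>v x. if P v x then [x] else []", OF assms(1)])
       (intro poly_time_If_Lst poly_time_Cons poly_time_const assms(2) poly_time_second poly_time_id)
  moreover have "concat (map (\<lambda>x. if P v x then [x] else []) xs) = filter (P v) xs" for v xs
    by (induction xs) auto
  ultimately show ?thesis by simp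
qed

text \<open>Positions are counted from 1, like elements and periods.\<close>

definition enum :: "data list \<Rightarrow> data list" where
  "enum xs = map (\<lambda>k. pair (Num (int k + 1)) (xs ! k)) [0..<length xs]"

definition positions :: "data list \<Rightarrow> data list" where
  "positions xs = map (\<lambda>k. Num (int k)) [1..<Suc (length xs)]"

lemma enum_snoc: "enum (xs @ [x]) = enum xs @ [pair (Num (int (length xs) + 1)) x]"
  by (simp add: enum_def nth_append)

lemma length_enum [simp]: "length (enum xs) = length xs"
  by (simp add: enum_def)

lemma data_size_Num_nat: "data_size (Num (int k)) \<le> 1 + k"
  using floorlog_leI[of k 2 k] less_exp[of k] by simp

lemma poly_time_enum:
  assumes L: "poly_time (\<lambda>v. Lst (l v))"
  shows "poly_time (\<lambda>v. Lst (enum (l v)))"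
proof -
  \<comment> \<open>The index is recomputed as one plus the length of the accumulator, a sum of
    ones. Its size depends on the accumulator, so the additive rule does not apply and the total
    size is bounded directly.\<close>
  define step where "step = (\<lambda>x acc. Lst (pair (Num ((\<Sum>y\<leftarrow>list_of acc. 1) + 1)) x # list_of acc))"
  have fold: "fold step xs (Lst []) = Lst (rev (enum xs))" for xs
  proof (induction xs rule: rev_induct)
    case (snoc x xs)
    then show ?case by (simp add: enum_snoc step_def sum_list_triv)
  qed (simp add: enum_def)
  let ?b = "\<lambda>v. 1 + data_size (Lst (l v)) * (2 + 2 * data_size (Lst (l v)))"
  have "poly_time (\<lambda>v. fold step (l v) (Lst []))"
  proof (rule poly_time_fold[where step = "\<lambda>_. step" and b = ?b, OF poly_time_const L])
    show "poly_time (\<lambda>u. step (second (first u)) (second u))"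
      unfolding step_def
      by (intro poly_time_Cons poly_time_pair poly_time_arith poly_time_sum_list poly_time_list_of
          poly_time_const poly_time_first poly_time_second poly_time_id)
    show "poly_bounded ?b" by (intro poly_bounded_intros poly_time_size[OF L])
    show "data_size (fold step (take n (l v)) (Lst [])) \<le> ?b v" if n: "n \<le> length (l v)" for v n
    proof -
      let ?S = "data_size (Lst (l v))"
      have "data_size x \<le> 2 + 2 * ?S" if "x \<in> set (enum (take n (l v)))" for x
      proof -
        from that obtain k where k: "k < length (l v)" and x: "x = pair (Num (int (Suc k))) (l v ! k)"
          unfolding enum_def by (auto simp: algebra_simps)
        have "data_size (l v ! k) \<le> (\<Sum>w\<leftarrow>l v. data_size w)"
          using member_le_sum_list[of "data_size (l v ! k)" "map data_size (l v)"] k by auto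
        moreover have "data_size (Num (int (Suc k))) \<le> 1 + Suc k" by (rule data_size_Num_nat)
        moreover have "Suc k \<le> ?S" using k length_le_data_size[of "l v"] by linarith
        ultimately show ?thesis unfolding x pair_def by (simp del: data_size.simps(1))
      qed
      then have "(\<Sum>x\<leftarrow>enum (take n (l v)). data_size x) \<le> (\<Sum>x\<leftarrow>enum (take n (l v)). 2 + 2 * ?S)"
        by (intro sum_list_mono)
      also have "\<dots> = n * (2 + 2 * ?S)" using n by (simp add: sum_list_triv min_def)
      also have "\<dots> \<le> ?S * (2 + 2 * ?S)"
        using n length_le_data_size[of "l v"] by (intro mult_right_mono) auto
      finally show ?thesis unfolding fold by (simp add: rev_map[symmetric] sum_list_rev)
    qed
  qed
  then have "poly_time (\<lambda>v. Lst (rev (rev (enum (l v)))))"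
    unfolding fold by (rule poly_time_rev)
  then show ?thesis by simp
qed

lemma poly_time_positions:
  assumes L: "poly_time (\<lambda>v. Lst (l v))"
  shows "poly_time (\<lambda>v. Lst (positions (l v)))"
proof -
  have "poly_time (\<lambda>v. Lst (map (\<lambda>x. first x) (enum (l v))))"
    by (intro poly_time_map[where h = "\<lambda>v x. first x"] poly_time_enum L poly_time_first poly_time_second poly_time_id)
  moreover have "map (\<lambda>x. first x) (enum xs) = positions xs" for xs
    unfolding enum_def positions_def
    by (simp add: comp_def map_Suc_upt[symmetric] algebra_simps del: map_Suc_upt upt_Suc)
  ultimately show ?thesis by simp
qed

text \<open>With these rules a function built from arithmetic, conditionals and \<open>map\<close>,
  \<open>filter\<close>, sums and products over lists is polynomial-time by its syntax.\<close>

lemmas poly_time_intros = poly_time_id poly_time_const poly_time_first poly_time_second poly_time_item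
  poly_time_Cons poly_time_pair poly_time_list_of poly_time_head poly_time_num_of poly_time_arith
  poly_time_power poly_time_le poly_time_conj poly_time_If_Num poly_time_If_Lst poly_time_append
  poly_time_sum_list poly_time_prod_list poly_time_concat_map poly_time_map poly_time_filter
  poly_time_enum poly_time_positions

section \<open>The rounding algorithm\<close>

text \<open>
  Below \<open>ts\<close> is the list of the periods, \<open>e\<close> an even number at least \<open>2\<alpha>\<close>, and \<open>xs\<close> the list of the
  entries \<open>[i, s, t, [numerator, denominator]]\<close> of \<open>x\<close>. Multiplying all masses by the product of the
  denominators avoids fractions.
\<close>

definition den_prod :: "data list \<Rightarrow> int" where
  "den_prod xs = (\<Prod>e\<leftarrow>xs. num_of (item 1 (item 3 e)))"

text \<open>\<open>den_prod xs\<close> times the mass that \<open>x\<close> puts on the periods 1 to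
  \<open>a\<close>. The division is exact, every denominator being a factor of the product. The
  positivity test drops entries for period 0, which an encoding may contain although they name no LP
  variable.\<close>

definition scaled_mass :: "data list \<Rightarrow> int \<Rightarrow> int \<Rightarrow> int \<Rightarrow> int" where
  "scaled_mass xs i a t = (\<Sum>e\<leftarrow>xs.
     if num_of (item 0 e) = i \<and> 0 < num_of (item 1 e) \<and> num_of (item 1 e) \<le> a \<and> num_of (item 2 e) = t
     then num_of (item 0 (item 3 e)) * (den_prod xs div num_of (item 1 (item 3 e))) else 0)"

definition median :: "data list \<Rightarrow> data list \<Rightarrow> int \<Rightarrow> int \<Rightarrow> int" where
  "median ts xs i t = num_of (head (filter (\<lambda>s. den_prod xs \<le> 2 * scaled_mass xs i (num_of s) t) ts))"

text \<open>
  \<open>bpow ts b k\<close> is the power \<open>b^k\<close> for \<open>0 \<le> k \<le> T\<close>, in a form covered by the closure rule for products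
  over lists; \<open>log_len ts\<close> is 8 plus the integer part of \<open>log\<^sub>2 T\<close>.
\<close>

definition bpow :: "data list \<Rightarrow> int \<Rightarrow> int \<Rightarrow> int" where
  "bpow ts b k = (\<Prod>j\<leftarrow>ts. if num_of j \<le> k then b else 1)"

definition log_len :: "data list \<Rightarrow> int" where
  "log_len ts = 8 + (\<Sum>k\<leftarrow>ts. if bpow ts 2 (num_of k) \<le> (\<Sum>j\<leftarrow>ts. 1) then 1 else 0)"

text \<open>The integer part \<open>D\<close> of the \<open>e\<close>-th root of
  \<open>L = log_len ts\<close>. Only the length of the list under \<open>positions\<close> counts:
  it supplies the candidates 1 to \<open>8 + T\<close>, among them \<open>L\<close>, which passes
  the test.\<close>

definition stretch_base :: "nat \<Rightarrow> data list \<Rightarrow> int" where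
  "stretch_base e ts = num_of (head (filter (\<lambda>d. log_len ts < (num_of d + 1) ^ e)
     (positions (replicate 8 (Num 0) @ ts))))"

text \<open>The least \<open>m\<close> with \<open>(1 + 1 / m) ^ e \<le> L\<close>, cleared of
  fractions. \<open>m = e\<close> qualifies, so \<open>e\<close> candidates suffice, and
  \<open>e\<close> is a constant of the program.\<close>

definition stretch_den :: "nat \<Rightarrow> data list \<Rightarrow> int" where
  "stretch_den e ts = num_of (head (filter (\<lambda>m. (num_of m + 1) ^ e \<le> log_len ts * num_of m ^ e)
     (positions (replicate e (Num 0)))))"

text \<open>For \<open>D = stretch_base e ts\<close> at least 3, the choice
  \<open>B = P = D - 1\<close> and \<open>M = 1\<close> gives the stretch
  \<open>1 + P / M = D\<close> and keeps \<open>B * M / P\<close> at 1. The threshold is 3 because a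
  class base must be at least 2.\<close>

definition class_base :: "nat \<Rightarrow> data list \<Rightarrow> int" where
  "class_base e ts = (if 3 \<le> stretch_base e ts then stretch_base e ts - 1 else 2)"

definition grid_num :: "nat \<Rightarrow> data list \<Rightarrow> int" where
  "grid_num e ts = (if 3 \<le> stretch_base e ts then stretch_base e ts - 1 else 1)"

definition grid_den :: "nat \<Rightarrow> data list \<Rightarrow> int" where
  "grid_den e ts = (if 3 \<le> stretch_base e ts then 1 else stretch_den e ts)"

text \<open>The search includes 0, which \<open>ts\<close> does not contain. The power
  \<open>k + 1\<close> is split into one factor and the power \<open>k\<close> to stay within the
  range of \<open>bpow\<close>.\<close>

definition level :: "nat \<Rightarrow> data list \<Rightarrow> int \<Rightarrow> int" where
  "level e ts w = num_of (head (filter (\<lambda>k. w < class_base e ts * bpow ts (class_base e ts) (num_of k)) (Num 0 # ts)))"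

definition raw_spacing :: "nat \<Rightarrow> data list \<Rightarrow> int \<Rightarrow> int" where
  "raw_spacing e ts w = bpow ts (class_base e ts) (level e ts w) * grid_num e ts div grid_den e ts"

definition spacing_of :: "nat \<Rightarrow> data list \<Rightarrow> int \<Rightarrow> int" where
  "spacing_of e ts w = (if 1 \<le> raw_spacing e ts w then raw_spacing e ts w else 1)"

text \<open>Grid points are 1 plus multiples of the spacing, so snapping never goes below period 1.
  An interval of length 0 has no holding cost, and no factor could pay for a shift; it is left
  alone.\<close>

definition snap :: "nat \<Rightarrow> data list \<Rightarrow> int \<Rightarrow> int \<Rightarrow> int" where
  "snap e ts a t = (if a = t then a else 1 + spacing_of e ts (t - a) * ((a - 1) div spacing_of e ts (t - a)))"

definition service :: "nat \<Rightarrow> data list \<Rightarrow> data list \<Rightarrow> int \<Rightarrow> int \<Rightarrow> int" where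
  "service e ts xs i t = snap e ts (median ts xs i t) t"

definition points :: "data list \<Rightarrow> data list" where
  "points tab = concat (map (\<lambda>r. concat (map (\<lambda>c.
     if 0 < num_of (item 0 (second c)) then [pair (first r) (first c)] else [])
       (enum (list_of (second r))))) (enum tab))"

text \<open>Every period gets exactly one entry, with the empty set if nothing is served from it;
  this is free, since the empty family covers the empty set. An element may be listed repeatedly, as
  only the set of the list counts.\<close>

definition round_y :: "nat \<Rightarrow> data list \<Rightarrow> data list \<Rightarrow> data list \<Rightarrow> data list" where
  "round_y e ts xs ps = map (\<lambda>s. Lst [Lst (concat (map (\<lambda>p.
     if service e ts xs (num_of (first p)) (num_of (second p)) = num_of s then [first p] else []) ps)),
     s, Lst [Num 1, Num 1]]) ts"

definition round_x :: "nat \<Rightarrow> data list \<Rightarrow> data list \<Rightarrow> data list \<Rightarrow> data list" where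
  "round_x e ts xs ps = map (\<lambda>p. Lst [first p,
     Num (service e ts xs (num_of (first p)) (num_of (second p))), second p, Lst [Num 1, Num 1]]) ps"

text \<open>The horizon as a number cannot be unfolded in time polynomial in its bit length, but the
  rows of the demand table have length \<open>T\<close>, and there is a first row because there is
  at least one element.\<close>

definition periods :: "data \<Rightarrow> data list" where
  "periods v = positions (list_of (item 0 (item 2 v)))"

text \<open>The argument pairs the instance with an encoded LP solution. Service periods are
  computed from the \<open>x\<close> entries; \<open>y\<close> acts in the analysis, as a fractional
  cover.\<close>

definition rounding :: "nat \<Rightarrow> data \<Rightarrow> data" where
  "rounding e v = Lst
     [Lst (round_y e (periods (first v)) (list_of (item 1 (second v))) (points (list_of (item 2 (first v))))),
      Lst (round_x e (periods (first v)) (list_of (item 1 (second v))) (points (list_of (item 2 (first v)))))]"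

lemma poly_time_den_prod:
  assumes "poly_time (\<lambda>v. Lst (xs v))"
  shows "poly_time (\<lambda>v. Num (den_prod (xs v)))"
  unfolding den_prod_def by (intro poly_time_intros assms)

lemma poly_time_scaled_mass:
  assumes "poly_time (\<lambda>v. Lst (xs v))" "poly_time (\<lambda>v. Num (i v))" "poly_time (\<lambda>v. Num (a v))"
    "poly_time (\<lambda>v. Num (t v))"
  shows "poly_time (\<lambda>v. Num (scaled_mass (xs v) (i v) (a v) (t v)))"
  unfolding scaled_mass_def
  \<comment> \<open>Under a binder the context sits in \<open>first u\<close>; composing the
    assumptions with a further function moves them there.\<close>
  by (intro poly_time_intros poly_time_den_prod assms assms[THEN poly_time_comp])

lemma poly_time_median:
  assumes "poly_time (\<lambda>v. Lst (ts v))" "poly_time (\<lambda>v. Lst (xs v))" "poly_time (\<lambda>v. Num (i v))"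
    "poly_time (\<lambda>v. Num (t v))"
  shows "poly_time (\<lambda>v. Num (median (ts v) (xs v) (i v) (t v)))"
  unfolding median_def
  by (intro poly_time_intros poly_time_den_prod poly_time_scaled_mass assms assms[THEN poly_time_comp])

lemma poly_time_bpow:
  assumes "poly_time (\<lambda>v. Lst (ts v))" "poly_time (\<lambda>v. Num (b v))" "poly_time (\<lambda>v. Num (k v))"
  shows "poly_time (\<lambda>v. Num (bpow (ts v) (b v) (k v)))"
  unfolding bpow_def by (intro poly_time_intros assms assms[THEN poly_time_comp])

lemma poly_time_log_len:
  assumes "poly_time (\<lambda>v. Lst (ts v))"
  shows "poly_time (\<lambda>v. Num (log_len (ts v)))"
  unfolding log_len_def by (intro poly_time_intros poly_time_bpow assms assms[THEN poly_time_comp])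

lemma poly_time_stretch_base:
  assumes "poly_time (\<lambda>v. Lst (ts v))"
  shows "poly_time (\<lambda>v. Num (stretch_base e (ts v)))"
  unfolding stretch_base_def by (intro poly_time_intros poly_time_log_len assms assms[THEN poly_time_comp])

lemma poly_time_stretch_den:
  assumes "poly_time (\<lambda>v. Lst (ts v))"
  shows "poly_time (\<lambda>v. Num (stretch_den e (ts v)))"
  unfolding stretch_den_def by (intro poly_time_intros poly_time_log_len assms assms[THEN poly_time_comp])

lemma poly_time_parameters:
  assumes "poly_time (\<lambda>v. Lst (ts v))"
  shows "poly_time (\<lambda>v. Num (class_base e (ts v)))" "poly_time (\<lambda>v. Num (grid_num e (ts v)))"
    "poly_time (\<lambda>v. Num (grid_den e (ts v)))"
  unfolding class_base_def grid_num_def grid_den_def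
  by (intro poly_time_intros poly_time_stretch_base poly_time_stretch_den assms)+

lemma poly_time_spacing_of:
  assumes "poly_time (\<lambda>v. Lst (ts v))" "poly_time (\<lambda>v. Num (w v))"
  shows "poly_time (\<lambda>v. Num (spacing_of e (ts v) (w v)))"
  unfolding spacing_of_def raw_spacing_def level_def
  by (intro poly_time_intros poly_time_parameters poly_time_bpow assms assms[THEN poly_time_comp])

lemma poly_time_service:
  assumes "poly_time (\<lambda>v. Lst (ts v))" "poly_time (\<lambda>v. Lst (xs v))" "poly_time (\<lambda>v. Num (i v))"
    "poly_time (\<lambda>v. Num (t v))"
  shows "poly_time (\<lambda>v. Num (service e (ts v) (xs v) (i v) (t v)))"
  unfolding service_def snap_def by (intro poly_time_intros poly_time_median poly_time_spacing_of assms)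

lemma poly_time_points:
  assumes "poly_time (\<lambda>v. Lst (tab v))"
  shows "poly_time (\<lambda>v. Lst (points (tab v)))"
  unfolding points_def by (intro poly_time_intros assms assms[THEN poly_time_comp])

lemma poly_time_rounding: "poly_time (rounding e)"
proof -
  have "poly_time (\<lambda>v. rounding e v)"
    unfolding rounding_def round_x_def round_y_def periods_def
    by (intro poly_time_intros poly_time_service poly_time_points)
  then show ?thesis .
qed

section \<open>Cost of the rounded solution\<close>

text \<open>The definition indexes families by natural numbers; enumerating \<open>K\<close> carries
  it over to any finite index set, such as pairs of a period and a set.\<close>

lemma fractional_subadditive_family:
  fixes C :: "'k \<Rightarrow> nat set" and l :: "'k \<Rightarrow> real"
  assumes f: "fractional_subadditive \<beta> N f" and S: "S \<subseteq> {1..N}" and K: "finite K"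
    and C: "\<And>k. k \<in> K \<Longrightarrow> C k \<subseteq> {1..N} \<and> 0 \<le> l k \<and> l k \<le> 1"
    and cover: "\<And>v. v \<in> S \<Longrightarrow> 1 \<le> (\<Sum>k\<in>{k\<in>K. v \<in> C k}. l k)"
  shows "f S \<le> \<beta> * (\<Sum>k\<in>K. l k * f (C k))"
proof -
  obtain h where h: "bij_betw h {0..<card K} K"
    using ex_bij_betw_nat_finite[OF K] by blast
  have h_in: "h j \<in> K" if "j \<in> {0..<card K}" for j by (rule bij_betwE[OF h, rule_format, OF that])
  have im: "h ` {0..<card K} = K" by (rule bij_betw_imp_surj_on[OF h])
  have cover': "\<forall>v\<in>S. 1 \<le> (\<Sum>j\<in>{j\<in>{0..<card K}. v \<in> C (h j)}. l (h j))"
  proof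
    fix v
    assume v: "v \<in> S"
    have "h ` {j\<in>{0..<card K}. v \<in> C (h j)} = {k\<in>K. v \<in> C k}"
    proof (intro equalityI subsetI)
      fix k
      assume k: "k \<in> {k\<in>K. v \<in> C k}"
      then have "k \<in> K" by simp
      then have "k \<in> h ` {0..<card K}" unfolding im .
      then show "k \<in> h ` {j\<in>{0..<card K}. v \<in> C (h j)}" using k by blast
    qed (use h_in in blast)
    then have "bij_betw h {j\<in>{0..<card K}. v \<in> C (h j)} {k\<in>K. v \<in> C k}"
      by (intro bij_betw_subset[OF h]) auto
    from sum.reindex_bij_betw[OF this, of l] cover[OF v]
    show "1 \<le> (\<Sum>j\<in>{j\<in>{0..<card K}. v \<in> C (h j)}. l (h j))" by simp
  qed
  have C': "\<forall>j\<in>{0..<card K}. C (h j) \<subseteq> {1..N} \<and> 0 \<le> l (h j) \<and> l (h j) \<le> 1"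
    using C[OF h_in] by blast
  have "f S \<le> \<beta> * (\<Sum>j\<in>{0..<card K}. l (h j) * f (C (h j)))"
    by (rule f[unfolded fractional_subadditive_def, THEN spec, THEN mp, OF S, THEN spec[where x = "{0..<card K}"],
          THEN spec[where x = "\<lambda>j. C (h j)"], THEN spec[where x = "\<lambda>j. l (h j)"], THEN mp, OF finite_atLeastLessThan, THEN mp, OF C', THEN mp, OF cover'])
  also have "(\<Sum>j\<in>{0..<card K}. l (h j) * f (C (h j))) = (\<Sum>k\<in>K. l k * f (C k))"
    by (rule sum.reindex_bij_betw[OF h])
  finally show ?thesis .
qed

text \<open>The rounding over natural numbers, free of encodings. The conditions on \<open>a\<close>
  describe the median: mass at least 1/2 up to \<open>a\<close> controls the holding cost, and mass
  below 1/2 before \<open>a\<close> leaves at least 1/2 on \<open>{a..t}\<close> for the ordering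
  cost.\<close>

locale lp_rounding =
  fixes I :: inventory and \<alpha> \<beta> :: real and y :: y_vars and x :: x_vars
    and B P M :: nat and a :: "nat \<Rightarrow> nat \<Rightarrow> nat"
  assumes problem: "inventory_problem I"
    and poly: "polynomial_holding \<alpha> I" and alpha: "1 \<le> \<alpha>"
    and subadd: "fractional_subadditive \<beta> (elems I) (order_cost I)" and beta: "0 \<le> \<beta>"
    and feasible: "LP_feasible I y x"
    and B: "2 \<le> B" and P: "1 \<le> P" and M: "1 \<le> M"
    and a_range: "\<And>i t. (i, t) \<in> demand_points I \<Longrightarrow> a i t \<in> {1..t}"
    and a_ge: "\<And>i t. (i, t) \<in> demand_points I \<Longrightarrow> 1 / 2 \<le> (\<Sum>s=1..a i t. x i s t)"
    and a_less: "\<And>i t. (i, t) \<in> demand_points I \<Longrightarrow> (\<Sum>s\<in>{1..<a i t}. x i s t) < 1 / 2"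
begin

text \<open>\<open>B ^ k * P / M\<close> may be below 1 for short intervals; spacing 1 then means
  that nothing is moved.\<close>

definition spacing :: "nat \<Rightarrow> nat" where
  "spacing k = max 1 (B ^ k * P div M)"

definition length_class :: "nat \<Rightarrow> nat" where
  "length_class w = (LEAST k. w < B ^ (k + 1))"

definition g :: "nat \<Rightarrow> nat \<Rightarrow> nat" where
  "g i t = (if a i t = t then t else
     1 + spacing (length_class (t - a i t)) * ((a i t - 1) div spacing (length_class (t - a i t))))"

definition U :: "nat \<Rightarrow> nat set" where
  "U s = {i. \<exists>t. (i, t) \<in> demand_points I \<and> g i t = s}"

text \<open>Vanishing outside the index ranges, \<open>y'\<close> and \<open>x'\<close> equal the
  decoded output as functions.\<close>

definition y' :: y_vars where
  "y' S s = (if s \<in> {1..horizon I} \<and> S = U s then 1 else 0)"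

definition x' :: x_vars where
  "x' i s t = (if (i, t) \<in> demand_points I \<and> s = g i t then 1 else 0)"

text \<open>Contains the intervals of all points served from \<open>s\<close>: \<open>s\<close>
  itself for length 0, and for each class \<open>k\<close> whose grid contains \<open>s\<close> a
  stretch long enough for a shift below \<open>spacing k\<close> plus a length below
  \<open>B ^ (k + 1)\<close>.\<close>

definition win :: "nat \<Rightarrow> nat set" where
  "win s = {r \<in> {1..horizon I}. r = s \<or>
     s \<le> r \<and> (\<exists>k. B ^ k < horizon I \<and> spacing k dvd s - 1 \<and> r < s + spacing k + B ^ (k + 1))}"

definition load :: real where
  "load = 1 + (\<Sum>k | B ^ k < horizon I. 2 + real (B ^ (k + 1) div spacing k))"

lemma length_class:
  assumes "0 < w"
  shows "B ^ length_class w \<le> w" "w < B ^ (length_class w + 1)"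
proof -
  have "w < 2 ^ (w + 1)" using less_exp[of "w + 1"] by simp
  also have "(2::nat) ^ (w + 1) \<le> B ^ (w + 1)" using B by (intro power_mono) auto
  finally have ex: "w < B ^ (w + 1)" .
  show "w < B ^ (length_class w + 1)"
    unfolding length_class_def using ex by (rule LeastI)
  show "B ^ length_class w \<le> w"
  proof (cases "length_class w")
    case 0
    then show ?thesis using assms by simp
  next
    case (Suc k)
    then have "\<not> w < B ^ (k + 1)" using not_less_Least[of k "\<lambda>k. w < B ^ (k + 1)"] by (simp add: length_class_def)
    then show ?thesis using Suc by simp
  qed
qed

lemma demand_points_range:
  "(i, t) \<in> demand_points I \<Longrightarrow> i \<in> {1..elems I} \<and> t \<in> {1..horizon I} \<and> 0 < demand I i t"
  by (auto simp: demand_points_def)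

lemma finite_demand_points: "finite (demand_points I)"
  by (rule finite_subset[of _ "{1..elems I} \<times> {1..horizon I}"]) (auto simp: demand_points_def)

lemma g_props:
  assumes "(i, t) \<in> demand_points I"
  defines "w \<equiv> t - a i t"
  shows "1 \<le> g i t" "g i t \<le> a i t"
    and "a i t = t \<Longrightarrow> g i t = t"
    and "a i t < t \<Longrightarrow> spacing (length_class w) dvd g i t - 1 \<and> a i t < g i t + spacing (length_class w)
      \<and> real (a i t - g i t) \<le> real w * (real P / real M)"
proof -
  have a: "1 \<le> a i t" "a i t \<le> t" using a_range[OF assms(1)] by auto
  let ?G = "spacing (length_class w)"
  have G: "1 \<le> ?G" by (simp add: spacing_def)
  have mul: "?G * ((a i t - 1) div ?G) + (a i t - 1) mod ?G = a i t - 1"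
    by (simp only: mult_div_mod_eq)
  have le: "?G * ((a i t - 1) div ?G) \<le> a i t - 1" by (rule times_div_less_eq_dividend)
  show "1 \<le> g i t" using a by (simp add: g_def)
  show "g i t \<le> a i t"
  proof (cases "a i t = t")
    case False
    then have "g i t = 1 + ?G * ((a i t - 1) div ?G)" by (simp add: g_def w_def)
    then show ?thesis using le a by linarith
  qed (simp add: g_def)
  show "a i t = t \<Longrightarrow> g i t = t" by (simp add: g_def)
  assume less: "a i t < t"
  then have g: "g i t = 1 + ?G * ((a i t - 1) div ?G)" by (simp add: g_def w_def)
  have m: "(a i t - 1) mod ?G < ?G" using G by simp
  have diff: "a i t - g i t = (a i t - 1) mod ?G" using mul g a by linarith
  have lt: "a i t < g i t + ?G" using mul g a m by linarith
  \<comment> \<open>The shift is a remainder modulo the spacing. If the integer quotient is 0, the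
    spacing is 1 and the shift 0; otherwise the shift is below that quotient, where
    \<open>B ^ length_class w \<le> w\<close>.\<close>
  have "real (a i t - g i t) \<le> real w * (real P / real M)"
  proof (cases "B ^ length_class w * P div M = 0")
    case True
    then have "?G = 1" by (simp add: spacing_def)
    then have "a i t - g i t = 0" using m diff by simp
    then show ?thesis by simp
  next
    case False
    then have Geq: "?G = B ^ length_class w * P div M" by (simp add: spacing_def)
    have "B ^ length_class w * P \<le> w * P" using length_class(1)[of w] less by (simp add: w_def)
    then have "?G \<le> w * P div M" unfolding Geq by (rule div_le_mono)
    then have "real (a i t - g i t) \<le> real (w * P div M)" using m diff by simp
    also have "\<dots> \<le> real (w * P) / real M" by (rule of_nat_div_le_of_nat)
    finally show ?thesis by simp
  qed
  with g lt show "?G dvd g i t - 1 \<and> a i t < g i t + ?G \<and> real (a i t - g i t) \<le> real w * (real P / real M)"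
    by simp
qed

lemma window:
  assumes "(i, t) \<in> demand_points I"
  shows "{a i t..t} \<subseteq> win (g i t)"
proof
  fix r
  assume r: "r \<in> {a i t..t}"
  note D = demand_points_range[OF assms] and ar = a_range[OF assms] and gp = g_props[OF assms]
  show "r \<in> win (g i t)"
  proof (cases "a i t = t")
    case True
    then show ?thesis using r D gp(3) by (auto simp: win_def)
  next
    case False
    then have less: "a i t < t" using ar by simp
    let ?k = "length_class (t - a i t)"
    have k: "B ^ ?k \<le> t - a i t" "t - a i t < B ^ (?k + 1)" using length_class[of "t - a i t"] less by auto
    have "B ^ ?k < horizon I" using k(1) D ar less by auto
    moreover have "r < g i t + spacing ?k + B ^ (?k + 1)"
      using k(2) gp(4)[OF less] r less by auto
    moreover have "g i t \<le> r" using r gp(2) by auto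
    ultimately show ?thesis using gp(4)[OF less] r D ar unfolding win_def by auto
  qed
qed

lemma y_nonneg: "S \<subseteq> {1..elems I} \<Longrightarrow> s \<in> {1..horizon I} \<Longrightarrow> 0 \<le> y S s"
  using feasible by (auto simp: LP_feasible_def)

lemma x_nonneg: "(i, t) \<in> demand_points I \<Longrightarrow> s \<in> {1..t} \<Longrightarrow> 0 \<le> x i s t"
  using feasible by (auto simp: LP_feasible_def)

lemma f_nonneg: "S \<subseteq> {1..elems I} \<Longrightarrow> 0 \<le> order_cost I S"
  using problem by (auto simp: inventory_problem_def)

text \<open>Less than half of the unit mass of \<open>x\<close> lies before \<open>a\<close>, and
  each \<open>x\<close> value is dominated by the \<open>y\<close> mass of the sets containing
  \<open>i\<close>.\<close>

lemma coverage:
  assumes D: "(i, t) \<in> demand_points I"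
  shows "1 / 2 \<le> (\<Sum>s=a i t..t. \<Sum>S\<in>{S. i \<in> S \<and> S \<subseteq> {1..elems I}}. y S s)"
proof -
  note ar = a_range[OF D]
  have "{1..t} = {1..<a i t} \<union> {a i t..t}" "{1..<a i t} \<inter> {a i t..t} = {}" using ar by auto
  then have "(\<Sum>s=1..t. x i s t) = (\<Sum>s\<in>{1..<a i t}. x i s t) + (\<Sum>s=a i t..t. x i s t)"
    by (simp add: sum.union_disjoint)
  moreover have "(\<Sum>s=1..t. x i s t) = 1" using feasible D by (auto simp: LP_feasible_def constraints_def)
  ultimately have "1 / 2 \<le> (\<Sum>s=a i t..t. x i s t)" using a_less[OF D] by linarith
  also have "\<dots> \<le> (\<Sum>s=a i t..t. \<Sum>S\<in>{S. i \<in> S \<and> S \<subseteq> {1..elems I}}. y S s)"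
    using feasible D ar by (intro sum_mono) (auto simp: LP_feasible_def constraints_def)
  finally show ?thesis .
qed

text \<open>Doubling \<open>y\<close> turns coverage 1/2 into 1, but weights must not exceed 1.
  Truncation does no harm: a weight equal to 1 covers \<open>i\<close> on its own, and if there is
  none among the sets containing \<open>i\<close>, nothing was truncated there.\<close>

lemma order_cost_U:
  "order_cost I (U s) \<le> \<beta> * (\<Sum>r\<in>win s. \<Sum>S\<in>Pow {1..elems I}. 2 * (order_cost I S * y S r))"
proof -
  let ?N = "{1..elems I}"
  let ?K = "win s \<times> Pow ?N"
  let ?l = "\<lambda>(r, S). min 1 (2 * y S r)"
  have fin: "finite (win s)" by (simp add: win_def)
  have win: "r \<in> {1..horizon I}" if "r \<in> win s" for r using that by (simp add: win_def)
  have "order_cost I (U s) \<le> \<beta> * (\<Sum>k\<in>?K. ?l k * order_cost I (snd k))"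
  proof (rule fractional_subadditive_family[OF subadd])
    show "U s \<subseteq> ?N" using demand_points_range by (auto simp: U_def)
    show "finite ?K" using fin by simp
    show "snd k \<subseteq> ?N \<and> 0 \<le> ?l k \<and> ?l k \<le> 1" if "k \<in> ?K" for k
      using that y_nonneg win by (auto split: prod.splits)
  next
    fix i
    assume "i \<in> U s"
    then obtain t where D: "(i, t) \<in> demand_points I" and g: "g i t = s" by (auto simp: U_def)
    let ?A = "{k \<in> ?K. i \<in> snd k}"
    have A_fin: "finite ?A" using fin by simp
    have A_nonneg: "0 \<le> ?l k" if "k \<in> ?A" for k
      using that y_nonneg win by (auto split: prod.splits)
    show "1 \<le> (\<Sum>k\<in>?A. ?l k)"
    proof (cases "\<exists>k\<in>?A. ?l k = 1")
      case True
      then obtain k where "k \<in> ?A" "?l k = 1" by blast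
      then show ?thesis using member_le_sum[of k ?A ?l] A_nonneg A_fin by auto
    next
      case False
      have "1 \<le> 2 * (\<Sum>r=a i t..t. \<Sum>S\<in>{S. i \<in> S \<and> S \<subseteq> ?N}. y S r)"
        using coverage[OF D] by simp
      also have "(\<Sum>r=a i t..t. \<Sum>S\<in>{S. i \<in> S \<and> S \<subseteq> ?N}. y S r)
          \<le> (\<Sum>r\<in>win s. \<Sum>S\<in>{S. i \<in> S \<and> S \<subseteq> ?N}. y S r)"
        using window[OF D] g fin by (intro sum_mono2) (auto intro!: sum_nonneg y_nonneg win)
      also have "\<dots> = (\<Sum>k\<in>win s \<times> {S. i \<in> S \<and> S \<subseteq> ?N}. y (snd k) (fst k))"
        by (simp add: sum.cartesian_product case_prod_unfold)
      also have "win s \<times> {S. i \<in> S \<and> S \<subseteq> ?N} = ?A" by auto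
      also have "2 * (\<Sum>k\<in>?A. y (snd k) (fst k)) = (\<Sum>k\<in>?A. ?l k)"
        unfolding sum_distrib_left
      proof (rule sum.cong[OF refl])
        fix k
        assume "k \<in> ?A"
        with False have "?l k \<noteq> 1" by blast
        then show "2 * y (snd k) (fst k) = ?l k" by (auto simp: min_def split: prod.splits if_splits)
      qed
      finally show ?thesis by simp
    qed
  qed
  also have "(\<Sum>k\<in>?K. ?l k * order_cost I (snd k)) = (\<Sum>r\<in>win s. \<Sum>S\<in>Pow ?N. min 1 (2 * y S r) * order_cost I S)"
    by (simp add: sum.cartesian_product case_prod_unfold)
  also have "\<beta> * \<dots> \<le> \<beta> * (\<Sum>r\<in>win s. \<Sum>S\<in>Pow ?N. 2 * (order_cost I S * y S r))"
  proof (intro mult_left_mono sum_mono beta)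
    fix r S
    assume "S \<in> Pow ?N"
    then have "min 1 (2 * y S r) * order_cost I S \<le> (2 * y S r) * order_cost I S"
      using f_nonneg by (intro mult_right_mono) auto
    then show "min 1 (2 * y S r) * order_cost I S \<le> 2 * (order_cost I S * y S r)" by (simp add: mult_ac)
  qed
  finally show ?thesis .
qed

lemma finite_classes: "finite {k. B ^ k < n}"
proof (rule finite_subset)
  show "{k. B ^ k < n} \<subseteq> {..n}"
  proof
    fix k
    assume "k \<in> {k. B ^ k < n}"
    moreover have "k < 2 ^ k" by (rule less_exp)
    moreover have "(2::nat) ^ k \<le> B ^ k" using B by (intro power_mono) auto
    ultimately have "k < n" by (metis mem_Collect_eq order.strict_trans less_le_trans)
    then show "k \<in> {..n}" by simp
  qed
qed simp

lemma card_win: "real (card {s \<in> {1..horizon I}. r \<in> win s}) \<le> load"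
proof -
  let ?A = "\<lambda>k. {s. 1 \<le> s \<and> s \<le> r \<and> spacing k dvd s - 1 \<and> r < s + spacing k + B ^ (k + 1)}"
  let ?K = "{k. B ^ k < horizon I}"
  have fin: "finite (?A k)" for k by (rule finite_subset[of _ "{..r}"]) auto
  have cardA: "card (?A k) \<le> 2 + B ^ (k + 1) div spacing k" for k
  proof -
    let ?G = "spacing k"
    let ?c = "1 + B ^ (k + 1) div ?G"
    have G: "1 \<le> ?G" by (simp add: spacing_def)
    \<comment> \<open>With \<open>s - 1 = ?G * j\<close>, the reach of the window confines
      \<open>j\<close> to at most \<open>?c + 1\<close> consecutive values ending at
      \<open>(r - 1) div ?G\<close>; truncated subtraction only shortens this range.\<close>
    have "?A k \<subseteq> (\<lambda>j. 1 + ?G * j) ` {(r - 1) div ?G - ?c..(r - 1) div ?G}"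
    proof
      fix s
      assume s: "s \<in> ?A k"
      then obtain j where j: "s - 1 = ?G * j" by (auto elim: dvdE)
      then have s_eq: "s = 1 + ?G * j" using s by auto
      have "?G * j \<le> r - 1" using s s_eq by auto
      then have "j \<le> (r - 1) div ?G" using G by (simp add: less_eq_div_iff_mult_less_eq mult.commute)
      moreover have "(r - 1) div ?G \<le> j + ?c"
      proof -
        have "r - 1 \<le> ?G * j + ?G + B ^ (k + 1)" using s s_eq by auto
        then have "(r - 1) div ?G \<le> (?G * (j + 1) + B ^ (k + 1)) div ?G"
          by (intro div_le_mono) (simp add: algebra_simps)
        also have "\<dots> = j + 1 + B ^ (k + 1) div ?G" using G by (subst div_mult_self4) auto
        finally show ?thesis by simp
      qed
      ultimately show "s \<in> (\<lambda>j. 1 + ?G * j) ` {(r - 1) div ?G - ?c..(r - 1) div ?G}"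
        using s_eq by auto
    qed
    then have "card (?A k) \<le> card ((\<lambda>j. 1 + ?G * j) ` {(r - 1) div ?G - ?c..(r - 1) div ?G})"
      by (intro card_mono) auto
    also have "\<dots> \<le> card {(r - 1) div ?G - ?c..(r - 1) div ?G}" by (rule card_image_le) simp
    also have "\<dots> \<le> ?c + 1" by auto
    finally show ?thesis by simp
  qed
  have "{s \<in> {1..horizon I}. r \<in> win s} \<subseteq> {r} \<union> (\<Union>k\<in>?K. ?A k)"
    by (auto simp: win_def)
  then have "card {s \<in> {1..horizon I}. r \<in> win s} \<le> card ({r} \<union> (\<Union>k\<in>?K. ?A k))"
    using fin finite_classes by (intro card_mono) auto
  also have "\<dots> \<le> card {r} + card (\<Union>k\<in>?K. ?A k)" by (rule card_Un_le)
  also have "card (\<Union>k\<in>?K. ?A k) \<le> (\<Sum>k\<in>?K. card (?A k))" by (rule card_UN_le[OF finite_classes])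
  also have "\<dots> \<le> (\<Sum>k\<in>?K. 2 + B ^ (k + 1) div spacing k)" by (rule sum_mono) (rule cardA)
  finally have "card {s \<in> {1..horizon I}. r \<in> win s} \<le> 1 + (\<Sum>k\<in>?K. 2 + B ^ (k + 1) div spacing k)"
    by simp
  then have "real (card {s \<in> {1..horizon I}. r \<in> win s}) \<le> real (1 + (\<Sum>k\<in>?K. 2 + B ^ (k + 1) div spacing k))"
    by (rule of_nat_mono)
  then show ?thesis by (simp add: load_def)
qed

text \<open>Double counting: each period is charged once for every window containing it, at most
  \<open>load\<close> times. The factor 2 comes from the doubled weights.\<close>

lemma ordering_cost:
  "(\<Sum>s=1..horizon I. order_cost I (U s))
     \<le> 2 * \<beta> * load * (\<Sum>S\<in>Pow {1..elems I}. \<Sum>s=1..horizon I. order_cost I S * y S s)"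
proof -
  let ?T = "{1..horizon I}" and ?N = "{1..elems I}"
  let ?W = "\<lambda>r. \<Sum>S\<in>Pow ?N. 2 * (order_cost I S * y S r)"
  have W: "0 \<le> ?W r" if "r \<in> ?T" for r
    using that by (intro sum_nonneg) (auto intro!: mult_nonneg_nonneg f_nonneg y_nonneg)
  have win: "win s = {r \<in> ?T. r \<in> win s}" for s by (auto simp: win_def)
  have "(\<Sum>s\<in>?T. order_cost I (U s)) \<le> (\<Sum>s\<in>?T. \<beta> * (\<Sum>r\<in>win s. ?W r))"
    by (rule sum_mono) (rule order_cost_U)
  also have "\<dots> = \<beta> * (\<Sum>s\<in>?T. \<Sum>r\<in>{r \<in> ?T. r \<in> win s}. ?W r)"
    by (subst win) (simp add: sum_distrib_left)
  also have "(\<Sum>s\<in>?T. \<Sum>r\<in>{r \<in> ?T. r \<in> win s}. ?W r) = (\<Sum>r\<in>?T. \<Sum>s\<in>{s \<in> ?T. r \<in> win s}. ?W r)"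
    by (rule sum.swap_restrict) auto
  also have "\<dots> = (\<Sum>r\<in>?T. real (card {s \<in> ?T. r \<in> win s}) * ?W r)" by simp
  also have "\<beta> * \<dots> \<le> \<beta> * (\<Sum>r\<in>?T. load * ?W r)"
    by (intro mult_left_mono sum_mono mult_right_mono beta card_win W)
  also have "(\<Sum>r\<in>?T. load * ?W r) = load * (\<Sum>r\<in>?T. ?W r)" by (simp add: sum_distrib_left)
  also have "(\<Sum>r\<in>?T. ?W r) = 2 * (\<Sum>S\<in>Pow ?N. \<Sum>s\<in>?T. order_cost I S * y S s)"
    unfolding sum_distrib_left by (rule sum.swap)
  finally show ?thesis by (simp add: mult_ac)
qed

lemma g_range: "(i, t) \<in> demand_points I \<Longrightarrow> g i t \<in> {1..t}"
  using g_props(1,2)[of i t] a_range[of i t] by fastforce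

lemma x'_sum: "(i, t) \<in> demand_points I \<Longrightarrow> (\<Sum>s=1..t. h s * x' i s t) = h (g i t)"
  using g_range[of i t] by (simp add: x'_def if_distrib[of "\<lambda>z. _ * z"] sum.delta cong: if_cong)

lemma objective_rounded:
  "objective I y' x' = (\<Sum>s=1..horizon I. order_cost I (U s))
     + (\<Sum>(i, t)\<in>demand_points I. holding_cost I i (g i t) t)"
proof -
  have U: "U s \<in> Pow {1..elems I}" for s using demand_points_range by (auto simp: U_def)
  have "(\<Sum>S\<in>Pow {1..elems I}. \<Sum>s=1..horizon I. order_cost I S * y' S s)
      = (\<Sum>s=1..horizon I. \<Sum>S\<in>Pow {1..elems I}. order_cost I S * y' S s)" by (rule sum.swap)
  also have "\<dots> = (\<Sum>s=1..horizon I. order_cost I (U s))"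
    using U by (intro sum.cong refl)
      (simp add: y'_def if_distrib[of "\<lambda>z. _ * z"] sum.delta cong: if_cong)
  finally have 1: "(\<Sum>S\<in>Pow {1..elems I}. \<Sum>s=1..horizon I. order_cost I S * y' S s) = \<dots>" .
  have "(\<Sum>(i, t)\<in>demand_points I. \<Sum>s=1..t. holding_cost I i s t * x' i s t)
      = (\<Sum>(i, t)\<in>demand_points I. holding_cost I i (g i t) t)"
  proof (intro sum.cong refl, clarify)
    fix i t
    assume "(i, t) \<in> demand_points I"
    then show "(\<Sum>s=1..t. holding_cost I i s t * x' i s t) = holding_cost I i (g i t) t" by (rule x'_sum)
  qed
  with 1 show ?thesis by (simp add: objective_def)
qed

lemma rounded_feasible: "IP_feasible I y' x'"
proof -
  have "(\<Sum>s=1..t. x' i s t) = 1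
      \<and> (\<forall>s\<in>{1..t}. x' i s t \<le> (\<Sum>S\<in>{S. i \<in> S \<and> S \<subseteq> {1..elems I}}. y' S s))"
    if D: "(i, t) \<in> demand_points I" for i t
  proof (intro conjI ballI)
    show "(\<Sum>s=1..t. x' i s t) = 1" using x'_sum[OF D, of "\<lambda>_. 1"] by simp
    fix s
    assume s: "s \<in> {1..t}"
    show "x' i s t \<le> (\<Sum>S\<in>{S. i \<in> S \<and> S \<subseteq> {1..elems I}}. y' S s)"
    proof (cases "s = g i t")
      case True
      then have "U s \<in> {S. i \<in> S \<and> S \<subseteq> {1..elems I}}"
        using D demand_points_range by (auto simp: U_def)
      moreover have "finite {S. i \<in> S \<and> S \<subseteq> {1..elems I}}"
        by (rule finite_subset[of _ "Pow {1..elems I}"]) auto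
      ultimately have "y' (U s) s \<le> (\<Sum>S\<in>{S. i \<in> S \<and> S \<subseteq> {1..elems I}}. y' S s)"
        by (intro member_le_sum) (auto simp: y'_def)
      moreover have "y' (U s) s = 1" using s demand_points_range[OF D] by (simp add: y'_def)
      ultimately show ?thesis using True by (simp add: x'_def)
    next
      case False
      then show ?thesis by (auto simp: x'_def y'_def intro: sum_nonneg)
    qed
  qed
  then have "constraints I y' x'" unfolding constraints_def by blast
  then show ?thesis unfolding IP_feasible_def by (auto simp: y'_def x'_def)
qed

text \<open>The two factors come from two moves. Snapping lengthens the interval by a factor of at
  most \<open>1 + P / M\<close>. Moving to the median costs a factor 2: at least half of the mass is
  served from some \<open>s \<le> a\<close>, each at no less than the cost from
  \<open>a\<close>.\<close>

lemma holding_cost_bound: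
  assumes D: "(i, t) \<in> demand_points I"
  shows "holding_cost I i (g i t) t
    \<le> 2 * (1 + real P / real M) powr \<alpha> * (\<Sum>s=1..t. holding_cost I i s t * x i s t)"
proof -
  note D' = demand_points_range[OF D] and ar = a_range[OF D] and gr = g_range[OF D]
  let ?b = "of_rat (base I i t) :: real" and ?d = "of_rat (demand I i t) :: real"
  let ?\<rho> = "1 + real P / real M"
  have b: "0 < ?b" and h: "\<And>s. s \<in> {1..t} \<Longrightarrow> holding I i s t = real (t - s) powr \<alpha> * ?b"
    using poly D' by (auto simp: polynomial_holding_def)
  have d: "0 < ?d" using D' by simp
  have "real (t - g i t) \<le> ?\<rho> * real (t - a i t)"
  proof (cases "a i t = t")
    case True
    then show ?thesis using g_props(3)[OF D] by simp
  next
    case False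
    then have less: "a i t < t" using ar by simp
    have "real (t - g i t) = real (t - a i t) + real (a i t - g i t)"
      using less g_props(2)[OF D] by simp
    with g_props(4)[OF D less] show ?thesis by (simp add: algebra_simps)
  qed
  then have "real (t - g i t) powr \<alpha> \<le> (?\<rho> * real (t - a i t)) powr \<alpha>"
    using alpha by (intro powr_mono2) auto
  also have "\<dots> = ?\<rho> powr \<alpha> * real (t - a i t) powr \<alpha>" by (rule powr_mult)
  finally have "holding I i (g i t) t \<le> ?\<rho> powr \<alpha> * holding I i (a i t) t"
    using h[OF gr] h[OF ar] b by (simp add: mult_right_mono mult.assoc[symmetric])
  then have 1: "holding_cost I i (g i t) t \<le> ?\<rho> powr \<alpha> * holding_cost I i (a i t) t"
    using d by (simp add: holding_cost_def mult.left_commute)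
  have hc_nonneg: "0 \<le> holding_cost I i s t" if "s \<in> {1..t}" for s
    using h[OF that] b d by (simp add: holding_cost_def)
  have "holding_cost I i (a i t) t * (1 / 2) \<le> holding_cost I i (a i t) t * (\<Sum>s=1..a i t. x i s t)"
    using a_ge[OF D] hc_nonneg[OF ar] by (rule mult_left_mono)
  also have "\<dots> = (\<Sum>s=1..a i t. holding_cost I i (a i t) t * x i s t)" by (rule sum_distrib_left)
  also have "\<dots> \<le> (\<Sum>s=1..a i t. holding_cost I i s t * x i s t)"
  proof (rule sum_mono, rule mult_right_mono)
    fix s
    assume s: "s \<in> {1..a i t}"
    then have st: "s \<in> {1..t}" using ar by auto
    show "0 \<le> x i s t" by (rule x_nonneg[OF D st])
    have "real (t - a i t) powr \<alpha> \<le> real (t - s) powr \<alpha>"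
      using s alpha by (intro powr_mono2) auto
    then show "holding_cost I i (a i t) t \<le> holding_cost I i s t"
      using h[OF ar] h[OF st] b d by (simp add: holding_cost_def)
  qed
  also have "\<dots> \<le> (\<Sum>s=1..t. holding_cost I i s t * x i s t)"
    using ar by (intro sum_mono2) (auto intro!: mult_nonneg_nonneg hc_nonneg x_nonneg[OF D])
  finally have "holding_cost I i (a i t) t \<le> 2 * (\<Sum>s=1..t. holding_cost I i s t * x i s t)" by simp
  then have "?\<rho> powr \<alpha> * holding_cost I i (a i t) t \<le> ?\<rho> powr \<alpha> * (2 * (\<Sum>s=1..t. holding_cost I i s t * x i s t))"
    by (rule mult_left_mono) simp
  with 1 show ?thesis by (simp add: mult_ac)
qed

text \<open>The holding bound does not involve \<beta>; \<open>1 \<le> \<beta>\<close> lets one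
  factor \<open>\<beta> * K\<close> serve both parts.\<close>

lemma rounded_cost:
  assumes "2 * load \<le> K" "2 * (1 + real P / real M) powr \<alpha> \<le> K" "1 \<le> \<beta>"
  shows "objective I y' x' \<le> \<beta> * K * objective I y x"
proof -
  let ?O = "\<Sum>S\<in>Pow {1..elems I}. \<Sum>s=1..horizon I. order_cost I S * y S s"
  let ?H = "\<Sum>(i, t)\<in>demand_points I. \<Sum>s=1..t. holding_cost I i s t * x i s t"
  have K: "0 \<le> K" by (rule order_trans[OF _ assms(2)]) simp
  have O: "0 \<le> ?O" by (intro sum_nonneg mult_nonneg_nonneg f_nonneg y_nonneg) auto
  have Ht: "0 \<le> (\<Sum>s=1..t. holding_cost I i s t * x i s t)" if "(i, t) \<in> demand_points I" for i t
  proof (intro sum_nonneg mult_nonneg_nonneg)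
    fix s
    assume s: "s \<in> {1..t}"
    show "0 \<le> x i s t" by (rule x_nonneg[OF that s])
    show "0 \<le> holding_cost I i s t"
      using problem demand_points_range[OF that] s by (auto simp: holding_cost_def inventory_problem_def)
  qed
  have "(\<Sum>s=1..horizon I. order_cost I (U s)) \<le> \<beta> * (2 * load) * ?O"
    using ordering_cost by (simp add: mult_ac)
  also have "\<dots> \<le> \<beta> * K * ?O"
    using assms beta O by (intro mult_right_mono mult_left_mono) auto
  finally have 1: "(\<Sum>s=1..horizon I. order_cost I (U s)) \<le> \<beta> * K * ?O" .
  have "(\<Sum>(i, t)\<in>demand_points I. holding_cost I i (g i t) t)
      \<le> (\<Sum>(i, t)\<in>demand_points I. \<beta> * K * (\<Sum>s=1..t. holding_cost I i s t * x i s t))"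
  proof (rule sum_mono, clarify)
    fix i t
    assume D: "(i, t) \<in> demand_points I"
    let ?h = "\<Sum>s=1..t. holding_cost I i s t * x i s t"
    have "2 * (1 + real P / real M) powr \<alpha> * ?h \<le> 1 * K * ?h"
      using assms(2) Ht[OF D] by (simp add: mult_right_mono)
    also have "\<dots> \<le> \<beta> * K * ?h" using assms(3) K Ht[OF D] by (intro mult_right_mono) auto
    finally show "holding_cost I i (g i t) t \<le> \<beta> * K * ?h" using holding_cost_bound[OF D] by linarith
  qed
  also have "\<dots> = \<beta> * K * ?H" by (simp add: sum_distrib_left case_prod_unfold)
  finally have 2: "(\<Sum>(i, t)\<in>demand_points I. holding_cost I i (g i t) t) \<le> \<beta> * K * ?H" .
  have "objective I y x = ?O + ?H" by (simp add: objective_def)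
  with 1 2 show ?thesis unfolding objective_rounded by (simp add: distrib_left)
qed

lemma load_bound:
  "load \<le> 1 + (1 + ln (real (horizon I)) / ln (real B)) * (2 + 2 * real B * real M / real P)"
proof -
  let ?T = "horizon I" and ?c = "2 + 2 * real B * real M / real P"
  have T: "1 \<le> ?T" using problem by (simp add: inventory_problem_def)
  have each: "2 + real (B ^ (k + 1) div spacing k) \<le> ?c" for k
  proof -
    have Mr: "0 < real M" "0 < real P" using M P by auto
    \<comment> \<open>Either the spacing is 1 because \<open>B ^ k * P / M\<close> is smaller, or it
      is the integer part of a number at least 1 and hence more than half of it.\<close>
    have half: "real (B ^ k * P) \<le> 2 * real M * real (spacing k)"
    proof (cases "B ^ k * P div M = 0")
      case True
      then have "B ^ k * P < M" using M by (simp add: div_eq_0_iff)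
      then have "real (B ^ k * P) \<le> real M * 1" by (simp del: of_nat_mult of_nat_power)
      moreover have "real M * 1 \<le> 2 * real M * real (spacing k)"
        using Mr by (intro mult_mono) (auto simp: spacing_def)
      ultimately show ?thesis by linarith
    next
      case False
      then have s: "spacing k = B ^ k * P div M" "1 \<le> spacing k" by (auto simp: spacing_def)
      have "B ^ k * P = M * spacing k + B ^ k * P mod M" unfolding s by simp
      moreover have "B ^ k * P mod M < M" using M by simp
      moreover have "M * 1 \<le> M * spacing k" using s(2) by (intro mult_left_mono) auto
      ultimately have "B ^ k * P \<le> 2 * M * spacing k" by linarith
      then have "real (B ^ k * P) \<le> real (2 * M * spacing k)" by (rule of_nat_mono)
      then show ?thesis by simp
    qed
    have G: "0 < real (spacing k)" by (simp add: spacing_def)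
    have "real (B ^ (k + 1) div spacing k) \<le> real (B ^ (k + 1)) / real (spacing k)" by (rule of_nat_div_le_of_nat)
    also have "\<dots> = real B * real (B ^ k * P) / (real P * real (spacing k))" using Mr by simp
    also have "\<dots> \<le> real B * (2 * real M * real (spacing k)) / (real P * real (spacing k))"
      using half Mr G by (intro divide_right_mono mult_left_mono) auto
    also have "\<dots> = 2 * real B * real M / real P" using G by simp
    finally show ?thesis by simp
  qed
  have c: "0 \<le> ?c" by simp
  have lnB: "0 < ln (real B)" using B by simp
  have "{k. B ^ k < ?T} \<subseteq> {..nat \<lfloor>ln (real ?T) / ln (real B)\<rfloor>}"
  proof
    fix k
    assume "k \<in> {k. B ^ k < ?T}"
    then have "real (B ^ k) \<le> real ?T" by (simp del: of_nat_power)
    then have "ln (real B ^ k) \<le> ln (real ?T)" using B by (intro ln_mono) auto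
    then have "real k \<le> ln (real ?T) / ln (real B)" using lnB B by (simp add: ln_realpow field_simps)
    then show "k \<in> {..nat \<lfloor>ln (real ?T) / ln (real B)\<rfloor>}" by (simp add: le_nat_floor)
  qed
  from card_mono[OF _ this] have "card {k. B ^ k < ?T} \<le> nat \<lfloor>ln (real ?T) / ln (real B)\<rfloor> + 1" by simp
  also have "real \<dots> \<le> 1 + ln (real ?T) / ln (real B)" using T lnB by simp
  finally have card: "real (card {k. B ^ k < ?T}) \<le> 1 + ln (real ?T) / ln (real B)" by simp
  have "load \<le> 1 + (\<Sum>k | B ^ k < ?T. ?c)" unfolding load_def by (intro add_left_mono sum_mono each)
  also have "\<dots> = 1 + real (card {k. B ^ k < ?T}) * ?c" by simp
  also have "\<dots> \<le> 1 + (1 + ln (real ?T) / ln (real B)) * ?c"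
    by (intro add_left_mono mult_right_mono card c)
  finally show ?thesis .
qed

end

section \<open>Choice of the parameters\<close>

text \<open>Makes the denominator of \<open>log_ratio\<close> positive. It follows from the bound on
  \<open>ln 2\<close> through 8 < 9.\<close>

lemma ln_3_gt_1: "1 < ln (3::real)"
proof -
  have "2 \<le> 3 * ln (2::real)" using ln2_ge_two_thirds by linarith
  also have "\<dots> = ln (8::real)" using ln_realpow[of 2 3] by simp
  also have "\<dots> < ln 9" by simp
  also have "\<dots> = 2 * ln 3" using ln_realpow[of 3 2] by simp
  finally show ?thesis by simp
qed

text \<open>Passes from the integer test to the real exponent: \<alpha> is at most
  \<open>e / 2\<close>, and the power \<open>e / 2\<close> is the square root of
  \<open>\<rho> ^ e\<close>.\<close>

lemma stretch_powr_le_sqrt: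
  fixes \<rho> \<alpha> :: real
  assumes "1 \<le> \<rho>" "\<rho> ^ e \<le> real L" "2 * \<alpha> \<le> real e"
  shows "\<rho> powr \<alpha> \<le> sqrt (real L)"
proof -
  have "\<rho> powr \<alpha> \<le> \<rho> powr (real e * (1 / 2))" using assms by (intro powr_mono) auto
  also have "\<dots> = (\<rho> ^ e) powr (1 / 2)" using assms by (simp add: powr_realpow[symmetric] powr_powr)
  also have "\<dots> = sqrt (\<rho> ^ e)" using assms by (intro powr_half_sqrt) auto
  also have "\<dots> \<le> sqrt (real L)" using assms by simp
  finally show ?thesis .
qed

text \<open>
  \<open>L\<close> is \<open>log\<^sub>2 T\<close> up to a constant. A stretch by the factor \<open>D\<close>, or by \<open>1 + 1/M\<close> when \<open>D \<le> 2\<close>,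
  multiplies the holding costs by at most the square root of \<open>L\<close>.
\<close>

lemma parameter_bounds:
  fixes \<alpha> :: real and T L n D M0 e B P M :: nat
  assumes alpha: "1 \<le> \<alpha>" and e: "e = 2 * nat \<lceil>\<alpha>\<rceil>" and T: "1 \<le> T"
    and L: "L = 8 + n" "2 ^ n \<le> T" "T < 2 ^ (n + 1)"
    and D: "L < (D + 1) ^ e" "D \<le> 2 \<or> D ^ e \<le> L"
    and M0: "1 \<le> M0" "(M0 + 1) ^ e \<le> L * M0 ^ e" "M0 = 1 \<or> L * (M0 - 1) ^ e < M0 ^ e"
    and B: "B = (if 3 \<le> D then D - 1 else 2)" and P: "P = (if 3 \<le> D then D - 1 else 1)"
    and M: "M = (if 3 \<le> D then 1 else M0)"
  shows "2 * (1 + real P / real M) powr \<alpha> \<le> 290 * (\<alpha> * log_ratio T)"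
    and "2 * (1 + (1 + ln (real T) / ln (real B)) * (2 + 2 * real B * real M / real P)) \<le> 290 * (\<alpha> * log_ratio T)"
    and "0 < log_ratio T"
proof -
  define x where "x = ln (real (max 3 T))"
  define R where "R = x / ln x"
  have R_eq: "log_ratio T = R" by (simp add: log_ratio_def x_def R_def)
  have "ln 3 \<le> x" unfolding x_def by (intro ln_mono) auto
  then have x1: "1 < x" using ln_3_gt_1 by linarith
  then have lnx: "0 < ln x" by simp
  have "ln x \<le> x - 1" using x1 by (intro ln_le_minus_one) simp
  then have R1: "1 \<le> R" using lnx by (simp add: R_def field_simps)
  have Rx: "x = R * ln x" using lnx by (simp add: R_def)
  have aR: "1 \<le> \<alpha> * R" using mult_mono[OF alpha R1] alpha by simp
  have lnT: "0 \<le> ln (real T)" "ln (real T) \<le> x" using T by (auto simp: x_def)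
  have e_le: "real e \<le> 4 * \<alpha>" and e_ge: "2 * \<alpha> \<le> real e" using alpha unfolding e by linarith+
  \<comment> \<open>This is the room for the coarse grid: \<open>ln x \<le> 2 * sqrt x\<close> gives
    \<open>sqrt x \<le> 2 * (x / ln x)\<close>.\<close>
  have sqrtL: "sqrt (real L) \<le> 8 * R"
  proof -
    have "real n * (2 / 3) \<le> real n * ln 2" using ln2_ge_two_thirds by (intro mult_left_mono) auto
    also have "\<dots> = ln (real (2 ^ n))" by (simp add: ln_realpow)
    also have "\<dots> \<le> ln (real T)" using L(2) T by (intro ln_mono) (auto simp: le_simps)
    finally have "real n \<le> 3 / 2 * x" using lnT by linarith
    then have "real L \<le> 16 * x" using L(1) x1 by simp
    then have "sqrt (real L) \<le> sqrt (16 * x)" by simp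
    also have "\<dots> = 4 * sqrt x" by (simp add: real_sqrt_mult)
    also have "\<dots> \<le> 4 * (2 * R)"
    proof -
      have "ln x = 2 * ln (sqrt x)" using x1 by (simp add: ln_sqrt)
      also have "\<dots> \<le> 2 * (sqrt x - 1)" using x1 by (intro mult_left_mono ln_le_minus_one) auto
      finally have "ln x \<le> 2 * sqrt x" by simp
      then have "sqrt x * ln x \<le> sqrt x * (2 * sqrt x)" using x1 by (intro mult_left_mono) auto
      also have "\<dots> = 2 * x" using x1 by simp
      finally have "sqrt x \<le> 2 * R" using lnx by (simp add: R_def field_simps)
      then show ?thesis by simp
    qed
    finally show ?thesis by simp
  qed
  \<comment> \<open>\<open>x \<le> ln (2 ^ L) \<le> L\<close>, so the upper bounds on
    \<open>ln L\<close> obtained from the searches also bound \<open>ln x\<close>.\<close>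
  have lnL: "ln x \<le> ln (real L)"
  proof -
    have "T \<le> 2 ^ L" using L(1,3) power_increasing[of "n + 1" L "2::nat"] by linarith
    moreover have "(3::nat) \<le> 2 ^ L" using L(1) power_increasing[of 8 L "2::nat"] by simp
    ultimately have "real (max 3 T) \<le> 2 ^ L" by (metis max.bounded_iff of_nat_le_iff of_nat_numeral of_nat_power)
    then have "x \<le> ln (2 ^ L)" unfolding x_def by (intro ln_mono) auto
    also have "\<dots> = real L * ln 2" by (simp add: ln_realpow)
    also have "\<dots> \<le> real L * 1" using ln_le_minus_one[of "2::real"] by (intro mult_left_mono) auto
    finally show ?thesis using x1 by simp
  qed
  have L0: "0 < real L" using L(1) by simp
  have stretch: "(1 + real P / real M) ^ e \<le> real L"
  proof (cases "3 \<le> D")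
    case True
    then have "1 + real P / real M = real D" by (simp add: P M)
    moreover have "D ^ e \<le> L" using D(2) True by linarith
    then have "real D ^ e \<le> real L" by (metis of_nat_le_iff of_nat_power)
    ultimately show ?thesis by simp
  next
    case False
    have "real ((M0 + 1) ^ e) \<le> real (L * M0 ^ e)" using M0(2) by (rule of_nat_mono)
    then have "(real M0 + 1) ^ e / real M0 ^ e \<le> real L" using M0(1) by (simp add: divide_le_eq add.commute)
    moreover have "1 + real P / real M = (real M0 + 1) / real M0" using False M0(1) by (simp add: P M field_simps)
    ultimately show ?thesis by (simp add: power_divide)
  qed
  have "1 \<le> 1 + real P / real M" by simp
  from stretch_powr_le_sqrt[OF this stretch e_ge] sqrtL
  have "2 * (1 + real P / real M) powr \<alpha> \<le> 16 * R" by simp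
  also have "\<dots> \<le> 290 * (\<alpha> * R)" using mult_right_mono[OF alpha, of R] R1 by simp
  finally show "2 * (1 + real P / real M) powr \<alpha> \<le> 290 * (\<alpha> * log_ratio T)" unfolding R_eq .
  show "0 < log_ratio T" using R1 R_eq by simp
  show "2 * (1 + (1 + ln (real T) / ln (real B)) * (2 + 2 * real B * real M / real P)) \<le> 290 * (\<alpha> * log_ratio T)"
  proof (cases "3 \<le> D")
    case True
    define b where "b = real B"
    have b: "2 \<le> b" "real (D + 1) = b + 2" using True by (simp_all add: b_def B of_nat_diff)
    have Pb: "real P = b" "real M = 1" using True by (simp_all add: b_def B P M)
    have lnb: "0 < ln b" using b by simp
    \<comment> \<open>The next integer exceeds the root, so \<open>L < (b + 2) ^ e\<close>, and
      \<open>b + 2 \<le> b * b\<close>. Hence \<open>ln L \<le> 2 * e * ln b\<close>, which bounds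
      \<open>ln T / ln b\<close> by \<open>8 * (\<alpha> * R)\<close>.\<close>
    have "real L \<le> real ((D + 1) ^ e)" using D(1) by (simp del: of_nat_power)
    then have "ln (real L) \<le> ln (real (D + 1) ^ e)" using L0 by (intro ln_mono) auto
    also have "\<dots> = real e * ln (b + 2)" using b by (simp add: ln_realpow)
    also have "b + 2 \<le> b * b" using mult_mono[of 2 b 2 b] mult_right_mono[of 2 b b] b by linarith
    then have "ln (b + 2) \<le> ln (b * b)" using b by (intro ln_mono) auto
    then have "real e * ln (b + 2) \<le> real e * (2 * ln b)" using b by (intro mult_left_mono) (auto simp: ln_mult)
    also have "\<dots> \<le> 4 * \<alpha> * (2 * ln b)" using e_le lnb by (intro mult_right_mono) auto
    finally have "ln x \<le> 8 * \<alpha> * ln b" using lnL by simp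
    then have "R * ln x \<le> R * (8 * \<alpha> * ln b)" using R1 by (intro mult_left_mono) auto
    then have "ln (real T) \<le> 8 * (\<alpha> * R) * ln b" using Rx lnT by (simp add: mult_ac)
    then have q: "ln (real T) / ln b \<le> 8 * (\<alpha> * R)" using lnb by (simp add: divide_le_eq)
    have "2 + 2 * b * 1 / b = 4" using b by simp
    then have "2 * (1 + (1 + ln (real T) / ln b) * (2 + 2 * b * 1 / b)) \<le> 290 * (\<alpha> * R)"
      using q aR by simp
    then show ?thesis unfolding Pb R_eq by (simp add: b_def)
  next
    case False
    then have BPM: "real B = 2" "real P = 1" "M = M0" by (simp_all add: B P M)
    \<comment> \<open>If \<open>M0 > 1\<close>, minimality says that \<open>m = M0 - 1\<close>
      fails: \<open>L < (1 + 1 / m) ^ e \<le> exp (e / m)\<close>, so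
      \<open>m * ln L \<le> e\<close>, and \<open>M0 \<le> 2 * m\<close>. If \<open>M0 = 1\<close>,
      it is \<open>D \<le> 2\<close> that gives \<open>L < 3 ^ e\<close>.\<close>
    have Mln: "real M0 * ln x \<le> 8 * \<alpha>"
    proof (cases "M0 = 1")
      case True
      have "(D + 1) ^ e \<le> 3 ^ e" using False by (intro power_mono) auto
      then have "L \<le> 3 ^ e" using D(1) by linarith
      then have "real L \<le> 3 ^ e" by (metis of_nat_le_iff of_nat_numeral of_nat_power)
      then have "ln (real L) \<le> ln (3 ^ e)" using L0 by (intro ln_mono) auto
      also have "\<dots> = real e * ln 3" by (simp add: ln_realpow)
      also have "\<dots> \<le> (4 * \<alpha>) * 2" using e_le ln_le_minus_one[of "3::real"] alpha by (intro mult_mono) auto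
      finally show ?thesis using lnL True by simp
    next
      case False
      then obtain m where m: "M0 = m + 1" "1 \<le> m" using M0(1) by (cases M0) auto
      have "L * m ^ e < M0 ^ e" using M0(3) False m by simp
      then have "real (L * m ^ e) < real (M0 ^ e)" by (rule of_nat_less_iff[THEN iffD2])
      then have "real L * real m ^ e < (real m + 1) ^ e" by (simp add: m add.commute)
      then have "real L \<le> ((real m + 1) / real m) ^ e"
        using m by (simp add: power_divide le_divide_eq)
      then have "ln (real L) \<le> ln (((real m + 1) / real m) ^ e)" using L0 by (intro ln_mono) auto
      also have "\<dots> = real e * ln (1 + 1 / real m)" using m by (simp add: ln_realpow add_divide_distrib)
      also have "\<dots> \<le> real e * (1 / real m)" using m by (intro mult_left_mono ln_add_one_self_le_self) auto
      finally have "real m * ln (real L) \<le> real e" using m by (simp add: field_simps)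
      moreover have "real m * ln x \<le> real m * ln (real L)" using lnL by (intro mult_left_mono) auto
      ultimately have "real m * ln x \<le> real e" by linarith
      moreover have "real M0 * ln x \<le> (2 * real m) * ln x" using m lnx by (intro mult_right_mono) auto
      ultimately show ?thesis using e_le by linarith
    qed
    then have "R * (real M0 * ln x) \<le> R * (8 * \<alpha>)" using R1 by (intro mult_left_mono) auto
    then have xM: "x * real M0 \<le> 8 * (\<alpha> * R)"
    proof -
      have "x * real M0 = R * (real M0 * ln x)" using Rx by algebra
      also have "\<dots> \<le> R * (8 * \<alpha>)" using \<open>R * (real M0 * ln x) \<le> R * (8 * \<alpha>)\<close> .
      also have "\<dots> = 8 * (\<alpha> * R)" by algebra
      finally show ?thesis .
    qed
    have "2 / 3 * (ln (real T) / ln 2) \<le> ln 2 * (ln (real T) / ln 2)"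
      using ln2_ge_two_thirds lnT by (intro mult_right_mono) auto
    also have "\<dots> = ln (real T)" by simp
    finally have "1 + ln (real T) / ln 2 \<le> 3 * x" using lnT x1 by linarith
    \<comment> \<open>The source of 290: the product is at most \<open>18 * x * M0\<close>, hence
      \<open>144 * (\<alpha> * R)\<close>, and \<open>2 * (1 + 144 * (\<alpha> * R))\<close> is at
      most \<open>290 * (\<alpha> * R)\<close> as \<open>\<alpha> * R \<ge> 1\<close>.\<close>
    then have "(1 + ln (real T) / ln 2) * (2 + 4 * real M0) \<le> 3 * x * (6 * real M0)"
      using M0(1) x1 by (intro mult_mono) auto
    also have "\<dots> \<le> 144 * (\<alpha> * R)" using xM by linarith
    finally show ?thesis using aR unfolding BPM R_eq by simp
  qed
qed

text \<open>\<open>(1 + 1 / e) ^ e \<le> exp 1 \<le> 3\<close>, so the candidate \<open>e\<close>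
  passes the test of \<open>stretch_den\<close> and the search cannot fail.\<close>

lemma stretch_den_exists:
  assumes "1 \<le> e" "8 \<le> (L::nat)"
  shows "(e + 1) ^ e \<le> L * e ^ e"
proof -
  have "(1 + 1 / real e) ^ e \<le> exp (1 / real e) ^ e"
    by (intro power_mono exp_ge_add_one_self) auto
  also have "\<dots> = exp (real e * (1 / real e))" by (rule exp_of_nat_mult[symmetric])
  also have "\<dots> \<le> 3" using assms(1) exp_le by simp
  finally have "((real e + 1) / real e) ^ e \<le> 3" using assms(1) by (simp add: field_simps)
  then have "(real e + 1) ^ e \<le> 3 * real e ^ e" using assms(1) by (simp add: power_divide divide_le_eq)
  also have "\<dots> \<le> real L * real e ^ e" using assms(2) by (intro mult_right_mono) auto
  finally have "real ((e + 1) ^ e) \<le> real (L * e ^ e)" by (simp add: add.commute)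
  then show ?thesis by (simp only: of_nat_le_iff)
qed

text \<open>The solver is guaranteed to work only from \<open>init_store\<close>, and it may destroy
  the input, which the second stage still needs. A copy is put into a register that the solver does
  not mention, and the run is transferred by \<open>exec_agree\<close>.\<close>

lemma poly_time_solvable_postprocess:
  assumes solv: "poly_time_solvable enc orc A ok" and F: "poly_time F"
    and ok': "\<And>p v. p \<in> A \<Longrightarrow> ok p v \<Longrightarrow> ok' p (F (pair (enc p) v))"
  shows "poly_time_solvable enc orc A ok'"
proof -
  from solv obtain c a k where c: "\<forall>p\<in>A. \<exists>n \<sigma>. exec (orc p) c (init_store (enc p)) n \<sigma>
        \<and> n \<le> a * data_size (enc p) ^ k \<and> ok p (\<sigma> 0)"
    unfolding poly_time_solvable_def by (elim exE)
  from F obtain c1 g1 where 1: "poly_bounded g1"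
    "\<And>\<phi> \<sigma>. \<exists>\<sigma>'. runs \<phi> c1 \<sigma> (g1 (\<sigma> 0)) \<sigma>' \<and> \<sigma>' 0 = F (\<sigma> 0)"
    unfolding poly_time_def by blast
  from 1(1) obtain a1 k1 where ak1: "\<And>v. g1 v \<le> a1 * data_size v ^ k1"
    unfolding poly_bounded_def by blast
  obtain z where z: "0 < z" "\<And>x. x \<in> vars_com c \<union> vars_com c1 \<union> vars_com c1 \<Longrightarrow> x < z"
    by (rule fresh_vars) blast
  have fresh: "z \<notin> vars_com c" using z(2)[of z] by auto
  define e where "e = Binop Push (Var z) (Binop Push (Var 0) (Lit (Lst [])))"
  define d where "d = Then (Assign z (Var 0)) (Then c (Then (Assign 0 e) c1))"
  define S where "S = (\<lambda>v. data_size v + a * data_size v ^ k)"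
  define G where "G = (\<lambda>v. (1 + data_size v) + (a * data_size v ^ k
    + ((10 + 5 * (data_size v + S v)) + a1 * (1 + data_size v + S v) ^ k1)))"
  have "poly_bounded G"
    unfolding G_def S_def by (intro poly_bounded_intros)
  then obtain a2 k2 where G: "\<And>v. G v \<le> a2 * data_size v ^ k2" unfolding poly_bounded_def by blast
  have "\<exists>n \<sigma>. exec (orc p) d (init_store (enc p)) n \<sigma> \<and> n \<le> a2 * data_size (enc p) ^ k2 \<and> ok' p (\<sigma> 0)"
    if p: "p \<in> A" for p
  proof -
    let ?v = "enc p" and ?\<phi> = "orc p"
    let ?\<sigma>0 = "init_store ?v"
    from c p obtain n \<sigma> where ex: "exec ?\<phi> c ?\<sigma>0 n \<sigma>" and n: "n \<le> a * data_size ?v ^ k" and ok: "ok p (\<sigma> 0)"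
      by blast
    let ?\<sigma>1 = "?\<sigma>0(z := ?v)"
    have r1: "runs ?\<phi> (Assign z (Var 0)) ?\<sigma>0 (1 + data_size ?v) ?\<sigma>1"
      using runs_Assign[of ?\<sigma>1 ?\<sigma>0 z "Var 0" ?\<phi>] by (simp add: init_store_def)
    \<comment> \<open>Register 0 is added because it holds the output even if \<open>c\<close> never
      mentions it.\<close>
    have agree: "\<forall>x\<in>vars_com c \<union> {0}. ?\<sigma>1 x = ?\<sigma>0 x" using fresh z(1) by auto
    from exec_agree[OF ex Un_upper1 agree] obtain \<sigma>2
      where ex2: "exec ?\<phi> c ?\<sigma>1 n \<sigma>2" and s2: "\<forall>x\<in>vars_com c \<union> {0}. \<sigma>2 x = \<sigma> x" by blast
    have r2: "runs ?\<phi> c ?\<sigma>1 (a * data_size ?v ^ k) \<sigma>2" unfolding runs_def using ex2 n by blast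
    have z2: "\<sigma>2 z = ?v" using runs_unchanged[OF r2 fresh] by simp
    have out: "\<sigma>2 0 = \<sigma> 0" using s2 by simp
    have size: "data_size (\<sigma> 0) \<le> S ?v"
      using exec_size[OF ex, of 0] n by (simp add: init_store_def S_def)
    let ?u = "pair ?v (\<sigma> 0)"
    let ?\<sigma>3 = "\<sigma>2(0 := ?u)"
    have r3: "runs ?\<phi> (Assign 0 e) \<sigma>2 (10 + 5 * (data_size ?v + S ?v)) ?\<sigma>3"
      by (rule runs_mono[OF runs_Assign]) (use size z2 out in \<open>simp_all add: e_def pair_def\<close>)
    from 1(2)[of ?\<phi> ?\<sigma>3] obtain \<sigma>4 where r4: "runs ?\<phi> c1 ?\<sigma>3 (g1 ?u) \<sigma>4" and s4: "\<sigma>4 0 = F ?u" by auto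
    have "data_size ?u \<le> 1 + data_size ?v + S ?v" using size by (simp add: pair_def)
    then have "g1 ?u \<le> a1 * (1 + data_size ?v + S ?v) ^ k1"
      by (intro order_trans[OF ak1] mult_left_mono power_mono) auto
    from runs_mono[OF r4 this]
    have r4': "runs ?\<phi> c1 ?\<sigma>3 (a1 * (1 + data_size ?v + S ?v) ^ k1) \<sigma>4" .
    have "runs ?\<phi> d ?\<sigma>0 (G ?v) \<sigma>4"
      unfolding d_def G_def by (rule runs_Then[OF r1 runs_Then[OF r2 runs_Then[OF r3 r4']]])
    from runs_mono[OF this G] obtain n' where "n' \<le> a2 * data_size ?v ^ k2" "exec ?\<phi> d ?\<sigma>0 n' \<sigma>4"
      unfolding runs_def by blast
    moreover have "ok' p (\<sigma>4 0)" unfolding s4 by (rule ok'[OF p ok])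
    ultimately show ?thesis by blast
  qed
  then show ?thesis unfolding poly_time_solvable_def
    by - (rule exI[of _ d], rule exI[of _ a2], rule exI[of _ k2], rule ballI)
qed

section \<open>Correctness of the algorithm\<close>

definition numbers :: "nat \<Rightarrow> data list" where
  "numbers n = map (\<lambda>k. Num (int k)) [1..<Suc n]"

lemma length_numbers [simp]: "length (numbers n) = n"
  by (simp add: numbers_def del: upt_Suc)

lemma positions_numbers: "positions xs = numbers (length xs)"
  by (simp add: positions_def numbers_def)

lemma map_numbers: "map f (numbers n) = map (\<lambda>k. f (Num (int k))) [1..<Suc n]"
  by (simp add: numbers_def comp_def del: upt_Suc)

lemma sum_list_numbers: "(\<Sum>k\<leftarrow>numbers n. f k) = (\<Sum>k=1..n. f (Num (int k)))"
proof -
  have "(\<Sum>k\<leftarrow>numbers n. f k) = (\<Sum>k\<leftarrow>[1..<Suc n]. f (Num (int k)))"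
    by (simp add: numbers_def comp_def del: upt_Suc)
  also have "\<dots> = (\<Sum>k\<in>{1..<Suc n}. f (Num (int k)))"
    by (simp add: interv_sum_list_conv_sum_set_nat del: upt_Suc)
  also have "{1..<Suc n} = {1..n}" by auto
  finally show ?thesis .
qed

text \<open>The specification of the bounded searches: one known hit guarantees success, and the
  failures below the result supply the minimality used in the bounds.\<close>

lemma first_position:
  assumes "m \<le> k" "k < n" "Q (Num (int k))"
  obtains d where "num_of (head (filter Q (map (\<lambda>k. Num (int k)) [m..<n]))) = int d" "m \<le> d" "d \<le> k"
    "Q (Num (int d))" "\<And>j. m \<le> j \<Longrightarrow> j < d \<Longrightarrow> \<not> Q (Num (int j))"
proof -
  define d where "d = (LEAST j. m \<le> j \<and> Q (Num (int j)))"
  have d: "m \<le> d \<and> Q (Num (int d))" unfolding d_def by (rule LeastI[of _ k]) (use assms in simp)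
  have dk: "d \<le> k" unfolding d_def by (rule Least_le) (use assms in simp)
  have below: "\<not> Q (Num (int j))" if "m \<le> j" "j < d" for j
    using not_less_Least[of j "\<lambda>j. m \<le> j \<and> Q (Num (int j))"] that by (simp add: d_def)
  have "[m..<n] = [m..<d] @ d # [Suc d..<n]"
  proof -
    have "d < n" "m \<le> d" using dk assms(2) d by auto
    then show ?thesis using upt_add_eq_append[of m d "n - d"] upt_conv_Cons[of d n] by simp
  qed
  moreover have "filter Q (map (\<lambda>k. Num (int k)) [m..<d]) = []" using below by (auto simp: filter_empty_conv)
  ultimately have "num_of (head (filter Q (map (\<lambda>k. Num (int k)) [m..<n]))) = int d"
    using d by (simp add: head_def)
  from that[OF this] d dk below show ?thesis by blast
qed

lemma bpow_numbers:
  assumes "k \<le> n"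
  shows "bpow (numbers n) b (int k) = b ^ k"
proof -
  have "(\<Prod>j\<leftarrow>[1..<Suc n]. if int j \<le> int k then b else 1) = b ^ min k n"
  proof (induction n)
    case (Suc n)
    then show ?case by (cases "Suc n \<le> k") (auto simp: min_def not_less_eq_eq le_Suc_eq)
  qed simp
  then show ?thesis using assms by (simp add: bpow_def numbers_def comp_def del: upt_Suc)
qed

text \<open>The sum counts the \<open>k \<ge> 1\<close> with \<open>2 ^ k \<le> T\<close>; there are
  \<open>n\<close> of them, all in the list because \<open>n \<le> T\<close>.\<close>

lemma log_len_numbers:
  assumes "2 ^ n \<le> T" "T < 2 ^ (n + 1)"
  shows "log_len (numbers T) = int (8 + n)"
proof -
  have "log_len (numbers T) = 8 + (\<Sum>k\<in>{1..T}. if bpow (numbers T) 2 (int k) \<le> int T then 1 else 0)"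
    by (simp add: log_len_def sum_list_numbers sum_list_triv del: One_nat_def)
  also have "(\<Sum>k\<in>{1..T}. if bpow (numbers T) 2 (int k) \<le> int T then 1 else 0) = (\<Sum>k\<in>{1..T}. if k \<le> n then 1 else 0 :: int)"
  proof (rule sum.cong[OF refl])
    fix k
    assume k: "k \<in> {1..T}"
    have "(2::int) ^ k \<le> int T \<longleftrightarrow> 2 ^ k \<le> T" by (metis of_nat_le_iff of_nat_numeral of_nat_power)
    also have "\<dots> \<longleftrightarrow> k \<le> n"
    proof
      assume "2 ^ k \<le> T"
      then have "(2::nat) ^ k < 2 ^ (n + 1)" using assms(2) by linarith
      then have "k < n + 1" by (rule power_less_imp_less_exp[rotated]) simp
      then show "k \<le> n" by simp
    next
      assume "k \<le> n"
      then have "(2::nat) ^ k \<le> 2 ^ n" by simp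
      then show "2 ^ k \<le> T" using assms(1) by linarith
    qed
    finally show "(if bpow (numbers T) 2 (int k) \<le> int T then 1 else 0 :: int) = (if k \<le> n then 1 else 0)"
      using k bpow_numbers[of k T 2] by simp
  qed
  also have "\<dots> = int (card {k \<in> {1..T}. k \<le> n})" by (simp add: sum.If_cases Int_def)
  also have "{k \<in> {1..T}. k \<le> n} = {1..n}"
  proof -
    have "n \<le> T" using assms(1) less_exp[of n] by linarith
    then show ?thesis by auto
  qed
  finally show ?thesis by simp
qed

lemma program_parameters:
  fixes \<alpha> :: real
  assumes alpha: "1 \<le> \<alpha>" and e: "e = 2 * nat \<lceil>\<alpha>\<rceil>" and T: "1 \<le> T"
  obtains B P M :: nat where "class_base e (numbers T) = int B" "grid_num e (numbers T) = int P"
    "grid_den e (numbers T) = int M" "2 \<le> B" "1 \<le> P" "1 \<le> M"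
    "2 * (1 + real P / real M) powr \<alpha> \<le> 290 * (\<alpha> * log_ratio T)"
    "2 * (1 + (1 + ln (real T) / ln (real B)) * (2 + 2 * real B * real M / real P)) \<le> 290 * (\<alpha> * log_ratio T)"
    "0 < log_ratio T"
proof -
  obtain n where n: "2 ^ n \<le> T" "T < 2 ^ (n + 1)"
    using ex_power_ivl1[of 2 T] T by auto
  define L where "L = 8 + n"
  have Lp: "log_len (numbers T) = int L" unfolding L_def by (rule log_len_numbers[OF n])
  have e1: "1 \<le> e" using alpha unfolding e by linarith
  have pos: "positions (replicate 8 (Num 0) @ numbers T) = numbers (8 + T)"
    "positions (replicate e (Num 0)) = numbers e" by (simp_all add: positions_numbers)
  have pow: "(int d + 1) ^ e = int ((d + 1) ^ e)" for d by (simp add: add.commute)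
  \<comment> \<open>\<open>d = L\<close> passes the test as \<open>L < (L + 1) ^ e\<close>; this
    places it among the \<open>8 + T\<close> candidates.\<close>
  have LT: "L \<le> 8 + T" using less_exp[of n] n(1) unfolding L_def by linarith
  have "L + 1 \<le> (L + 1) ^ e" using e1 by (intro self_le_power) auto
  then have "L < (L + 1) ^ e" by simp
  then have QL: "int L < (num_of (Num (int L)) + 1) ^ e" unfolding num_of.simps pow of_nat_less_iff .
  obtain D where D0: "num_of (head (filter (\<lambda>d. int L < (num_of d + 1) ^ e) (numbers (8 + T)))) = int D"
    and D: "1 \<le> D" "int L < (num_of (Num (int D)) + 1) ^ e"
    "\<And>j. 1 \<le> j \<Longrightarrow> j < D \<Longrightarrow> \<not> int L < (num_of (Num (int j)) + 1) ^ e"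
    by (rule first_position[of 1 L "Suc (8 + T)" "\<lambda>d. int L < (num_of d + 1) ^ e", folded numbers_def, OF _ _ QL])
       (use LT L_def in simp_all)
  have sb: "stretch_base e (numbers T) = int D" unfolding stretch_base_def Lp pos by (rule D0)
  have D1: "L < (D + 1) ^ e" using D(2) unfolding num_of.simps pow of_nat_less_iff .
  have D2: "D \<le> 2 \<or> D ^ e \<le> L"
  proof (cases "D \<le> 2")
    case False
    then have "\<not> int L < (num_of (Num (int (D - 1))) + 1) ^ e" by (intro D(3)) auto
    then have "\<not> L < (D - 1 + 1) ^ e" unfolding num_of.simps pow of_nat_less_iff .
    then show ?thesis using False by simp
  qed simp
  have powM: "int L * int m ^ e = int (L * m ^ e)" for m by simp
  have "(e + 1) ^ e \<le> L * e ^ e" by (rule stretch_den_exists[OF e1]) (simp add: L_def)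
  then have QM: "(num_of (Num (int e)) + 1) ^ e \<le> int L * num_of (Num (int e)) ^ e"
    unfolding num_of.simps pow powM of_nat_le_iff .
  obtain M0 where M00: "num_of (head (filter (\<lambda>m. (num_of m + 1) ^ e \<le> int L * num_of m ^ e) (numbers e))) = int M0"
    and M0: "1 \<le> M0" "(num_of (Num (int M0)) + 1) ^ e \<le> int L * num_of (Num (int M0)) ^ e"
    "\<And>j. 1 \<le> j \<Longrightarrow> j < M0 \<Longrightarrow> \<not> (num_of (Num (int j)) + 1) ^ e \<le> int L * num_of (Num (int j)) ^ e"
    by (rule first_position[of 1 e "Suc e" "\<lambda>m. (num_of m + 1) ^ e \<le> int L * num_of m ^ e",
          folded numbers_def, OF e1 _ QM]) simp_all
  have sd: "stretch_den e (numbers T) = int M0" unfolding stretch_den_def Lp pos by (rule M00)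
  have M1: "(M0 + 1) ^ e \<le> L * M0 ^ e" using M0(2) unfolding num_of.simps pow powM of_nat_le_iff .
  have M2: "M0 = 1 \<or> L * (M0 - 1) ^ e < M0 ^ e"
  proof (cases "M0 = 1")
    case False
    then have "\<not> (num_of (Num (int (M0 - 1))) + 1) ^ e \<le> int L * num_of (Num (int (M0 - 1))) ^ e"
      using M0(1) by (intro M0(3)) auto
    then have "\<not> (M0 - 1 + 1) ^ e \<le> L * (M0 - 1) ^ e" unfolding num_of.simps pow powM of_nat_le_iff .
    then show ?thesis using M0(1) by simp
  qed simp
  define B where "B = (if 3 \<le> D then D - 1 else 2)"
  define P where "P = (if 3 \<le> D then D - 1 else 1)"
  define M where "M = (if 3 \<le> D then 1 else M0)"
  note bounds = parameter_bounds[OF alpha e T L_def n D1 D2 M0(1) M1 M2 B_def P_def M_def]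
  show ?thesis
  proof (rule that[OF _ _ _ _ _ _ bounds])
    show "class_base e (numbers T) = int B" "grid_num e (numbers T) = int P" "grid_den e (numbers T) = int M"
      unfolding class_base_def grid_num_def grid_den_def sb sd by (auto simp: B_def P_def M_def)
    show "2 \<le> B" "1 \<le> P" "1 \<le> M" using M0(1) by (auto simp: B_def P_def M_def)
  qed
qed

section \<open>Decoding the LP solution\<close>

definition enc_x_entry :: "(nat \<times> nat \<times> nat) \<times> rat \<Rightarrow> data" where
  "enc_x_entry = (\<lambda>((i, s, t), q). Lst [enc_nat i, enc_nat s, enc_nat t, enc_rat q])"

lemma item_enc_x_entry [simp]:
  "item 0 (enc_x_entry ((i, s, t), q)) = Num (int i)" "item 1 (enc_x_entry ((i, s, t), q)) = Num (int s)"
  "item (Suc 0) (enc_x_entry ((i, s, t), q)) = Num (int s)"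
  "item 2 (enc_x_entry ((i, s, t), q)) = Num (int t)" "item 3 (enc_x_entry ((i, s, t), q)) = enc_rat q"
  by (simp_all add: enc_x_entry_def enc_nat_def numeral_2_eq_2 numeral_3_eq_3)

lemma item_enc_rat [simp]:
  "item 0 (enc_rat q) = Num (fst (quotient_of q))" "item 1 (enc_rat q) = Num (snd (quotient_of q))"
  "item (Suc 0) (enc_rat q) = Num (snd (quotient_of q))"
  by (simp_all add: enc_rat_def split: prod.split)

lemma den_prod_pos: "0 < den_prod (map enc_x_entry X)"
proof (induction X)
  case (Cons e X)
  obtain i s t q where e: "e = ((i, s, t), q)" by (metis prod.collapse)
  show ?case using Cons quotient_of_denom_pos'[of q] by (simp add: den_prod_def e)
qed (simp add: den_prod_def)

lemma den_dvd_den_prod: "(k, q) \<in> set X \<Longrightarrow> snd (quotient_of q) dvd den_prod (map enc_x_entry X)"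
proof (induction X)
  case (Cons e X)
  obtain i s t r where e: "e = ((i, s, t), r)" by (metis prod.collapse)
  show ?case using Cons by (auto simp: den_prod_def e)
qed simp

text \<open>The common denominator belongs to the whole list, so the induction runs over an
  arbitrary list \<open>Z\<close> whose denominators divide it. Several entries for one variable add
  up on both sides.\<close>

lemma scaled_mass_enc:
  "real_of_int (scaled_mass (map enc_x_entry X) (int i) (int a) (int t))
     = real_of_int (den_prod (map enc_x_entry X)) * (\<Sum>s=1..a. x_of X i s t)"
proof -
  let ?Q = "den_prod (map enc_x_entry X)"
  let ?h = "\<lambda>e. if num_of (item 0 e) = int i \<and> 0 < num_of (item 1 e) \<and> num_of (item 1 e) \<le> int a \<and> num_of (item 2 e) = int t
     then num_of (item 0 (item 3 e)) * (?Q div num_of (item 1 (item 3 e))) else 0"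
  have "real_of_int (\<Sum>e\<leftarrow>map enc_x_entry Z. ?h e) = real_of_int ?Q * (\<Sum>s=1..a. x_of Z i s t)"
    if "\<forall>(k, q)\<in>set Z. snd (quotient_of q) dvd ?Q" for Z
    using that
  proof (induction Z)
    case (Cons e Z)
    obtain i' s' t' q where e: "e = ((i', s', t'), q)" by (metis prod.collapse)
    obtain n d where nd: "quotient_of q = (n, d)" by fastforce
    have d: "0 < d" using quotient_of_denom_pos[OF nd] .
    have dvd: "d dvd ?Q" using Cons.prems nd by (auto simp: e)
    have q: "(of_rat q :: real) = real_of_int n / real_of_int d"
      using quotient_of_div[OF nd] by (simp add: of_rat_divide)
    have "real_of_int (n * (?Q div d)) = real_of_int ?Q * of_rat q"
      using dvd d by (simp add: q real_of_int_div)
    then have head: "real_of_int (?h (enc_x_entry e))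
        = real_of_int ?Q * (if i' = i \<and> 1 \<le> s' \<and> s' \<le> a \<and> t' = t then of_rat q else 0)"
      by (auto simp: e nd)
    have "(\<Sum>s=1..a. if (i', s', t') = (i, s, t) then of_rat q else 0 :: real)
        = (\<Sum>s=1..a. if s' = s then (if i' = i \<and> t' = t then of_rat q else 0) else 0)"
      by (intro sum.cong) auto
    also have "\<dots> = (if i' = i \<and> 1 \<le> s' \<and> s' \<le> a \<and> t' = t then of_rat q else 0)"
      by (simp add: sum.delta')
    finally have "(\<Sum>s=1..a. x_of (e # Z) i s t)
        = (if i' = i \<and> 1 \<le> s' \<and> s' \<le> a \<and> t' = t then of_rat q else 0) + (\<Sum>s=1..a. x_of Z i s t)"
      by (simp add: x_of_def e sum.distrib)
    moreover have "real_of_int (\<Sum>e\<leftarrow>map enc_x_entry Z. ?h e) = real_of_int ?Q * (\<Sum>s=1..a. x_of Z i s t)"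
      using Cons by simp
    ultimately show ?case using head
      by (simp only: list.map sum_list.Cons of_int_add distrib_left)
  qed (simp add: x_of_def)
  from this[of X] show ?thesis unfolding scaled_mass_def using den_dvd_den_prod by fast
qed

text \<open>The search covers the whole horizon but stops by \<open>t\<close>, where the mass is 1.
  Success at \<open>d\<close> and failure at \<open>d - 1\<close> give the two inequalities; for
  \<open>d = 1\<close> the second sum is empty.\<close>

lemma median_enc:
  assumes lp: "LP_feasible I y (x_of X)" and D: "(i, t) \<in> demand_points I"
  obtains a where "median (numbers (horizon I)) (map enc_x_entry X) (int i) (int t) = int a" "a \<in> {1..t}"
    "1 / 2 \<le> (\<Sum>s=1..a. x_of X i s t)" "(\<Sum>s\<in>{1..<a}. x_of X i s t) < 1 / 2"
proof -
  let ?Q = "den_prod (map enc_x_entry X)"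
  let ?P = "\<lambda>s. ?Q \<le> 2 * scaled_mass (map enc_x_entry X) (int i) (num_of s) (int t)"
  have t: "1 \<le> t" "t \<le> horizon I" using D by (auto simp: demand_points_def)
  have Q: "0 < real_of_int ?Q" using den_prod_pos by simp
  have P: "?P (Num (int a)) \<longleftrightarrow> 1 / 2 \<le> (\<Sum>s=1..a. x_of X i s t)" for a
  proof -
    have "?P (Num (int a)) \<longleftrightarrow> real_of_int ?Q \<le> 2 * real_of_int (scaled_mass (map enc_x_entry X) (int i) (int a) (int t))"
      by simp linarith
    also have "\<dots> \<longleftrightarrow> real_of_int ?Q * 1 \<le> real_of_int ?Q * (2 * (\<Sum>s=1..a. x_of X i s t))"
      unfolding scaled_mass_enc by (simp add: mult_ac)
    also have "\<dots> \<longleftrightarrow> 1 \<le> 2 * (\<Sum>s=1..a. x_of X i s t)" using Q by (rule mult_le_cancel_left_pos)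
    finally show ?thesis by linarith
  qed
  have one: "(\<Sum>s=1..t. x_of X i s t) = 1" using lp D by (auto simp: LP_feasible_def constraints_def)
  have Pt: "?P (Num (int t))" unfolding P one by simp
  show ?thesis
  proof (rule first_position[of 1 t "Suc (horizon I)" ?P, OF t(1) _ Pt])
    show "t < Suc (horizon I)" using t by simp
    fix d
    assume d: "num_of (head (filter ?P (map (\<lambda>k. Num (int k)) [1..<Suc (horizon I)]))) = int d" "1 \<le> d" "d \<le> t" "?P (Num (int d))"
      "\<And>j. 1 \<le> j \<Longrightarrow> j < d \<Longrightarrow> \<not> ?P (Num (int j))"
    show thesis
    proof (rule that[of d])
      show "median (numbers (horizon I)) (map enc_x_entry X) (int i) (int t) = int d"
        unfolding median_def numbers_def by (rule d(1))
      show "1 / 2 \<le> (\<Sum>s=1..d. x_of X i s t)" using d(4) unfolding P .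
      show "(\<Sum>s\<in>{1..<d}. x_of X i s t) < 1 / 2"
      proof (cases "d = 1")
        case False
        then have "\<not> 1 / 2 \<le> (\<Sum>s=1..d - 1. x_of X i s t)" using d(5)[of "d - 1"] d(2) unfolding P by simp
        moreover have "{1..d - 1} = {1..<d}" using False d(2) by auto
        ultimately show ?thesis by simp
      qed simp
    qed (use d in simp)
  qed
qed

lemma (in lp_rounding) spacing_of_numbers:
  assumes cb: "class_base e (numbers (horizon I)) = int B" and gn: "grid_num e (numbers (horizon I)) = int P"
    and gd: "grid_den e (numbers (horizon I)) = int M" and w: "0 < w" "w < horizon I"
  shows "spacing_of e (numbers (horizon I)) (int w) = int (spacing (length_class w))"
proof -
  let ?T = "horizon I" and ?k = "length_class w"
  let ?P = "\<lambda>k. int w < int B * bpow (numbers ?T) (int B) (num_of k)"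
  note lc = length_class[OF w(1)]
  have P: "?P (Num (int k)) \<longleftrightarrow> w < B ^ (k + 1)" if "k \<le> ?T" for k
  proof -
    have "?P (Num (int k)) \<longleftrightarrow> int w < int (B ^ (k + 1))" using that by (simp add: bpow_numbers)
    then show ?thesis by (simp only: of_nat_less_iff)
  qed
  \<comment> \<open>The class index stays below the horizon, where \<open>bpow\<close> is the true
    power and the search can find it.\<close>
  have "?k < 2 ^ ?k" by (rule less_exp)
  also have "(2::nat) ^ ?k \<le> B ^ ?k" using B by (intro power_mono) auto
  finally have kT: "?k < ?T" using lc(1) w(2) by linarith
  have Pk: "?P (Num (int ?k))" using lc(2) kT by (subst P) auto
  have cons: "Num 0 # numbers ?T = map (\<lambda>k. Num (int k)) [0..<Suc ?T]"
    by (simp add: numbers_def upt_conv_Cons[of 0] del: upt_Suc)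
  obtain d where d: "num_of (head (filter ?P (Num 0 # numbers ?T))) = int d" "d \<le> ?k" "?P (Num (int d))"
    using first_position[of 0 ?k "Suc ?T" ?P, OF _ _ Pk] kT unfolding cons by (metis le0 less_SucI)
  have "w < B ^ (d + 1)" using d(2,3) kT by (subst (asm) P) auto
  then have "?k \<le> d" unfolding length_class_def by (rule Least_le)
  with d(1,2) have "level e (numbers ?T) (int w) = int ?k" by (simp add: level_def cb)
  then have "raw_spacing e (numbers ?T) (int w) = int (B ^ ?k * P div M)"
    using kT unfolding raw_spacing_def cb gn gd by (simp add: bpow_numbers zdiv_int)
  then show ?thesis by (simp add: spacing_of_def spacing_def)
qed

text \<open>As \<open>1 \<le> a \<le> t\<close>, no subtraction goes below 0, so the integer
  arithmetic of the program agrees with that of \<open>g\<close>.\<close>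

lemma (in lp_rounding) snap_numbers:
  assumes "class_base e (numbers (horizon I)) = int B" "grid_num e (numbers (horizon I)) = int P"
    "grid_den e (numbers (horizon I)) = int M" and D: "(i, t) \<in> demand_points I"
  shows "snap e (numbers (horizon I)) (int (a i t)) (int t) = int (g i t)"
proof (cases "a i t = t")
  case False
  then have less: "0 < t - a i t" "t - a i t < horizon I" and a: "1 \<le> a i t" "a i t \<le> t"
    using a_range[OF D] demand_points_range[OF D] by auto
  have diff: "int t - int (a i t) = int (t - a i t)" "int (a i t) - 1 = int (a i t - 1)" using a by simp_all
  show ?thesis
    using False unfolding snap_def g_def diff spacing_of_numbers[OF assms(1-3) less]
    by (simp add: zdiv_int)
qed (simp add: snap_def g_def)

text \<open>Row by row, the order in which \<open>points\<close> walks through the table.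
  Distinctness turns sums over the list into sums over the demand points.\<close>

definition demand_list :: "nat \<Rightarrow> nat \<Rightarrow> (nat \<Rightarrow> nat \<Rightarrow> rat) \<Rightarrow> (nat \<times> nat) list" where
  "demand_list N T d = filter (\<lambda>(i, t). 0 < d i t) (List.product [1..<Suc N] [1..<Suc T])"

lemma set_demand_list: "set (demand_list (elems I) (horizon I) (demand I)) = demand_points I"
  by (auto simp: demand_list_def demand_points_def)

lemma distinct_demand_list: "distinct (demand_list N T d)"
  by (simp add: demand_list_def distinct_product del: upt_Suc)

lemma enum_map_upt:
  "enum (map f [1..<Suc n]) = map (\<lambda>k. pair (Num (int k)) (f k)) [1..<Suc n]"
  by (rule nth_equalityI) (simp_all add: enum_def add.commute del: upt_Suc)

lemma quotient_of_pos: "0 < fst (quotient_of q) \<longleftrightarrow> 0 < q"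
proof -
  obtain n d where nd: "quotient_of q = (n, d)" by fastforce
  have "0 < q \<longleftrightarrow> 0 < n"
    unfolding quotient_of_div[OF nd] using quotient_of_denom_pos[OF nd] by (simp add: zero_less_divide_iff)
  then show ?thesis by (simp add: nd)
qed

lemma points_enc_table:
  "points (list_of (enc_table N T d)) = map (\<lambda>(i, t). pair (Num (int i)) (Num (int t))) (demand_list N T d)"
proof -
  have row: "concat (map (\<lambda>t. if 0 < d i t then [pair (Num (int i)) (Num (int t))] else []) ts)
      = map (\<lambda>(i, t). pair (Num (int i)) (Num (int t))) (filter (\<lambda>(i, t). 0 < d i t) (map (Pair i) ts))" for i ts
    by (induction ts) auto
  have "points (list_of (enc_table N T d)) = concat (map (\<lambda>i. concat (map (\<lambda>t.
      if 0 < d i t then [pair (Num (int i)) (Num (int t))] else []) [1..<Suc T])) [1..<Suc N])"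
    by (simp add: points_def enc_table_def enum_map_upt comp_def quotient_of_pos cong: if_cong del: upt_Suc One_nat_def)
  also have "\<dots> = map (\<lambda>(i, t). pair (Num (int i)) (Num (int t))) (demand_list N T d)"
    unfolding row demand_list_def product_concat_map filter_concat map_concat
    by (simp add: comp_def del: upt_Suc)
  finally show ?thesis .
qed

text \<open>Equality with \<open>y'\<close> and \<open>x'\<close> as functions transfers feasibility
  and cost to the output at once.\<close>

lemma (in lp_rounding) rounding_output:
  fixes e :: nat and v :: data
  assumes service: "\<And>i t. (i, t) \<in> demand_points I \<Longrightarrow>
    service e (numbers (horizon I)) (list_of (item 1 v)) (int i) (int t) = int (g i t)"
  obtains Y X where "rounding e (pair (enc_inventory I) v) = enc_solution Y X" "y_of Y = y'" "x_of X = x'"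
proof -
  let ?T = "horizon I" and ?dl = "demand_list (elems I) (horizon I) (demand I)"
  let ?xs = "list_of (item 1 v)"
  define E where "E s = concat (map (\<lambda>(i, t). if g i t = s then [i] else []) ?dl)" for s
  define Y :: y_entries where "Y = map (\<lambda>s. ((E s, s), 1)) [1..<Suc ?T]"
  define X :: x_entries where "X = map (\<lambda>(i, t). ((i, g i t, t), 1)) ?dl"
  have tab: "item 2 (enc_inventory I) = enc_table (elems I) ?T (demand I)"
    by (simp add: enc_inventory_def numeral_2_eq_2)
  have "1 \<le> elems I" using problem by (simp add: inventory_problem_def)
  then have "[1..<Suc (elems I)] = 1 # [2..<Suc (elems I)]"
    by (simp add: upt_conv_Cons numeral_2_eq_2 del: upt_Suc)
  then have per: "periods (enc_inventory I) = numbers ?T"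
    unfolding periods_def tab by (simp add: enc_table_def positions_numbers del: upt_Suc)
  have one: "enc_rat 1 = Lst [Num 1, Num 1]" by (simp add: enc_rat_def)
  let ?ps = "map (\<lambda>(i, t). pair (Num (int i)) (Num (int t))) ?dl"
  have E: "concat (map (\<lambda>p. if service e (numbers ?T) ?xs (num_of (first p)) (num_of (second p)) = int s
      then [first p] else []) ?ps) = map enc_nat (E s)" for s
    unfolding E_def map_concat map_map
    by (intro arg_cong[of _ _ concat] map_cong refl)
       (auto simp: service set_demand_list enc_nat_def simp del: One_nat_def)
  have ry: "round_y e (numbers ?T) ?xs ?ps = map (\<lambda>((E, s), q). Lst [Lst (map enc_nat E), enc_nat s, enc_rat q]) Y"
    unfolding round_y_def map_numbers num_of.simps E
    by (simp add: Y_def comp_def enc_nat_def one del: upt_Suc One_nat_def)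
  have rx: "round_x e (numbers ?T) ?xs ?ps = map (\<lambda>((i, s, t), q). Lst [enc_nat i, enc_nat s, enc_nat t, enc_rat q]) X"
    unfolding round_x_def X_def map_map
    by (intro map_cong refl) (auto simp: service set_demand_list enc_nat_def one simp del: One_nat_def)
  have "rounding e (pair (enc_inventory I) v) = enc_solution Y X"
    unfolding rounding_def first_pair second_pair per tab points_enc_table ry rx enc_solution_def ..
  moreover have "y_of Y = y'"
  proof (intro ext)
    fix S s
    have set_E: "set (E s) = U s" for s
      by (auto simp: E_def U_def set_demand_list split: if_splits)
    have "y_of Y S s = (\<Sum>r\<leftarrow>[1..<Suc ?T]. if set (E r) = S \<and> r = s then 1 else 0)"
      by (simp add: y_of_def Y_def comp_def cong: if_cong del: upt_Suc)
    also have "\<dots> = (\<Sum>r\<in>{1..<Suc ?T}. if r = s then (if U s = S then 1 else 0) else 0)"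
      unfolding interv_sum_list_conv_sum_set_nat set_upt set_E by (intro sum.cong) auto
    also have "\<dots> = y' S s" by (auto simp: y'_def sum.delta)
    finally show "y_of Y S s = y' S s" .
  qed
  moreover have "x_of X = x'"
  proof (intro ext)
    fix i s t
    have "x_of X i s t = (\<Sum>p\<leftarrow>?dl. if p = (i, t) then (if s = g i t then 1 else 0) else 0)"
      unfolding x_of_def X_def map_map
      by (intro arg_cong[of _ _ sum_list] map_cong refl) (auto split: if_splits)
    also have "\<dots> = (\<Sum>p\<in>demand_points I. if p = (i, t) then (if s = g i t then 1 else 0) else 0)"
      unfolding set_demand_list[symmetric] by (rule sum_list_distinct_conv_sum_set[OF distinct_demand_list])
    also have "\<dots> = x' i s t" using finite_demand_points by (simp add: x'_def sum.delta)
    finally show "x_of X i s t = x' i s t" .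
  qed
  ultimately show ?thesis by (rule that)
qed

section \<open>Comparison with the optimal values\<close>

lemma IP_feasible_imp_LP_feasible:
  assumes "IP_feasible I y x"
  shows "LP_feasible I y x"
proof -
  have nonneg: "0 \<le> z" if "z \<in> {0, 1}" for z :: real using that by auto
  from assms have 1: "constraints I y x" and 2: "\<forall>S\<subseteq>{1..elems I}. \<forall>s\<in>{1..horizon I}. y S s \<in> {0, 1}"
    and 3: "\<forall>(i, t)\<in>demand_points I. \<forall>s\<in>{1..t}. x i s t \<in> {0, 1}"
    unfolding IP_feasible_def by simp_all
  have "\<forall>S\<subseteq>{1..elems I}. \<forall>s\<in>{1..horizon I}. 0 \<le> y S s" using 2 nonneg by blast
  moreover have "\<forall>(i, t)\<in>demand_points I. \<forall>s\<in>{1..t}. 0 \<le> x i s t" using 3 nonneg by blast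
  ultimately show ?thesis using 1 unfolding LP_feasible_def by blast
qed

lemma objective_nonneg:
  assumes I: "inventory_problem I" and lp: "LP_feasible I y x"
  shows "0 \<le> objective I y x"
proof -
  have "0 \<le> (\<Sum>S\<in>Pow {1..elems I}. \<Sum>s=1..horizon I. order_cost I S * y S s)"
    using I lp by (intro sum_nonneg mult_nonneg_nonneg) (auto simp: inventory_problem_def LP_feasible_def)
  moreover have "0 \<le> (\<Sum>(i, t)\<in>demand_points I. \<Sum>s=1..t. holding_cost I i s t * x i s t)"
  proof (rule sum_nonneg, clarify)
    fix i t
    assume D: "(i, t) \<in> demand_points I"
    show "0 \<le> (\<Sum>s=1..t. holding_cost I i s t * x i s t)"
      using I lp D
      by (intro sum_nonneg mult_nonneg_nonneg)
         (auto simp: inventory_problem_def LP_feasible_def holding_cost_def demand_points_def)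
  qed
  ultimately show ?thesis by (simp add: objective_def)
qed

lemma LP_opt_le:
  assumes "inventory_problem I" "LP_feasible I y x"
  shows "LP_opt I \<le> objective I y x"
  unfolding LP_opt_def
  by (rule cInf_lower) (use assms objective_nonneg in \<open>auto intro!: bdd_belowI[of _ 0]\<close>)

text \<open>The objective values are bounded below by 0, and the given feasible point makes the sets
  nonempty, without which \<open>Inf\<close> says nothing.\<close>

lemma opt_bounds:
  assumes "inventory_problem I" "IP_feasible I y x"
  shows "0 \<le> LP_opt I" "LP_opt I \<le> IP_opt I" "IP_opt I \<le> objective I y x"
proof -
  have lp: "LP_feasible I y x" by (rule IP_feasible_imp_LP_feasible[OF assms(2)])
  show "0 \<le> LP_opt I"
    unfolding LP_opt_def by (rule cInf_greatest) (use lp assms(1) objective_nonneg in auto)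
  show "LP_opt I \<le> IP_opt I"
    unfolding IP_opt_def
    by (rule cInf_greatest) (use assms LP_opt_le IP_feasible_imp_LP_feasible in auto)
  show "IP_opt I \<le> objective I y x"
    unfolding IP_opt_def
    by (rule cInf_lower)
       (use assms objective_nonneg IP_feasible_imp_LP_feasible in \<open>auto intro!: bdd_belowI[of _ 0]\<close>)
qed

text \<open>A factor \<open>\<beta> < 1\<close> forces the ordering costs to vanish, and then every factor is admissible.\<close>

lemma fractional_subadditive_max_1:
  assumes nonneg: "\<And>S. S \<subseteq> {1..N} \<Longrightarrow> 0 \<le> f S" and f: "fractional_subadditive \<beta> N f"
  shows "fractional_subadditive (max 1 \<beta>) N f" and "\<beta> < 1 \<Longrightarrow> S \<subseteq> {1..N} \<Longrightarrow> f S = 0"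
proof -
  have zero: "f S = 0" if "\<beta> < 1" "S \<subseteq> {1..N}" for S
  proof -
    have "f S \<le> \<beta> * (\<Sum>k\<in>{()}. 1 * f S)"
      by (rule fractional_subadditive_family[OF f that(2), where C = "\<lambda>_. S" and l = "\<lambda>_. 1"])
         (use that in auto)
    then have "(1 - \<beta>) * f S \<le> 0" by (simp add: algebra_simps)
    with that nonneg[OF that(2)] show ?thesis by (simp add: mult_le_0_iff)
  qed
  then show "\<beta> < 1 \<Longrightarrow> S \<subseteq> {1..N} \<Longrightarrow> f S = 0" .
  show "fractional_subadditive (max 1 \<beta>) N f"
  proof (cases "\<beta> < 1")
    case True
    with zero show ?thesis by (simp add: fractional_subadditive_def)
  next
    case False
    then show ?thesis using f by (simp add: max_def)
  qed
qed

text \<open>Ordering all elements in every period and serving each demand in its own period is free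
  here. Hence a positive LP value excludes vanishing ordering costs, and with them
  \<open>\<beta> < 1\<close>.\<close>

lemma LP_opt_eq_0:
  assumes I: "inventory_problem I" and poly: "polynomial_holding \<alpha> I"
    and f: "\<And>S. S \<subseteq> {1..elems I} \<Longrightarrow> order_cost I S = 0"
  shows "LP_opt I \<le> 0"
proof -
  define y :: y_vars where "y S s = (if S = {1..elems I} then 1 else 0)" for S s
  define x :: x_vars where "x i s t = (if s = t then 1 else 0)" for i s t
  have y: "(\<Sum>S\<in>{S. i \<in> S \<and> S \<subseteq> {1..elems I}}. y S s) = 1" if "i \<in> {1..elems I}" for i s
  proof -
    have "finite {S. i \<in> S \<and> S \<subseteq> {1..elems I}}"
      by (rule finite_subset[of _ "Pow {1..elems I}"]) auto
    then show ?thesis using that by (simp add: y_def sum.delta)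
  qed
  have "constraints I y x"
    unfolding constraints_def
  proof clarify
    fix i t
    assume "(i, t) \<in> demand_points I"
    then have "i \<in> {1..elems I}" "1 \<le> t" by (auto simp: demand_points_def)
    then show "(\<Sum>s=1..t. x i s t) = 1
        \<and> (\<forall>s\<in>{1..t}. x i s t \<le> (\<Sum>S\<in>{S. i \<in> S \<and> S \<subseteq> {1..elems I}}. y S s))"
      by (simp only: y) (simp add: x_def)
  qed
  then have "LP_feasible I y x" by (auto simp: LP_feasible_def y_def x_def)
  then have "LP_opt I \<le> objective I y x" by (rule LP_opt_le[OF I])
  also have "objective I y x = 0"
  proof -
    have "(\<Sum>s=1..t. holding_cost I i s t * x i s t) = 0" if "(i, t) \<in> demand_points I" for i t
    proof (rule sum.neutral, rule ballI)
      fix s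
      assume "s \<in> {1..t}"
      with poly that show "holding_cost I i s t * x i s t = 0"
        by (auto simp: x_def holding_cost_def polynomial_holding_def demand_points_def)
    qed
    then have "(\<Sum>(i, t)\<in>demand_points I. \<Sum>s=1..t. holding_cost I i s t * x i s t) = 0"
      by (intro sum.neutral) auto
    then show ?thesis using f by (simp add: objective_def)
  qed
  finally show ?thesis .
qed

lemma rounding_correct:
  fixes \<alpha> \<beta> \<gamma> :: real
  assumes alpha: "1 \<le> \<alpha>" and I: "inventory_problem I" and poly: "polynomial_holding \<alpha> I"
    and sub: "fractional_subadditive \<beta> (elems I) (order_cost I)"
    and lp: "LP_approximate \<gamma> I (y_of Y) (x_of X)"
  shows "\<exists>Y' X'. rounding (2 * nat \<lceil>\<alpha>\<rceil>) (pair (enc_inventory I) (enc_solution Y X)) = enc_solution Y' X'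
    \<and> IP_approximate (290 * (\<alpha> * \<beta> * \<gamma> * log_ratio (horizon I))) I (y_of Y') (x_of X')"
proof -
  let ?e = "2 * nat \<lceil>\<alpha>\<rceil>" and ?T = "horizon I" and ?xs = "map enc_x_entry X"
  define R where "R = log_ratio ?T"
  have feas: "LP_feasible I (y_of Y) (x_of X)" and approx: "objective I (y_of Y) (x_of X) \<le> \<gamma> * LP_opt I"
    using lp by (auto simp: LP_approximate_def)
  have T: "1 \<le> ?T" using I by (simp add: inventory_problem_def)
  obtain B P M :: nat where par: "class_base ?e (numbers ?T) = int B" "grid_num ?e (numbers ?T) = int P"
    "grid_den ?e (numbers ?T) = int M" "2 \<le> B" "1 \<le> P" "1 \<le> M"
    "2 * (1 + real P / real M) powr \<alpha> \<le> 290 * (\<alpha> * R)"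
    "2 * (1 + (1 + ln (real ?T) / ln (real B)) * (2 + 2 * real B * real M / real P)) \<le> 290 * (\<alpha> * R)"
    and R: "0 < R"
    using program_parameters[OF alpha refl T] unfolding R_def by blast
  define a where "a i t = nat (median (numbers ?T) ?xs (int i) (int t))" for i t
  have a: "median (numbers ?T) ?xs (int i) (int t) = int (a i t) \<and> a i t \<in> {1..t}
      \<and> 1 / 2 \<le> (\<Sum>s=1..a i t. x_of X i s t) \<and> (\<Sum>s\<in>{1..<a i t}. x_of X i s t) < 1 / 2"
    if D: "(i, t) \<in> demand_points I" for i t
  proof -
    obtain a0 where a0: "median (numbers ?T) ?xs (int i) (int t) = int a0" "a0 \<in> {1..t}"
      "1 / 2 \<le> (\<Sum>s=1..a0. x_of X i s t)" "(\<Sum>s\<in>{1..<a0}. x_of X i s t) < 1 / 2"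
      by (rule median_enc[OF feas D])
    have "a i t = a0" unfolding a_def a0(1) by simp
    then show ?thesis using a0 by simp
  qed
  have sub': "fractional_subadditive (max 1 \<beta>) (elems I) (order_cost I)"
    and zero: "\<beta> < 1 \<Longrightarrow> S \<subseteq> {1..elems I} \<Longrightarrow> order_cost I S = 0" for S
    using fractional_subadditive_max_1[OF _ sub] I by (auto simp: inventory_problem_def)
  interpret lp_rounding I \<alpha> "max 1 \<beta>" "y_of Y" "x_of X" B P M a
    by unfold_locales (use I poly alpha sub' feas par a in auto)
  have xs: "list_of (item 1 (enc_solution Y X)) = ?xs"
    by (simp add: enc_solution_def enc_x_entry_def)
  have "service ?e (numbers ?T) (list_of (item 1 (enc_solution Y X))) (int i) (int t) = int (g i t)"
    if D: "(i, t) \<in> demand_points I" for i t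
    unfolding service_def xs using a[OF D] snap_numbers[OF par(1-3) D] by simp
  then obtain Y' X' where out: "rounding ?e (pair (enc_inventory I) (enc_solution Y X)) = enc_solution Y' X'"
    and yx: "y_of Y' = y'" "x_of X' = x'"
    by (rule rounding_output)
  let ?z = "objective I (y_of Y) (x_of X)" and ?K = "290 * (\<alpha> * R)"
  have cost: "objective I y' x' \<le> max 1 \<beta> * ?K * ?z"
  proof (rule rounded_cost)
    show "2 * load \<le> ?K" by (rule order_trans[OF mult_left_mono[OF load_bound] par(8)]) simp
  qed (use par(7) in auto)
  note opt = opt_bounds[OF I rounded_feasible]
  have z: "0 \<le> ?z" "LP_opt I \<le> ?z" by (rule objective_nonneg[OF I feas], rule LP_opt_le[OF I feas])
  have K: "0 < ?K" using alpha R by simp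
  \<comment> \<open>Here \<open>max 1 \<beta>\<close> has to be replaced by \<beta>, with \<beta>
    and \<gamma> arbitrary reals. If the LP solution costs nothing, so does the rounded one, and
    \<open>IP_opt I\<close> is 0. Otherwise its positive cost forces a positive LP value, and this
    in turn \<open>1 \<le> \<gamma>\<close> and \<open>1 \<le> \<beta>\<close>.\<close>
  have "objective I y' x' \<le> 290 * (\<alpha> * \<beta> * \<gamma> * R) * IP_opt I"
  proof (cases "?z = 0")
    case True
    then have "objective I y' x' \<le> 0" using cost by simp
    then have "IP_opt I = 0" "objective I y' x' \<le> 0" using opt by linarith+
    then show ?thesis by simp
  next
    case False
    then have z_pos: "0 < ?z" using z by simp
    have opt_pos: "0 < LP_opt I"
    proof (rule ccontr)
      assume "\<not> 0 < LP_opt I"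
      then have "LP_opt I = 0" using opt(1) by simp
      then show False using approx z_pos by simp
    qed
    have "1 * LP_opt I \<le> \<gamma> * LP_opt I" using approx z(2) by simp
    then have gamma: "1 \<le> \<gamma>" using opt_pos by (rule mult_right_le_imp_le)
    have beta: "1 \<le> \<beta>" using LP_opt_eq_0[OF I poly zero] opt_pos by fastforce
    have "objective I y' x' \<le> \<beta> * ?K * ?z" using cost beta by (simp add: max_def)
    also have "\<dots> \<le> \<beta> * ?K * (\<gamma> * IP_opt I)"
    proof (rule mult_left_mono)
      have "\<gamma> * LP_opt I \<le> \<gamma> * IP_opt I" using gamma opt(2) by (intro mult_left_mono) auto
      then show "?z \<le> \<gamma> * IP_opt I" using approx by linarith
      show "0 \<le> \<beta> * ?K" using beta K by simp
    qed
    finally show ?thesis by (simp add: mult_ac)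
  qed
  then have "IP_approximate (290 * (\<alpha> * \<beta> * \<gamma> * R)) I (y_of Y') (x_of X')"
    unfolding IP_approximate_def yx using rounded_feasible by blast
  with out show ?thesis unfolding R_def by blast
qed

theorem theorem1:
  shows "\<exists>C>0. \<forall>(\<alpha>::real) (\<beta>::real) (\<gamma>::real) (\<I> :: inventory set).
    1 \<le> \<alpha> \<longrightarrow>
    (\<forall>I\<in>\<I>. inventory_problem I \<and> polynomial_holding \<alpha> I
       \<and> fractional_subadditive \<beta> (elems I) (order_cost I)) \<longrightarrow>
    LP_approx_in_poly_time \<gamma> \<I> \<longrightarrow>
    IP_approx_in_poly_time (\<lambda>I. C * (\<alpha> * \<beta> * \<gamma> * log_ratio (horizon I))) \<I>"
proof (rule exI[of _ 290], intro conjI allI impI)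
  fix \<alpha> \<beta> \<gamma> :: real and \<I> :: "inventory set"
  assume alpha: "1 \<le> \<alpha>"
    and I: "\<forall>I\<in>\<I>. inventory_problem I \<and> polynomial_holding \<alpha> I
       \<and> fractional_subadditive \<beta> (elems I) (order_cost I)"
    and lp: "LP_approx_in_poly_time \<gamma> \<I>"
  \<comment> \<open>The program and its running time may depend on \<alpha> through the built-in
    exponent; the constant 290 does not.\<close>
  show "IP_approx_in_poly_time (\<lambda>I. 290 * (\<alpha> * \<beta> * \<gamma> * log_ratio (horizon I))) \<I>"
    unfolding IP_approx_in_poly_time_def
  proof (rule poly_time_solvable_postprocess[OF lp[unfolded LP_approx_in_poly_time_def]
        poly_time_rounding[of "2 * nat \<lceil>\<alpha>\<rceil>"]])
    fix I v
    assume "I \<in> \<I>" and "\<exists>Y X. v = enc_solution Y X \<and> LP_approximate \<gamma> I (y_of Y) (x_of X)"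
    then show "\<exists>Y X. rounding (2 * nat \<lceil>\<alpha>\<rceil>) (pair (enc_inventory I) v) = enc_solution Y X
        \<and> IP_approximate (290 * (\<alpha> * \<beta> * \<gamma> * log_ratio (horizon I))) I (y_of Y) (x_of X)"
      using I rounding_correct[OF alpha] by blast
  qed
qed simp

end
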